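(* Let $R$ be a commutative rig in $\mathscr V$, and let $V$ be an object of $\mathscr V$. Then functional distributions on $V$ in the scalar $R$-linear context $(\mathscr V,\mathrm{Mat}_R,R)$ are the same as $R$-linear morphisms $\mu:[V,R]\to R$ in $\mathscr V$, and moreover $D_{(\mathrm{Mat}_R,R)}(V)=R\text{-Mod}([V,R],R)$.
   Context: $\mathscr V$ is a locally small cartesian closed category with equalizers, countable colimits, and intersections of countable families of strong subobjects; $\underline{\mathscr V}$ is $\mathscr V$ as a $\mathscr V$-category, with internal homs $\underline{\mathscr V}(V,W)$. Algebraic formulas below are to be read for generalized elements. \emph{Theories.} A theory (discretely finitary, enriched in $\mathscr V$) is a $\mathscr V$-category $\mathscr T$ whose objects are the natural numbers, equipped for each $n$ with morphisms $\pi_i:n\to1$ ($1\le i\le n$) exhibiting $n$ as a conical ($\mathscr V$-enriched) $n$-th power of $1$, with $\pi_1=\mathrm{id}$ if $n=1$. A $\mathscr T$-algebra is a $\mathscr V$-functor $A:\mathscr T\to\underline{\mathscr V}$ preserving conical finite powers, with carrier $|A|=A(1)$; it is normal if it sends the designated power $n$ of $1$ to the designated power $|A|^n$. $\mathscr T\text{-Alg}$ is the $\mathscr V$-category of $\mathscr T$-algebras, with hom-objects the objects of $\mathscr V$-natural transformations; it has pointwise cotensors $[V,A]$, with carrier $\underline{\mathscr V}(V,|A|)$. It is equivalent to its full sub-$\mathscr V$-category of normal $\mathscr T$-algebras. \emph{Commutant and functional distributions.} The commutant of $\mathscr T$ with respect to a $\mathscr T$-algebra $S$ is the theory $\mathscr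 T^\perp$ with $\mathscr T^\perp(n,m)=\mathscr T\text{-Alg}(S^n,S^m)$ and composition as in $\mathscr T\text{-Alg}$; $n\mapsto|S|^n$ is a $\mathscr T^\perp$-algebra with carrier $|S|$, again denoted $S$. A finitary functional-analytic context $(\mathscr V,\mathscr T,S)$ consists of $\mathscr V$, a commutative theory $\mathscr T$, and a $\mathscr T$-algebra $S$ such that $\mathscr T$ is saturated with respect to $S$ (i.e. canonically isomorphic to its double commutant with respect to $S$). In such a context, the object of functional distributions on $V\in\mathscr V$ is $D_{(\mathscr T,S)}(V)=\mathscr T^\perp\text{-Alg}([V,S],S)$, and functional distributions on $V$ are the $\mathscr T^\perp$-algebra homomorphisms $[V,S]\to S$. \emph{Rigs, modules.} A rig in $\mathscr V$ is an object $R$ with a commutative monoid structure $(+,0)$ and a monoid structure $(\bullet,1)$ in $\mathscr V$ such that $\bullet$ preserves $+$ and $0$ in each variable separately; it is commutative if $\bullet$ is. $R$-modules in $\mathscr V$ are commutative monoids in $\mathscr V$ with an associative unital $R$-action that preserves $+,0$ in each variable; $R\text{-Mod}$ is the $\mathscr V$-category of $R$-modules, in which $R\text{-Mod}(M,N)\hookrightarrow\underline{\mathscr V}(M,N)$ is the subobject of $R$-linear morphisms (the evident equalizer expressing preservation of $+$, $0$ and the action). $[V,R]$ is $\underline{\mathscr V}(V,R)$ with the pointwise $R$-module structure (the cotensor of $R$ by $V$). \emph{Scalar $R$-linear context.} $\mathrm{Mat}_R$ is the theory with $\mathrm{Mat}_R(n,m)=R^{m\times n}$, composition given by matrix multiplication,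 identities the identity matrices, and designated projections the standard basis row vectors. Its normal algebras are identified with the $R$-modules ($R$-module $M$ corresponding to the algebra in which $r\in R^{1\times n}$ acts by $x\mapsto\sum_ir_ix_i$, $M^n\to M$). For commutative $R$, $(\mathscr V,\mathrm{Mat}_R,R)$ is a finitary functional-analytic context, called the scalar $R$-linear context. *)

theory Defs
  imports Main
begin

section \<open>Categories\<close>

text \<open>
  Hom-classes are HOL sets, so every category in this sense is locally small.
\<close>

record ('o, 'a) cat =
  Ob :: "'o set"
  Ar :: "'a set"
  Dom :: "'a \<Rightarrow> 'o"
  Cod :: "'a \<Rightarrow> 'o"
  Ide :: "'o \<Rightarrow> 'a"
  Comp :: "'a \<Rightarrow> 'a \<Rightarrow> 'a" (infixr "\<cdot>\<index>" 75)

definition hom :: "('o, 'a, 'z) cat_scheme \<Rightarrow> 'o \<Rightarrow> 'o \<Rightarrow> 'a set" where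
  "hom C A B = {f \<in> Ar C. Dom C f = A \<and> Cod C f = B}"

locale category =
  fixes C :: "('o, 'a, 'z) cat_scheme" (structure)
  assumes dom_cod: "f \<in> Ar C \<Longrightarrow> Dom C f \<in> Ob C \<and> Cod C f \<in> Ob C"
    and ide_in_hom: "A \<in> Ob C \<Longrightarrow> Ide C A \<in> hom C A A"
    and comp_in_hom: "f \<in> hom C A B \<Longrightarrow> g \<in> hom C B D \<Longrightarrow> g \<cdot> f \<in> hom C A D"
    and ide_left: "f \<in> hom C A B \<Longrightarrow> Ide C B \<cdot> f = f"
    and ide_right: "f \<in> hom C A B \<Longrightarrow> f \<cdot> Ide C A = f"
    and comp_assoc: "f \<in> hom C A B \<Longrightarrow> g \<in> hom C B D \<Longrightarrow> h \<in> hom C D E \<Longrightarrow>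
      (h \<cdot> g) \<cdot> f = h \<cdot> (g \<cdot> f)"

definition is_iso :: "('o, 'a, 'z) cat_scheme \<Rightarrow> 'o \<Rightarrow> 'o \<Rightarrow> 'a \<Rightarrow> bool" where
  "is_iso C A B f \<longleftrightarrow> f \<in> hom C A B \<and>
    (\<exists>g \<in> hom C B A. g \<cdot>\<^bsub>C\<^esub> f = Ide C A \<and> f \<cdot>\<^bsub>C\<^esub> g = Ide C B)"

definition is_mono :: "('o, 'a, 'z) cat_scheme \<Rightarrow> 'o \<Rightarrow> 'o \<Rightarrow> 'a \<Rightarrow> bool" where
  "is_mono C A B m \<longleftrightarrow> m \<in> hom C A B \<and>
    (\<forall>X. \<forall>f \<in> hom C X A. \<forall>g \<in> hom C X A. m \<cdot>\<^bsub>C\<^esub> f = m \<cdot>\<^bsub>C\<^esub> g \<longrightarrow> f = g)"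

definition is_epi :: "('o, 'a, 'z) cat_scheme \<Rightarrow> 'o \<Rightarrow> 'o \<Rightarrow> 'a \<Rightarrow> bool" where
  "is_epi C A B e \<longleftrightarrow> e \<in> hom C A B \<and>
    (\<forall>X. \<forall>f \<in> hom C B X. \<forall>g \<in> hom C B X. f \<cdot>\<^bsub>C\<^esub> e = g \<cdot>\<^bsub>C\<^esub> e \<longrightarrow> f = g)"

definition is_strong_mono :: "('o, 'a, 'z) cat_scheme \<Rightarrow> 'o \<Rightarrow> 'o \<Rightarrow> 'a \<Rightarrow> bool" where
  "is_strong_mono C A B m \<longleftrightarrow> is_mono C A B m \<and>
    (\<forall>P Q e. is_epi C P Q e \<longrightarrow>
      (\<forall>u \<in> hom C P A. \<forall>v \<in> hom C Q B. m \<cdot>\<^bsub>C\<^esub> u = v \<cdot>\<^bsub>C\<^esub> e \<longrightarrow>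
        (\<exists>d \<in> hom C Q A. d \<cdot>\<^bsub>C\<^esub> e = u \<and> m \<cdot>\<^bsub>C\<^esub> d = v)))"

text \<open>
  The joint equalizer of a set of pairs of morphisms out of \<open>A\<close>; the pairs need not share a codomain.
\<close>

definition is_joint_equalizer ::
  "('o, 'a, 'z) cat_scheme \<Rightarrow> 'o \<Rightarrow> ('a \<times> 'a) set \<Rightarrow> 'o \<Rightarrow> 'a \<Rightarrow> bool" where
  "is_joint_equalizer C A P E e \<longleftrightarrow>
    e \<in> hom C E A \<and> (\<forall>(f, g) \<in> P. f \<cdot>\<^bsub>C\<^esub> e = g \<cdot>\<^bsub>C\<^esub> e) \<and>
    (\<forall>X. \<forall>h \<in> hom C X A. (\<forall>(f, g) \<in> P. f \<cdot>\<^bsub>C\<^esub> h = g \<cdot>\<^bsub>C\<^esub> h) \<longrightarrow>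
      (\<exists>!k. k \<in> hom C X E \<and> e \<cdot>\<^bsub>C\<^esub> k = h))"

definition has_equalizers :: "('o, 'a, 'z) cat_scheme \<Rightarrow> bool" where
  "has_equalizers C \<longleftrightarrow> (\<forall>A B. \<forall>f \<in> hom C A B. \<forall>g \<in> hom C A B.
    \<exists>E e. is_joint_equalizer C A {(f, g)} E e)"

definition is_intersection ::
  "('o, 'a, 'z) cat_scheme \<Rightarrow> 'o \<Rightarrow> 'i set \<Rightarrow> ('i \<Rightarrow> 'o) \<Rightarrow> ('i \<Rightarrow> 'a) \<Rightarrow> 'o \<Rightarrow> 'a \<Rightarrow> bool" where
  "is_intersection C B I A m K k \<longleftrightarrow>
    k \<in> hom C K B \<and> (\<forall>i \<in> I. \<exists>g \<in> hom C K (A i). m i \<cdot>\<^bsub>C\<^esub> g = k) \<and>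
    (\<forall>X. \<forall>f \<in> hom C X B. (\<forall>i \<in> I. \<exists>g \<in> hom C X (A i). m i \<cdot>\<^bsub>C\<^esub> g = f) \<longrightarrow>
      (\<exists>!h. h \<in> hom C X K \<and> k \<cdot>\<^bsub>C\<^esub> h = f))"

definition has_countable_strong_intersections :: "('o, 'a, 'z) cat_scheme \<Rightarrow> bool" where
  "has_countable_strong_intersections C \<longleftrightarrow>
    (\<forall>B \<in> Ob C. \<forall>(I :: nat set) A m. (\<forall>i \<in> I. is_strong_mono C (A i) B (m i)) \<longrightarrow>
      (\<exists>K k. is_intersection C B I A m K k))"

definition is_functor ::
  "('o, 'a, 'z) cat_scheme \<Rightarrow> ('p, 'b, 'y) cat_scheme \<Rightarrow> ('o \<Rightarrow> 'p) \<Rightarrow> ('a \<Rightarrow> 'b) \<Rightarrow> bool" where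
  "is_functor C D Fo Fa \<longleftrightarrow>
    (\<forall>A \<in> Ob C. Fo A \<in> Ob D \<and> Fa (Ide C A) = Ide D (Fo A)) \<and>
    (\<forall>A B. \<forall>f \<in> hom C A B. Fa f \<in> hom D (Fo A) (Fo B)) \<and>
    (\<forall>A B E. \<forall>f \<in> hom C A B. \<forall>g \<in> hom C B E. Fa (g \<cdot>\<^bsub>C\<^esub> f) = Fa g \<cdot>\<^bsub>D\<^esub> Fa f)"

definition is_cocone ::
  "('i, 'j, 'y) cat_scheme \<Rightarrow> ('o, 'a, 'z) cat_scheme \<Rightarrow> ('i \<Rightarrow> 'o) \<Rightarrow> ('j \<Rightarrow> 'a) \<Rightarrow> 'o \<Rightarrow>
    ('i \<Rightarrow> 'a) \<Rightarrow> bool" where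
  "is_cocone J C Fo Fa L leg \<longleftrightarrow> L \<in> Ob C \<and>
    (\<forall>i \<in> Ob J. leg i \<in> hom C (Fo i) L) \<and>
    (\<forall>i k. \<forall>j \<in> hom J i k. leg k \<cdot>\<^bsub>C\<^esub> Fa j = leg i)"

definition is_colimit ::
  "('i, 'j, 'y) cat_scheme \<Rightarrow> ('o, 'a, 'z) cat_scheme \<Rightarrow> ('i \<Rightarrow> 'o) \<Rightarrow> ('j \<Rightarrow> 'a) \<Rightarrow> 'o \<Rightarrow>
    ('i \<Rightarrow> 'a) \<Rightarrow> bool" where
  "is_colimit J C Fo Fa L leg \<longleftrightarrow> is_cocone J C Fo Fa L leg \<and>
    (\<forall>M leg'. is_cocone J C Fo Fa M leg' \<longrightarrow>
      (\<exists>!h. h \<in> hom C L M \<and> (\<forall>i \<in> Ob J. h \<cdot>\<^bsub>C\<^esub> leg i = leg' i)))"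

text \<open>
  Up to isomorphism, the countable categories are those whose objects and arrows are natural numbers.
\<close>

definition has_countable_colimits :: "('o, 'a, 'z) cat_scheme \<Rightarrow> bool" where
  "has_countable_colimits C \<longleftrightarrow>
    (\<forall>(J :: (nat, nat) cat) Fo Fa. category J \<longrightarrow> is_functor J C Fo Fa \<longrightarrow>
      (\<exists>L leg. is_colimit J C Fo Fa L leg))"


section \<open>Cartesian closed categories with designated structure\<close>

record ('o, 'a) ccc = "('o, 'a) cat" +
  Tml :: 'o
  Prod :: "'o \<Rightarrow> 'o \<Rightarrow> 'o"
  Fst :: "'o \<Rightarrow> 'o \<Rightarrow> 'a"
  Snd :: "'o \<Rightarrow> 'o \<Rightarrow> 'a"
  Exp :: "'o \<Rightarrow> 'o \<Rightarrow> 'o"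
  Ev :: "'o \<Rightarrow> 'o \<Rightarrow> 'a"

definition bang :: "('o, 'a) ccc \<Rightarrow> 'o \<Rightarrow> 'a" where
  "bang V X = (THE f. f \<in> hom V X (Tml V))"

definition pair :: "('o, 'a) ccc \<Rightarrow> 'a \<Rightarrow> 'a \<Rightarrow> 'a" ("\<langle>_, _\<rangle>\<index>") where
  "pair V f g = (THE h. h \<in> hom V (Dom V f) (Prod V (Cod V f) (Cod V g)) \<and>
    Fst V (Cod V f) (Cod V g) \<cdot>\<^bsub>V\<^esub> h = f \<and> Snd V (Cod V f) (Cod V g) \<cdot>\<^bsub>V\<^esub> h = g)"

text \<open>
  \<open>Exp V A B\<close> is the internal hom from \<open>A\<close> to \<open>B\<close>, with evaluation
  \<open>Ev V A B : Exp V A B \<times> A \<rightarrow> B\<close>.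
\<close>

locale cartesian_closed = category V for V :: "('o, 'a) ccc" (structure) +
  assumes tml: "Tml V \<in> Ob V" "X \<in> Ob V \<Longrightarrow> \<exists>!f. f \<in> hom V X (Tml V)"
    and prod: "A \<in> Ob V \<Longrightarrow> B \<in> Ob V \<Longrightarrow> Prod V A B \<in> Ob V"
      "A \<in> Ob V \<Longrightarrow> B \<in> Ob V \<Longrightarrow> Fst V A B \<in> hom V (Prod V A B) A"
      "A \<in> Ob V \<Longrightarrow> B \<in> Ob V \<Longrightarrow> Snd V A B \<in> hom V (Prod V A B) B"
      "f \<in> hom V X A \<Longrightarrow> g \<in> hom V X B \<Longrightarrow>
        \<exists>!h. h \<in> hom V X (Prod V A B) \<and> Fst V A B \<cdot> h = f \<and> Snd V A B \<cdot> h = g"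
    and exp: "A \<in> Ob V \<Longrightarrow> B \<in> Ob V \<Longrightarrow> Exp V A B \<in> Ob V"
      "A \<in> Ob V \<Longrightarrow> B \<in> Ob V \<Longrightarrow> Ev V A B \<in> hom V (Prod V (Exp V A B) A) B"
      "X \<in> Ob V \<Longrightarrow> A \<in> Ob V \<Longrightarrow> f \<in> hom V (Prod V X A) B \<Longrightarrow>
        \<exists>!g. g \<in> hom V X (Exp V A B) \<and> Ev V A B \<cdot> \<langle>g \<cdot> Fst V X A, Snd V X A\<rangle> = f"

locale enrichment_base = cartesian_closed +
  assumes equalizers: "has_equalizers V"
    and countable_colimits: "has_countable_colimits V"
    and strong_intersections: "has_countable_strong_intersections V"

definition curry :: "('o, 'a) ccc \<Rightarrow> 'o \<Rightarrow> 'o \<Rightarrow> 'a \<Rightarrow> 'a" where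
  "curry V X A f = (THE g. g \<in> hom V X (Exp V A (Cod V f)) \<and>
    Ev V A (Cod V f) \<cdot>\<^bsub>V\<^esub> \<langle>g \<cdot>\<^bsub>V\<^esub> Fst V X A, Snd V X A\<rangle>\<^bsub>V\<^esub> = f)"

text \<open>The global element of \<open>Exp V A B\<close> named by a morphism \<open>f : A \<rightarrow> B\<close>.\<close>

definition name :: "('o, 'a) ccc \<Rightarrow> 'a \<Rightarrow> 'a" where
  "name V f = curry V (Tml V) (Dom V f) (f \<cdot>\<^bsub>V\<^esub> Snd V (Tml V) (Dom V f))"

text \<open>
  Designated finite powers \<open>A\<^sup>n\<close>, with \<open>A\<^sup>1 = A\<close>. Here and below, the factors of a power,
  and the rows and columns of a matrix, are numbered from \<open>0\<close>.
\<close>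

fun npow :: "('o, 'a) ccc \<Rightarrow> 'o \<Rightarrow> nat \<Rightarrow> 'o" where
  "npow V A 0 = Tml V"
| "npow V A (Suc 0) = A"
| "npow V A (Suc (Suc n)) = Prod V (npow V A (Suc n)) A"

fun nproj :: "('o, 'a) ccc \<Rightarrow> 'o \<Rightarrow> nat \<Rightarrow> nat \<Rightarrow> 'a" where
  "nproj V A 0 i = undefined"
| "nproj V A (Suc 0) i = Ide V A"
| "nproj V A (Suc (Suc n)) i =
    (if i = Suc n then Snd V (npow V A (Suc n)) A
     else nproj V A (Suc n) i \<cdot>\<^bsub>V\<^esub> Fst V (npow V A (Suc n)) A)"

definition ntuple :: "('o, 'a) ccc \<Rightarrow> 'o \<Rightarrow> 'o \<Rightarrow> nat \<Rightarrow> (nat \<Rightarrow> 'a) \<Rightarrow> 'a" where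
  "ntuple V X A n f =
    (THE h. h \<in> hom V X (npow V A n) \<and> (\<forall>i<n. nproj V A n i \<cdot>\<^bsub>V\<^esub> h = f i))"


section \<open>Enriched categories\<close>

text \<open>\<open>VComp K a b c : VHom K b c \<times> VHom K a b \<rightarrow> VHom K a c\<close>.\<close>

record ('c, 'o, 'a) vcat =
  VOb :: "'c set"
  VHom :: "'c \<Rightarrow> 'c \<Rightarrow> 'o"
  VComp :: "'c \<Rightarrow> 'c \<Rightarrow> 'c \<Rightarrow> 'a"
  VId :: "'c \<Rightarrow> 'a"

text \<open>Composition and identities of generalized elements of the hom-objects.\<close>

definition vc :: "('o, 'a) ccc \<Rightarrow> ('c, 'o, 'a, 'z) vcat_scheme \<Rightarrow> 'c \<Rightarrow> 'c \<Rightarrow> 'c \<Rightarrow> 'a \<Rightarrow> 'a \<Rightarrow> 'a" where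
  "vc V K a b c g f = VComp K a b c \<cdot>\<^bsub>V\<^esub> \<langle>g, f\<rangle>\<^bsub>V\<^esub>"

definition vid :: "('o, 'a) ccc \<Rightarrow> ('c, 'o, 'a, 'z) vcat_scheme \<Rightarrow> 'o \<Rightarrow> 'c \<Rightarrow> 'a" where
  "vid V K X a = VId K a \<cdot>\<^bsub>V\<^esub> bang V X"

definition is_vcategory :: "('o, 'a) ccc \<Rightarrow> ('c, 'o, 'a, 'z) vcat_scheme \<Rightarrow> bool" where
  "is_vcategory V K \<longleftrightarrow>
    (\<forall>a \<in> VOb K. \<forall>b \<in> VOb K. VHom K a b \<in> Ob V) \<and>
    (\<forall>a \<in> VOb K. VId K a \<in> hom V (Tml V) (VHom K a a)) \<and>
    (\<forall>a \<in> VOb K. \<forall>b \<in> VOb K. \<forall>c \<in> VOb K.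
      VComp K a b c \<in> hom V (Prod V (VHom K b c) (VHom K a b)) (VHom K a c)) \<and>
    (\<forall>a \<in> VOb K. \<forall>b \<in> VOb K. \<forall>X \<in> Ob V. \<forall>f \<in> hom V X (VHom K a b).
      vc V K a a b f (vid V K X a) = f \<and> vc V K a b b (vid V K X b) f = f) \<and>
    (\<forall>a \<in> VOb K. \<forall>b \<in> VOb K. \<forall>c \<in> VOb K. \<forall>d \<in> VOb K. \<forall>X \<in> Ob V.
      \<forall>f \<in> hom V X (VHom K a b). \<forall>g \<in> hom V X (VHom K b c). \<forall>h \<in> hom V X (VHom K c d).
      vc V K a b d (vc V K b c d h g) f = vc V K a c d h (vc V K a b c g f))"

definition selfv :: "('o, 'a) ccc \<Rightarrow> ('o, 'o, 'a) vcat" where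
  "selfv V = \<lparr>
    VOb = Ob V,
    VHom = Exp V,
    VComp = (\<lambda>A B C. let E = Exp V B C; F = Exp V A B; P = Prod V E F in
      curry V P A (Ev V B C \<cdot>\<^bsub>V\<^esub>
        \<langle>Fst V E F \<cdot>\<^bsub>V\<^esub> Fst V P A,
         Ev V A B \<cdot>\<^bsub>V\<^esub> \<langle>Snd V E F \<cdot>\<^bsub>V\<^esub> Fst V P A, Snd V P A\<rangle>\<^bsub>V\<^esub>\<rangle>\<^bsub>V\<^esub>)),
    VId = (\<lambda>A. name V (Ide V A))\<rparr>"

record ('c, 'd, 'a) vfunctor =
  FOb :: "'c \<Rightarrow> 'd"
  FHom :: "'c \<Rightarrow> 'c \<Rightarrow> 'a"

definition is_vfunctor :: "('o, 'a) ccc \<Rightarrow> ('c, 'o, 'a, 'z) vcat_scheme \<Rightarrow>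
    ('d, 'o, 'a, 'y) vcat_scheme \<Rightarrow> ('c, 'd, 'a) vfunctor \<Rightarrow> bool" where
  "is_vfunctor V K L F \<longleftrightarrow>
    (\<forall>a \<in> VOb K. FOb F a \<in> VOb L) \<and>
    (\<forall>a \<in> VOb K. \<forall>b \<in> VOb K. FHom F a b \<in> hom V (VHom K a b) (VHom L (FOb F a) (FOb F b))) \<and>
    (\<forall>a \<in> VOb K. FHom F a a \<cdot>\<^bsub>V\<^esub> VId K a = VId L (FOb F a)) \<and>
    (\<forall>a \<in> VOb K. \<forall>b \<in> VOb K. \<forall>c \<in> VOb K. \<forall>X \<in> Ob V.
      \<forall>f \<in> hom V X (VHom K a b). \<forall>g \<in> hom V X (VHom K b c).
      FHom F a c \<cdot>\<^bsub>V\<^esub> vc V K a b c g f =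
        vc V L (FOb F a) (FOb F b) (FOb F c) (FHom F b c \<cdot>\<^bsub>V\<^esub> g) (FHom F a b \<cdot>\<^bsub>V\<^esub> f))"

text \<open>
  The morphisms \<open>q i : p \<rightarrow> c\<close> (\<open>i < n\<close>) of the enriched category \<open>K\<close> exhibit \<open>p\<close> as a conical
  \<open>n\<close>-th power of \<open>c\<close>, i.e. induce isomorphisms \<open>K(a,p) \<cong> K(a,c)\<^sup>n\<close> in \<open>V\<close>.
\<close>

definition is_conical_power :: "('o, 'a) ccc \<Rightarrow> ('c, 'o, 'a, 'z) vcat_scheme \<Rightarrow>
    nat \<Rightarrow> 'c \<Rightarrow> 'c \<Rightarrow> (nat \<Rightarrow> 'a) \<Rightarrow> bool" where
  "is_conical_power V K n p c q \<longleftrightarrow> p \<in> VOb K \<and> c \<in> VOb K \<and>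
    (\<forall>i<n. q i \<in> hom V (Tml V) (VHom K p c)) \<and>
    (\<forall>a \<in> VOb K. \<forall>X \<in> Ob V. \<forall>f. (\<forall>i<n. f i \<in> hom V X (VHom K a c)) \<longrightarrow>
      (\<exists>!h. h \<in> hom V X (VHom K a p) \<and>
        (\<forall>i<n. vc V K a p c (q i \<cdot>\<^bsub>V\<^esub> bang V X) h = f i)))"


section \<open>Theories and their algebras\<close>

record ('o, 'a) thy = "(nat, 'o, 'a) vcat" +
  Pr :: "nat \<Rightarrow> nat \<Rightarrow> 'a"

definition is_theory :: "('o, 'a) ccc \<Rightarrow> ('o, 'a) thy \<Rightarrow> bool" where
  "is_theory V T \<longleftrightarrow> is_vcategory V T \<and> VOb T = UNIV \<and>
    (\<forall>n. is_conical_power V T n n 1 (Pr T n)) \<and> Pr T 1 0 = VId T 1"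

type_synonym ('o, 'a) alg = "(nat, 'o, 'a) vfunctor"

definition is_algebra :: "('o, 'a) ccc \<Rightarrow> ('o, 'a) thy \<Rightarrow> ('o, 'a) alg \<Rightarrow> bool" where
  "is_algebra V T A \<longleftrightarrow> is_theory V T \<and> is_vfunctor V T (selfv V) A \<and>
    (\<forall>n p c q. is_conical_power V T n p c q \<longrightarrow>
      is_conical_power V (selfv V) n (FOb A p) (FOb A c) (\<lambda>i. FHom A p c \<cdot>\<^bsub>V\<^esub> q i))"

text \<open>
  A family \<open>l n : X \<rightarrow> Exp V (A n) (B n)\<close> that is natural in \<open>n\<close> in the enriched sense, i.e. a wedge
  for the end of the objects \<open>Exp V (A n) (B n)\<close>.
\<close>

definition is_natural_family ::
  "('o, 'a) ccc \<Rightarrow> ('o, 'a) thy \<Rightarrow> ('o, 'a) alg \<Rightarrow> ('o, 'a) alg \<Rightarrow> 'o \<Rightarrow> (nat \<Rightarrow> 'a) \<Rightarrow> bool" where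
  "is_natural_family V T A B X l \<longleftrightarrow>
    (\<forall>n. l n \<in> hom V X (Exp V (FOb A n) (FOb B n))) \<and>
    (\<forall>n m Y. \<forall>e \<in> hom V Y X. \<forall>t \<in> hom V Y (VHom T n m).
      vc V (selfv V) (FOb A n) (FOb B n) (FOb B m) (FHom B n m \<cdot>\<^bsub>V\<^esub> t) (l n \<cdot>\<^bsub>V\<^esub> e) =
      vc V (selfv V) (FOb A n) (FOb A m) (FOb B m) (l m \<cdot>\<^bsub>V\<^esub> e) (FHom A n m \<cdot>\<^bsub>V\<^esub> t))"

definition is_algebra_hom ::
  "('o, 'a) ccc \<Rightarrow> ('o, 'a) thy \<Rightarrow> ('o, 'a) alg \<Rightarrow> ('o, 'a) alg \<Rightarrow> (nat \<Rightarrow> 'a) \<Rightarrow> bool" where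
  "is_algebra_hom V T A B \<alpha> \<longleftrightarrow> is_algebra V T A \<and> is_algebra V T B \<and>
    (\<forall>n. \<alpha> n \<in> hom V (FOb A n) (FOb B n)) \<and>
    is_natural_family V T A B (Tml V) (\<lambda>n. name V (\<alpha> n))"

text \<open>
  The object of enriched natural transformations from \<open>A\<close> to \<open>B\<close>, with its projections
  \<open>l n : E \<rightarrow> Exp V (A n) (B n)\<close>: the end of the objects \<open>Exp V (A n) (B n)\<close>.
\<close>

definition is_alg_obj ::
  "('o, 'a) ccc \<Rightarrow> ('o, 'a) thy \<Rightarrow> ('o, 'a) alg \<Rightarrow> ('o, 'a) alg \<Rightarrow> 'o \<times> (nat \<Rightarrow> 'a) \<Rightarrow> bool" where
  "is_alg_obj V T A B = (\<lambda>(E, l). E \<in> Ob V \<and> is_natural_family V T A B E l \<and>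
    (\<forall>X \<in> Ob V. \<forall>k. is_natural_family V T A B X k \<longrightarrow>
      (\<exists>!h. h \<in> hom V X E \<and> (\<forall>n. l n \<cdot>\<^bsub>V\<^esub> h = k n))))"

text \<open>
  As the category of \<open>T\<close>-algebras is a full subcategory of the enriched functors, its hom-object is
  the end above, chosen here once for each pair of algebras.
\<close>

definition alg_obj :: "('o, 'a) ccc \<Rightarrow> ('o, 'a) thy \<Rightarrow> ('o, 'a) alg \<Rightarrow> ('o, 'a) alg \<Rightarrow> 'o" where
  "alg_obj V T A B = fst (SOME p. is_alg_obj V T A B p)"

definition alg_pr :: "('o, 'a) ccc \<Rightarrow> ('o, 'a) thy \<Rightarrow> ('o, 'a) alg \<Rightarrow> ('o, 'a) alg \<Rightarrow> nat \<Rightarrow> 'a" where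
  "alg_pr V T A B = snd (SOME p. is_alg_obj V T A B p)"

definition alg_in :: "('o, 'a) ccc \<Rightarrow> ('o, 'a) thy \<Rightarrow> ('o, 'a) alg \<Rightarrow> ('o, 'a) alg \<Rightarrow>
    'o \<Rightarrow> (nat \<Rightarrow> 'a) \<Rightarrow> 'a" where
  "alg_in V T A B X k =
    (THE h. h \<in> hom V X (alg_obj V T A B) \<and> (\<forall>n. alg_pr V T A B n \<cdot>\<^bsub>V\<^esub> h = k n))"

definition power_alg :: "('o, 'a) ccc \<Rightarrow> ('o, 'a) thy \<Rightarrow> ('o, 'a) alg \<Rightarrow> nat \<Rightarrow> ('o, 'a) alg" where
  "power_alg V T A n = \<lparr>
    FOb = (\<lambda>k. npow V (FOb A k) n),
    FHom = (\<lambda>k l. let H = VHom T k l; Q = npow V (FOb A k) n; P = Prod V H Q in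
      curry V H Q (ntuple V P (FOb A l) n (\<lambda>i.
        Ev V (FOb A k) (FOb A l) \<cdot>\<^bsub>V\<^esub>
          \<langle>FHom A k l \<cdot>\<^bsub>V\<^esub> Fst V H Q, nproj V (FOb A k) n i \<cdot>\<^bsub>V\<^esub> Snd V H Q\<rangle>\<^bsub>V\<^esub>)))\<rparr>"

definition cotensor_alg :: "('o, 'a) ccc \<Rightarrow> ('o, 'a) thy \<Rightarrow> 'o \<Rightarrow> ('o, 'a) alg \<Rightarrow> ('o, 'a) alg" where
  "cotensor_alg V T X A = \<lparr>
    FOb = (\<lambda>k. Exp V X (FOb A k)),
    FHom = (\<lambda>k l. let H = VHom T k l; Q = Exp V X (FOb A k); P = Prod V H Q in
      curry V H Q (curry V P X (
        Ev V (FOb A k) (FOb A l) \<cdot>\<^bsub>V\<^esub>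
          \<langle>FHom A k l \<cdot>\<^bsub>V\<^esub> Fst V H Q \<cdot>\<^bsub>V\<^esub> Fst V P X,
           Ev V X (FOb A k) \<cdot>\<^bsub>V\<^esub> \<langle>Snd V H Q \<cdot>\<^bsub>V\<^esub> Fst V P X, Snd V P X\<rangle>\<^bsub>V\<^esub>\<rangle>\<^bsub>V\<^esub>)))\<rparr>"


section \<open>Commutants and functional distributions\<close>

definition commutant :: "('o, 'a) ccc \<Rightarrow> ('o, 'a) thy \<Rightarrow> ('o, 'a) alg \<Rightarrow> ('o, 'a) thy" where
  "commutant V T S = \<lparr>
    VOb = UNIV,
    VHom = (\<lambda>n m. alg_obj V T (power_alg V T S n) (power_alg V T S m)),
    VComp = (\<lambda>n m k. let
        A = power_alg V T S n; B = power_alg V T S m; C = power_alg V T S k;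
        G = alg_obj V T B C; F = alg_obj V T A B
      in alg_in V T A C (Prod V G F) (\<lambda>j.
        vc V (selfv V) (FOb A j) (FOb B j) (FOb C j)
          (alg_pr V T B C j \<cdot>\<^bsub>V\<^esub> Fst V G F) (alg_pr V T A B j \<cdot>\<^bsub>V\<^esub> Snd V G F))),
    VId = (\<lambda>n. let A = power_alg V T S n in
      alg_in V T A A (Tml V) (\<lambda>j. VId (selfv V) (FOb A j))),
    Pr = (\<lambda>n i. alg_in V T (power_alg V T S n) (power_alg V T S 1) (Tml V)
      (\<lambda>j. name V (nproj V (FOb S j) n i)))\<rparr>"

text \<open>\<open>S\<close> as an algebra \<open>n \<mapsto> |S|\<^sup>n\<close> of its commutant.\<close>

definition commutant_alg :: "('o, 'a) ccc \<Rightarrow> ('o, 'a) thy \<Rightarrow> ('o, 'a) alg \<Rightarrow> ('o, 'a) alg" where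
  "commutant_alg V T S = \<lparr>
    FOb = (\<lambda>n. npow V (FOb S 1) n),
    FHom = (\<lambda>n m. alg_pr V T (power_alg V T S n) (power_alg V T S m) 1)\<rparr>"

definition functional_distributions ::
  "('o, 'a) ccc \<Rightarrow> ('o, 'a) thy \<Rightarrow> ('o, 'a) alg \<Rightarrow> 'o \<Rightarrow> (nat \<Rightarrow> 'a) set" where
  "functional_distributions V T S X = (let T' = commutant V T S; S' = commutant_alg V T S in
    {\<mu>. is_algebra_hom V T' (cotensor_alg V T' X S') S' \<mu>})"

definition distribution_obj :: "('o, 'a) ccc \<Rightarrow> ('o, 'a) thy \<Rightarrow> ('o, 'a) alg \<Rightarrow> 'o \<Rightarrow> 'o" where
  "distribution_obj V T S X = (let T' = commutant V T S; S' = commutant_alg V T S in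
    alg_obj V T' (cotensor_alg V T' X S') S')"

text \<open>
  The canonical morphism from the object of functional distributions to the internal hom
  \<open>Exp V |[X,S]| |S|\<close> of carriers.
\<close>

definition distribution_incl :: "('o, 'a) ccc \<Rightarrow> ('o, 'a) thy \<Rightarrow> ('o, 'a) alg \<Rightarrow> 'o \<Rightarrow> 'a" where
  "distribution_incl V T S X = (let T' = commutant V T S; S' = commutant_alg V T S in
    alg_pr V T' (cotensor_alg V T' X S') S' 1)"


section \<open>Rigs and modules\<close>

record ('o, 'a) cmonoid =
  Car :: 'o
  Add :: 'a
  Zero :: 'a

record ('o, 'a) rig = "('o, 'a) cmonoid" +
  Mul :: 'a
  One :: 'a

record ('o, 'a) rmodule = "('o, 'a) cmonoid" +
  Act :: 'a

definition is_cmonoid :: "('o, 'a) ccc \<Rightarrow> ('o, 'a, 'z) cmonoid_scheme \<Rightarrow> bool" where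
  "is_cmonoid V M \<longleftrightarrow> (let add = \<lambda>x y. Add M \<cdot>\<^bsub>V\<^esub> \<langle>x, y\<rangle>\<^bsub>V\<^esub> in
    Car M \<in> Ob V \<and> Add M \<in> hom V (Prod V (Car M) (Car M)) (Car M) \<and>
    Zero M \<in> hom V (Tml V) (Car M) \<and>
    (\<forall>X \<in> Ob V. \<forall>x \<in> hom V X (Car M). \<forall>y \<in> hom V X (Car M). \<forall>z \<in> hom V X (Car M).
      add (add x y) z = add x (add y z) \<and> add x y = add y x \<and>
      add (Zero M \<cdot>\<^bsub>V\<^esub> bang V X) x = x))"

definition is_rig :: "('o, 'a) ccc \<Rightarrow> ('o, 'a) rig \<Rightarrow> bool" where
  "is_rig V R \<longleftrightarrow> (let
      add = \<lambda>x y. Add R \<cdot>\<^bsub>V\<^esub> \<langle>x, y\<rangle>\<^bsub>V\<^esub>;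
      mul = \<lambda>x y. Mul R \<cdot>\<^bsub>V\<^esub> \<langle>x, y\<rangle>\<^bsub>V\<^esub>
    in
    is_cmonoid V R \<and>
    Mul R \<in> hom V (Prod V (Car R) (Car R)) (Car R) \<and> One R \<in> hom V (Tml V) (Car R) \<and>
    (\<forall>X \<in> Ob V. \<forall>x \<in> hom V X (Car R). \<forall>y \<in> hom V X (Car R). \<forall>z \<in> hom V X (Car R). let
        zero = Zero R \<cdot>\<^bsub>V\<^esub> bang V X; one = One R \<cdot>\<^bsub>V\<^esub> bang V X
      in
      mul (mul x y) z = mul x (mul y z) \<and> mul one x = x \<and> mul x one = x \<and>
      mul (add x y) z = add (mul x z) (mul y z) \<and> mul x (add y z) = add (mul x y) (mul x z) \<and>
      mul zero x = zero \<and> mul x zero = zero))"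

definition is_comm_rig :: "('o, 'a) ccc \<Rightarrow> ('o, 'a) rig \<Rightarrow> bool" where
  "is_comm_rig V R \<longleftrightarrow> is_rig V R \<and>
    (\<forall>X \<in> Ob V. \<forall>x \<in> hom V X (Car R). \<forall>y \<in> hom V X (Car R).
      Mul R \<cdot>\<^bsub>V\<^esub> \<langle>x, y\<rangle>\<^bsub>V\<^esub> = Mul R \<cdot>\<^bsub>V\<^esub> \<langle>y, x\<rangle>\<^bsub>V\<^esub>)"

definition is_rmodule :: "('o, 'a) ccc \<Rightarrow> ('o, 'a) rig \<Rightarrow> ('o, 'a) rmodule \<Rightarrow> bool" where
  "is_rmodule V R M \<longleftrightarrow> (let
      radd = \<lambda>x y. Add R \<cdot>\<^bsub>V\<^esub> \<langle>x, y\<rangle>\<^bsub>V\<^esub>;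
      mul = \<lambda>x y. Mul R \<cdot>\<^bsub>V\<^esub> \<langle>x, y\<rangle>\<^bsub>V\<^esub>;
      add = \<lambda>x y. Add M \<cdot>\<^bsub>V\<^esub> \<langle>x, y\<rangle>\<^bsub>V\<^esub>;
      act = \<lambda>r x. Act M \<cdot>\<^bsub>V\<^esub> \<langle>r, x\<rangle>\<^bsub>V\<^esub>
    in
    is_rig V R \<and> is_cmonoid V M \<and> Act M \<in> hom V (Prod V (Car R) (Car M)) (Car M) \<and>
    (\<forall>X \<in> Ob V. \<forall>r \<in> hom V X (Car R). \<forall>s \<in> hom V X (Car R).
      \<forall>x \<in> hom V X (Car M). \<forall>y \<in> hom V X (Car M). let
        zero = Zero M \<cdot>\<^bsub>V\<^esub> bang V X
      in
      act (mul r s) x = act r (act s x) \<and> act (One R \<cdot>\<^bsub>V\<^esub> bang V X) x = x \<and>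
      act (radd r s) x = add (act r x) (act s x) \<and> act r (add x y) = add (act r x) (act r y) \<and>
      act (Zero R \<cdot>\<^bsub>V\<^esub> bang V X) x = zero \<and> act r zero = zero))"

definition is_linear :: "('o, 'a) ccc \<Rightarrow> ('o, 'a) rig \<Rightarrow> ('o, 'a) rmodule \<Rightarrow>
    ('o, 'a) rmodule \<Rightarrow> 'a \<Rightarrow> bool" where
  "is_linear V R M N f \<longleftrightarrow> (let A = Car M; K = Car R in
    is_rmodule V R M \<and> is_rmodule V R N \<and> f \<in> hom V A (Car N) \<and>
    f \<cdot>\<^bsub>V\<^esub> Add M = Add N \<cdot>\<^bsub>V\<^esub> \<langle>f \<cdot>\<^bsub>V\<^esub> Fst V A A, f \<cdot>\<^bsub>V\<^esub> Snd V A A\<rangle>\<^bsub>V\<^esub> \<and>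
    f \<cdot>\<^bsub>V\<^esub> Zero M = Zero N \<and>
    f \<cdot>\<^bsub>V\<^esub> Act M = Act N \<cdot>\<^bsub>V\<^esub> \<langle>Fst V K A, f \<cdot>\<^bsub>V\<^esub> Snd V K A\<rangle>\<^bsub>V\<^esub>)"

text \<open>
  The three pairs of morphisms out of \<open>Exp V |M| |N|\<close> expressing, respectively, that a generalized
  element preserves addition, zero and the action of \<open>R\<close>.
\<close>

definition linearity_pairs :: "('o, 'a) ccc \<Rightarrow> ('o, 'a) rig \<Rightarrow> ('o, 'a) rmodule \<Rightarrow>
    ('o, 'a) rmodule \<Rightarrow> ('a \<times> 'a) set" where
  "linearity_pairs V R M N = (let
      A = Car M; B = Car N; K = Car R; E = Exp V A B;
      AA = Prod V A A; KA = Prod V K A;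
      app = \<lambda>f x. Ev V A B \<cdot>\<^bsub>V\<^esub> \<langle>f, x\<rangle>\<^bsub>V\<^esub>
    in {
      (curry V E AA (app (Fst V E AA) (Add M \<cdot>\<^bsub>V\<^esub> Snd V E AA)),
       curry V E AA (Add N \<cdot>\<^bsub>V\<^esub>
         \<langle>app (Fst V E AA) (Fst V A A \<cdot>\<^bsub>V\<^esub> Snd V E AA),
          app (Fst V E AA) (Snd V A A \<cdot>\<^bsub>V\<^esub> Snd V E AA)\<rangle>\<^bsub>V\<^esub>)),
      (app (Ide V E) (Zero M \<cdot>\<^bsub>V\<^esub> bang V E),
       Zero N \<cdot>\<^bsub>V\<^esub> bang V E),
      (curry V E KA (app (Fst V E KA) (Act M \<cdot>\<^bsub>V\<^esub> Snd V E KA)),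
       curry V E KA (Act N \<cdot>\<^bsub>V\<^esub>
         \<langle>Fst V K A \<cdot>\<^bsub>V\<^esub> Snd V E KA,
          app (Fst V E KA) (Snd V K A \<cdot>\<^bsub>V\<^esub> Snd V E KA)\<rangle>\<^bsub>V\<^esub>))})"

definition is_linear_obj :: "('o, 'a) ccc \<Rightarrow> ('o, 'a) rig \<Rightarrow> ('o, 'a) rmodule \<Rightarrow>
    ('o, 'a) rmodule \<Rightarrow> 'o \<times> 'a \<Rightarrow> bool" where
  "is_linear_obj V R M N = (\<lambda>(L, j).
    is_joint_equalizer V (Exp V (Car M) (Car N)) (linearity_pairs V R M N) L j)"

definition linear_obj :: "('o, 'a) ccc \<Rightarrow> ('o, 'a) rig \<Rightarrow> ('o, 'a) rmodule \<Rightarrow>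
    ('o, 'a) rmodule \<Rightarrow> 'o" where
  "linear_obj V R M N = fst (SOME p. is_linear_obj V R M N p)"

definition linear_incl :: "('o, 'a) ccc \<Rightarrow> ('o, 'a) rig \<Rightarrow> ('o, 'a) rmodule \<Rightarrow>
    ('o, 'a) rmodule \<Rightarrow> 'a" where
  "linear_incl V R M N = snd (SOME p. is_linear_obj V R M N p)"

definition rig_module :: "('o, 'a) rig \<Rightarrow> ('o, 'a) rmodule" where
  "rig_module R = \<lparr>Car = Car R, Add = Add R, Zero = Zero R, Act = Mul R\<rparr>"

definition cotensor_module :: "('o, 'a) ccc \<Rightarrow> ('o, 'a) rig \<Rightarrow> 'o \<Rightarrow> ('o, 'a) rmodule \<Rightarrow>
    ('o, 'a) rmodule" where
  "cotensor_module V R X M = (let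
      A = Car M; K = Car R; E = Exp V X A; EE = Prod V E E; KE = Prod V K E;
      app = \<lambda>f x. Ev V X A \<cdot>\<^bsub>V\<^esub> \<langle>f, x\<rangle>\<^bsub>V\<^esub>
    in \<lparr>
      Car = E,
      Add = curry V EE X (Add M \<cdot>\<^bsub>V\<^esub>
        \<langle>app (Fst V E E \<cdot>\<^bsub>V\<^esub> Fst V EE X) (Snd V EE X),
         app (Snd V E E \<cdot>\<^bsub>V\<^esub> Fst V EE X) (Snd V EE X)\<rangle>\<^bsub>V\<^esub>),
      Zero = curry V (Tml V) X (Zero M \<cdot>\<^bsub>V\<^esub> Fst V (Tml V) X),
      Act = curry V KE X (Act M \<cdot>\<^bsub>V\<^esub>
        \<langle>Fst V K E \<cdot>\<^bsub>V\<^esub> Fst V KE X,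
         app (Snd V K E \<cdot>\<^bsub>V\<^esub> Fst V KE X) (Snd V KE X)\<rangle>\<^bsub>V\<^esub>)\<rparr>)"


section \<open>Matrices over a rig\<close>

text \<open>\<open>vsum V M X f n\<close> is the sum of the generalized elements \<open>f 0, \<dots>, f (n - 1) : X \<rightarrow> |M|\<close>.\<close>

primrec vsum :: "('o, 'a) ccc \<Rightarrow> ('o, 'a, 'z) cmonoid_scheme \<Rightarrow> 'o \<Rightarrow> (nat \<Rightarrow> 'a) \<Rightarrow> nat \<Rightarrow> 'a" where
  "vsum V M X f 0 = Zero M \<cdot>\<^bsub>V\<^esub> bang V X"
| "vsum V M X f (Suc n) = Add M \<cdot>\<^bsub>V\<^esub> \<langle>vsum V M X f n, f n\<rangle>\<^bsub>V\<^esub>"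

text \<open>
  The object of \<open>m \<times> n\<close> matrices is the power \<open>(R\<^sup>n)\<^sup>m\<close>, i.e. \<open>m\<close> rows of length \<open>n\<close>; in particular
  the object of \<open>1 \<times> n\<close> matrices is \<open>R\<^sup>n\<close>.
\<close>

definition matrix_obj :: "('o, 'a) ccc \<Rightarrow> ('o, 'a) rig \<Rightarrow> nat \<Rightarrow> nat \<Rightarrow> 'o" where
  "matrix_obj V R m n = npow V (npow V (Car R) n) m"

definition entry :: "('o, 'a) ccc \<Rightarrow> ('o, 'a) rig \<Rightarrow> nat \<Rightarrow> nat \<Rightarrow> nat \<Rightarrow> nat \<Rightarrow> 'a" where
  "entry V R m n i j = nproj V (Car R) n j \<cdot>\<^bsub>V\<^esub> nproj V (npow V (Car R) n) m i"

definition matrix :: "('o, 'a) ccc \<Rightarrow> ('o, 'a) rig \<Rightarrow> 'o \<Rightarrow> nat \<Rightarrow> nat \<Rightarrow> (nat \<Rightarrow> nat \<Rightarrow> 'a) \<Rightarrow> 'a" where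
  "matrix V R X m n f = ntuple V X (npow V (Car R) n) m (\<lambda>i. ntuple V X (Car R) n (f i))"

definition Mat :: "('o, 'a) ccc \<Rightarrow> ('o, 'a) rig \<Rightarrow> ('o, 'a) thy" where
  "Mat V R = \<lparr>
    VOb = UNIV,
    VHom = (\<lambda>n m. matrix_obj V R m n),
    VComp = (\<lambda>n m k. let G = matrix_obj V R k m; F = matrix_obj V R m n; P = Prod V G F in
      matrix V R P k n (\<lambda>i j. vsum V R P (\<lambda>l. Mul R \<cdot>\<^bsub>V\<^esub>
        \<langle>entry V R k m i l \<cdot>\<^bsub>V\<^esub> Fst V G F, entry V R m n l j \<cdot>\<^bsub>V\<^esub> Snd V G F\<rangle>\<^bsub>V\<^esub>) m)),
    VId = (\<lambda>n. matrix V R (Tml V) n n (\<lambda>i j. if i = j then One R else Zero R)),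
    Pr = (\<lambda>n i. matrix V R (Tml V) 1 n (\<lambda>_ j. if i = j then One R else Zero R))\<rparr>"

text \<open>
  The normal \<open>Mat V R\<close>-algebra \<open>n \<mapsto> |M|\<^sup>n\<close> of a module \<open>M\<close>: an \<open>m \<times> n\<close> matrix \<open>r\<close> acts by
  \<open>x \<mapsto> (\<Sum>j<n. r i j x j) i\<close>.
\<close>

definition module_alg :: "('o, 'a) ccc \<Rightarrow> ('o, 'a) rig \<Rightarrow> ('o, 'a) rmodule \<Rightarrow> ('o, 'a) alg" where
  "module_alg V R M = \<lparr>
    FOb = (\<lambda>n. npow V (Car M) n),
    FHom = (\<lambda>n m. let H = matrix_obj V R m n; Q = npow V (Car M) n; P = Prod V H Q in
      curry V H Q (ntuple V P (Car M) m (\<lambda>i. vsum V M P (\<lambda>j. Act M \<cdot>\<^bsub>V\<^esub>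
        \<langle>entry V R m n i j \<cdot>\<^bsub>V\<^esub> Fst V H Q, nproj V (Car M) n j \<cdot>\<^bsub>V\<^esub> Snd V H Q\<rangle>\<^bsub>V\<^esub>) n)))\<rparr>"

end

theory Submission
  imports Defs
begin

text \<open>
  Write \<open>T\<close> for the theory of matrices over \<open>R\<close>, \<open>A\<close> for \<open>R\<close> as a \<open>T\<close>-algebra, and \<open>T'\<close> for the
  commutant.
  The theorem holds because \<open>T'\<close> is again the theory of matrices, so that naturality over \<open>T'\<close>
  is compatibility with linear combinations. Everything is computed with generalized elements
  \<open>Y \<rightarrow> B\<close>, and an equation between morphisms into an internal hom is checked by evaluating both
  sides at all generalized elements (\<open>exp_ext\<close>).

  \<^item> A natural family \<open>l\<close> at stage \<open>Y\<close> from \<open>A\<^sup>n\<close> to \<open>A\<^sup>m\<close> is a matrix. Naturality at the unit rows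
    \<open>k \<rightarrow> 1\<close> expresses \<open>l k\<close> through \<open>l 1\<close> coordinate by coordinate
    (\<open>natural_family_component\<close>). Naturality at a row \<open>y : n \<rightarrow> 1\<close>, applied to the tuple of unit
    vectors, expresses \<open>l 1 y\<close> as a linear combination of the values of \<open>l 1\<close> at the unit vectors
    (\<open>natural_family_linear\<close>). Conversely every matrix acts naturally because \<open>R\<close> is commutative
    (\<open>matrix_action_natural\<close>). Hence the object of matrices is the hom-object from \<open>A\<^sup>n\<close> to \<open>A\<^sup>m\<close>
    (\<open>matrix_obj_is_alg_obj\<close>).

  \<^item> It follows that \<open>T'\<close> is a theory, an element of its \<open>n\<close>-th power of \<open>1\<close> being the list of the
    \<open>n\<close> rows of a matrix (\<open>commutant_theory\<close>). The \<open>T'\<close>-algebra \<open>S'\<close> with carrier \<open>R\<close> is represented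
    by the object \<open>1\<close>, since matrices with a single column are tuples in \<open>R\<close>. Being representable, it
    preserves every conical power, and its cotensor \<open>[X,S']\<close> inherits this by currying.

  \<^item> A natural family \<open>l\<close> at stage \<open>Y\<close> from \<open>[X,S']\<close> to \<open>S'\<close> is determined by \<open>l 1 : Y \<rightarrow> [[X,R],R]\<close>,
    because \<open>[X,R\<^sup>n] \<cong> [X,R]\<^sup>n\<close> and the unit rows belong to \<open>T'\<close>
    (\<open>natural_family_eq_power_family\<close>). Naturality at all rows says that \<open>l 1\<close> preserves linear
    combinations (\<open>natural_family_is_linear\<close>), and a linear \<open>l 1\<close> extends coordinatewise to a
    natural family (\<open>power_family_natural\<close>).

  So linear elements and natural families correspond at every stage. At the terminal object this is
  the bijection between functional distributions and linear morphisms. At all stages together it says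
  that the equalizer of the linearity equations has the universal property of the object of
  distributions (\<open>joint_equalizer_is_alg_obj\<close>).
\<close>


section \<open>Generalized elements\<close>

text \<open>
  Typing is expressed through \<open>Dom\<close> and \<open>Cod\<close>, because the simplifier can compute the type of a
  composite but cannot guess the intermediate object of a composition. Composites are kept bracketed
  to the right with pairing outermost, so that an element \<open>e\<close> of the stage moves inwards
  to the elements it reindexes.
\<close>

lemma mem_hom [simp]: "f \<in> hom C A B \<longleftrightarrow> f \<in> Ar C \<and> Dom C f = A \<and> Cod C f = B"
  by (simp add: hom_def)

context category
begin

lemma dom_in_Ob [simp]: "f \<in> Ar C \<Longrightarrow> Dom C f \<in> Ob C"
  and cod_in_Ob [simp]: "f \<in> Ar C \<Longrightarrow> Cod C f \<in> Ob C"
  using dom_cod by auto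

lemma hom_Ob: "f \<in> hom C A B \<Longrightarrow> A \<in> Ob C \<and> B \<in> Ob C"
  by auto

lemma ide_simps [simp]:
  assumes "A \<in> Ob C"
  shows "Ide C A \<in> Ar C" "Dom C (Ide C A) = A" "Cod C (Ide C A) = A"
  using ide_in_hom[OF assms] by auto

lemma comp_simps [simp]:
  assumes "f \<in> Ar C" "g \<in> Ar C" "Cod C f = Dom C g"
  shows "g \<cdot> f \<in> Ar C" "Dom C (g \<cdot> f) = Dom C f" "Cod C (g \<cdot> f) = Cod C g"
  using comp_in_hom[of f "Dom C f" "Cod C f" g "Cod C g"] assms by auto

lemma comp_ide [simp]:
  assumes "f \<in> Ar C"
  shows "Cod C f = A \<Longrightarrow> Ide C A \<cdot> f = f" "Dom C f = A \<Longrightarrow> f \<cdot> Ide C A = f"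
  using ide_left[of f "Dom C f" "Cod C f"] ide_right[of f "Dom C f" "Cod C f"] assms by auto

lemma comp_assoc' [simp]:
  assumes "f \<in> Ar C" "g \<in> Ar C" "h \<in> Ar C" "Cod C f = Dom C g" "Cod C g = Dom C h"
  shows "(h \<cdot> g) \<cdot> f = h \<cdot> (g \<cdot> f)"
  using comp_assoc[of f "Dom C f" "Cod C f" g "Cod C g" h "Cod C h"] assms by auto

end

context cartesian_closed
begin

lemma tml_in_Ob [simp]: "Tml V \<in> Ob V"
  by (rule tml(1))

lemma bang_in_hom: "X \<in> Ob V \<Longrightarrow> bang V X \<in> hom V X (Tml V)"
  unfolding bang_def by (rule theI'[OF tml(2)])

lemma bang_simps [simp]:
  assumes "X \<in> Ob V"
  shows "bang V X \<in> Ar V" "Dom V (bang V X) = X" "Cod V (bang V X) = Tml V"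
  using bang_in_hom[OF assms] by auto

lemma tml_ext: "f \<in> hom V X (Tml V) \<Longrightarrow> g \<in> hom V X (Tml V) \<Longrightarrow> f = g"
  using tml(2)[of X] hom_Ob[of f X] by blast

lemma bang_comp [simp]: "e \<in> Ar V \<Longrightarrow> Cod V e = X \<Longrightarrow> bang V X \<cdot> e = bang V (Dom V e)"
  by (rule tml_ext[where X = "Dom V e"]) auto

lemma into_tml: "e \<in> Ar V \<Longrightarrow> Cod V e = Tml V \<Longrightarrow> e = bang V (Dom V e)"
  by (rule tml_ext[where X = "Dom V e"]) auto

lemma bang_tml: "bang V (Tml V) = Ide V (Tml V)"
  by (rule tml_ext[where X = "Tml V"]) auto

lemma prod_simps [simp]:
  assumes "A \<in> Ob V" "B \<in> Ob V"
  shows "Prod V A B \<in> Ob V"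
    "Fst V A B \<in> Ar V" "Dom V (Fst V A B) = Prod V A B" "Cod V (Fst V A B) = A"
    "Snd V A B \<in> Ar V" "Dom V (Snd V A B) = Prod V A B" "Cod V (Snd V A B) = B"
  using prod(1-3)[OF assms] by auto

lemma pair_props:
  assumes "f \<in> Ar V" "g \<in> Ar V" "Dom V g = Dom V f"
  shows "\<langle>f, g\<rangle> \<in> hom V (Dom V f) (Prod V (Cod V f) (Cod V g)) \<and>
    Fst V (Cod V f) (Cod V g) \<cdot> \<langle>f, g\<rangle> = f \<and> Snd V (Cod V f) (Cod V g) \<cdot> \<langle>f, g\<rangle> = g"
  unfolding pair_def by (rule theI'[OF prod(4)]) (use assms in auto)

lemma pair_simps [simp]:
  assumes "f \<in> Ar V" "g \<in> Ar V" "Dom V g = Dom V f"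
  shows "\<langle>f, g\<rangle> \<in> Ar V" "Dom V \<langle>f, g\<rangle> = Dom V f" "Cod V \<langle>f, g\<rangle> = Prod V (Cod V f) (Cod V g)"
  using pair_props[OF assms] by auto

lemma pair_beta [simp]:
  assumes "f \<in> Ar V" "g \<in> Ar V" "Dom V g = Dom V f" "Cod V f = A" "Cod V g = B"
  shows "Fst V A B \<cdot> \<langle>f, g\<rangle> = f" "Snd V A B \<cdot> \<langle>f, g\<rangle> = g"
  using pair_props[OF assms(1-3)] assms(4-) by auto

lemma pair_ext:
  assumes "h \<in> hom V X (Prod V A B)" "k \<in> hom V X (Prod V A B)" "A \<in> Ob V" "B \<in> Ob V"
    "Fst V A B \<cdot> h = Fst V A B \<cdot> k" "Snd V A B \<cdot> h = Snd V A B \<cdot> k"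
  shows "h = k"
  using prod(4)[of "Fst V A B \<cdot> k" X A "Snd V A B \<cdot> k" B] assms by (auto simp del: mem_hom intro: comp_in_hom prod)

lemma pair_comp [simp]:
  assumes "f \<in> Ar V" "g \<in> Ar V" "Dom V g = Dom V f" "e \<in> Ar V" "Cod V e = Dom V f"
  shows "\<langle>f, g\<rangle> \<cdot> e = \<langle>f \<cdot> e, g \<cdot> e\<rangle>"
proof (rule pair_ext[where X = "Dom V e" and A = "Cod V f" and B = "Cod V g"])
  show "Fst V (Cod V f) (Cod V g) \<cdot> \<langle>f, g\<rangle> \<cdot> e = Fst V (Cod V f) (Cod V g) \<cdot> \<langle>f \<cdot> e, g \<cdot> e\<rangle>"
    using comp_assoc'[of e "\<langle>f, g\<rangle>" "Fst V (Cod V f) (Cod V g)"] assms by simp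
  show "Snd V (Cod V f) (Cod V g) \<cdot> \<langle>f, g\<rangle> \<cdot> e = Snd V (Cod V f) (Cod V g) \<cdot> \<langle>f \<cdot> e, g \<cdot> e\<rangle>"
    using comp_assoc'[of e "\<langle>f, g\<rangle>" "Snd V (Cod V f) (Cod V g)"] assms by simp
qed (use assms in auto)

lemma pair_eta: "A \<in> Ob V \<Longrightarrow> B \<in> Ob V \<Longrightarrow> \<langle>Fst V A B, Snd V A B\<rangle> = Ide V (Prod V A B)"
  by (rule pair_ext[where X = "Prod V A B" and A = A and B = B]) auto

lemma exp_simps [simp]:
  assumes "A \<in> Ob V" "B \<in> Ob V"
  shows "Exp V A B \<in> Ob V" "Ev V A B \<in> Ar V" "Dom V (Ev V A B) = Prod V (Exp V A B) A"
    "Cod V (Ev V A B) = B"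
  using exp(1-2)[OF assms] by auto

lemma curry_props:
  assumes "f \<in> hom V (Prod V X A) B" "X \<in> Ob V" "A \<in> Ob V"
  shows "curry V X A f \<in> hom V X (Exp V A B) \<and>
    Ev V A B \<cdot> \<langle>curry V X A f \<cdot> Fst V X A, Snd V X A\<rangle> = f"
proof -
  have "Cod V f = B" using assms by simp
  with theI'[OF exp(3)[OF assms(2,3,1)]] show ?thesis unfolding curry_def by simp
qed

lemma curry_simps [simp]:
  assumes "f \<in> Ar V" "Dom V f = Prod V X A" "X \<in> Ob V" "A \<in> Ob V"
  shows "curry V X A f \<in> Ar V" "Dom V (curry V X A f) = X" "Cod V (curry V X A f) = Exp V A (Cod V f)"
  using curry_props[of f X A "Cod V f"] assms by auto

text \<open>
  The universal property of currying concerns the evaluation at the generic element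
  \<open>Snd V X A\<close>. Reindexing along \<open>\<langle>e, x\<rangle>\<close> gives the rule for an arbitrary element.
\<close>

lemma curry_beta [simp]:
  assumes "f \<in> Ar V" "Dom V f = Prod V X A" "Cod V f = B" "X \<in> Ob V" "A \<in> Ob V"
    "e \<in> Ar V" "Cod V e = X" "x \<in> Ar V" "Cod V x = A" "Dom V x = Dom V e"
  shows "Ev V A B \<cdot> \<langle>curry V X A f \<cdot> e, x\<rangle> = f \<cdot> \<langle>e, x\<rangle>"
proof -
  have B: "B \<in> Ob V" using assms by auto
  have "f \<cdot> \<langle>e, x\<rangle> = (Ev V A B \<cdot> \<langle>curry V X A f \<cdot> Fst V X A, Snd V X A\<rangle>) \<cdot> \<langle>e, x\<rangle>"
    using curry_props[of f X A B] assms by simp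
  also have "\<dots> = Ev V A B \<cdot> \<langle>curry V X A f \<cdot> e, x\<rangle>"
    using assms B by (simp del: curry_simps(3) add: curry_simps(3)[of f])
  finally show ?thesis by simp
qed

text \<open>
  The value at the generic elements \<open>Fst V X A\<close> and \<open>Snd V X A\<close>, at the stage \<open>Prod V X A\<close>,
  determines a morphism into \<open>Exp V A B\<close> by the uniqueness of currying.
\<close>

lemma exp_ext:
  assumes "g \<in> hom V X (Exp V A B)" "h \<in> hom V X (Exp V A B)" "A \<in> Ob V" "B \<in> Ob V"
    and eq: "\<And>Y e x. Y \<in> Ob V \<Longrightarrow> e \<in> hom V Y X \<Longrightarrow> x \<in> hom V Y A \<Longrightarrow>
      Ev V A B \<cdot> \<langle>g \<cdot> e, x\<rangle> = Ev V A B \<cdot> \<langle>h \<cdot> e, x\<rangle>"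
  shows "g = h"
proof -
  have X: "X \<in> Ob V" using assms(1) hom_Ob by blast
  let ?f = "Ev V A B \<cdot> \<langle>h \<cdot> Fst V X A, Snd V X A\<rangle>"
  have "?f \<in> hom V (Prod V X A) B" using assms X by simp
  moreover have "Ev V A B \<cdot> \<langle>g \<cdot> Fst V X A, Snd V X A\<rangle> = ?f"
    by (rule eq[of "Prod V X A"]) (use assms X in auto)
  ultimately show ?thesis using exp(3)[OF X assms(3), of ?f B] assms(1,2) by blast
qed

lemma curry_eqI:
  assumes "g \<in> hom V X (Exp V A B)" "f \<in> hom V (Prod V X A) B" "X \<in> Ob V" "A \<in> Ob V"
    "Ev V A B \<cdot> \<langle>g \<cdot> Fst V X A, Snd V X A\<rangle> = f"
  shows "g = curry V X A f"
  using exp(3)[OF assms(3,4,2)] curry_props[OF assms(2-4)] assms(1,5) by blast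

lemma name_simps [simp]:
  assumes "f \<in> Ar V"
  shows "name V f \<in> Ar V" "Dom V (name V f) = Tml V"
    "Cod V (name V f) = Exp V (Dom V f) (Cod V f)"
  unfolding name_def using assms by auto

lemma name_beta_comp [simp]:
  assumes "f \<in> Ar V" "Dom V f = A" "Cod V f = B"
    "e \<in> Ar V" "Cod V e = Tml V" "x \<in> Ar V" "Cod V x = A" "Dom V x = Dom V e"
  shows "Ev V A B \<cdot> \<langle>name V f \<cdot> e, x\<rangle> = f \<cdot> x"
proof -
  have "A \<in> Ob V" using assms by auto
  then show ?thesis unfolding name_def using assms by simp
qed

lemma name_beta [simp]:
  assumes "f \<in> Ar V" "Dom V f = A" "Cod V f = B" "x \<in> Ar V" "Cod V x = A" "Dom V x = Tml V"
  shows "Ev V A B \<cdot> \<langle>name V f, x\<rangle> = f \<cdot> x"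
  using name_beta_comp[of f A B "Ide V (Tml V)" x] assms by simp

lemma npow_in_Ob [simp]: "A \<in> Ob V \<Longrightarrow> npow V A n \<in> Ob V"
  by (induction n rule: induct_nat_012) auto

lemma nproj_simps [simp]:
  assumes "A \<in> Ob V" "i < n"
  shows "nproj V A n i \<in> Ar V" "Dom V (nproj V A n i) = npow V A n" "Cod V (nproj V A n i) = A"
proof -
  have "nproj V A n i \<in> hom V (npow V A n) A" using assms(2)
  proof (induction n rule: induct_nat_012)
    case (ge2 n)
    have "nproj V A (Suc n) i \<in> hom V (npow V A (Suc n)) A" if "i \<noteq> Suc n"
      using ge2(2) ge2(3) that by (metis less_SucE)
    then show ?case using assms(1) by simp
  qed (use assms(1) in auto)
  with assms show "nproj V A n i \<in> Ar V" "Dom V (nproj V A n i) = npow V A n" "Cod V (nproj V A n i) = A"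
    by auto
qed

text \<open>
  The induction has two base cases, as \<open>A\<^sup>1\<close> is \<open>A\<close> itself and not the product of \<open>A\<^sup>0\<close> with \<open>A\<close>.
\<close>

lemma npow_ex1:
  assumes "A \<in> Ob V" "X \<in> Ob V" "\<And>i. i < n \<Longrightarrow> f i \<in> hom V X A"
  shows "\<exists>!h. h \<in> hom V X (npow V A n) \<and> (\<forall>i<n. nproj V A n i \<cdot> h = f i)"
  using assms(3)
proof (induction n rule: induct_nat_012)
  case 0
  then show ?case using tml(2)[OF assms(2)] by simp
next
  case 1
  show ?case
  proof (rule ex1I[of _ "f 0"])
    fix h assume "h \<in> hom V X (npow V A (Suc 0)) \<and> (\<forall>i<Suc 0. nproj V A (Suc 0) i \<cdot> h = f i)"
    then have "h \<in> hom V X A" "Ide V A \<cdot> h = f 0" by simp_all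
    then show "h = f 0" by simp
  qed (use 1 in simp)
next
  case (ge2 n)
  let ?P = "npow V A (Suc n)"
  obtain k where k: "k \<in> hom V X ?P" "\<forall>i<Suc n. nproj V A (Suc n) i \<cdot> k = f i"
    and uniq: "\<And>k'. k' \<in> hom V X ?P \<Longrightarrow> \<forall>i<Suc n. nproj V A (Suc n) i \<cdot> k' = f i \<Longrightarrow> k' = k"
    using ge2(2)[OF ge2(3)[OF less_SucI]] by blast
  have fS: "f (Suc n) \<in> hom V X A" using ge2(3) by simp
  show ?case
  proof (rule ex1I[of _ "\<langle>k, f (Suc n)\<rangle>"])
    show "\<langle>k, f (Suc n)\<rangle> \<in> hom V X (npow V A (Suc (Suc n))) \<and>
      (\<forall>i<Suc (Suc n). nproj V A (Suc (Suc n)) i \<cdot> \<langle>k, f (Suc n)\<rangle> = f i)"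
    proof (intro conjI allI impI)
      show "\<langle>k, f (Suc n)\<rangle> \<in> hom V X (npow V A (Suc (Suc n)))" using k(1) fS by simp
      fix i assume "i < Suc (Suc n)"
      then show "nproj V A (Suc (Suc n)) i \<cdot> \<langle>k, f (Suc n)\<rangle> = f i"
        using k(1) k(2)[rule_format, of i] fS assms(1) by (cases "i = Suc n") simp_all
    qed
  next
    fix h assume h: "h \<in> hom V X (npow V A (Suc (Suc n))) \<and>
      (\<forall>i<Suc (Suc n). nproj V A (Suc (Suc n)) i \<cdot> h = f i)"
    have "Fst V ?P A \<cdot> h = k"
    proof (rule uniq)
      show "\<forall>i<Suc n. nproj V A (Suc n) i \<cdot> Fst V ?P A \<cdot> h = f i"
      proof (intro allI impI)
        fix i assume "i < Suc n"
        with h[THEN conjunct2, rule_format, of i] h[THEN conjunct1] show "nproj V A (Suc n) i \<cdot> Fst V ?P A \<cdot> h = f i"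
          using assms by simp
      qed
    qed (use h[THEN conjunct1] assms in simp)
    moreover have "Snd V ?P A \<cdot> h = f (Suc n)" using h[THEN conjunct2, rule_format, of "Suc n"] by simp
    ultimately have *: "Fst V ?P A \<cdot> h = k" "Snd V ?P A \<cdot> h = f (Suc n)" .
    show "h = \<langle>k, f (Suc n)\<rangle>"
      by (rule pair_ext[where X = X and A = ?P and B = A])
        (use h[THEN conjunct1] * k(1) fS assms(1) in simp_all)
  qed
qed

lemma ntuple_props:
  assumes "A \<in> Ob V" "X \<in> Ob V" "\<And>i. i < n \<Longrightarrow> f i \<in> hom V X A"
  shows "ntuple V X A n f \<in> hom V X (npow V A n) \<and> (\<forall>i<n. nproj V A n i \<cdot> ntuple V X A n f = f i)"
  unfolding ntuple_def by (rule theI'[OF npow_ex1[OF assms]])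

lemma ntuple_simps [simp]:
  assumes "A \<in> Ob V" "X \<in> Ob V" "\<And>i. i < n \<Longrightarrow> f i \<in> Ar V" "\<And>i. i < n \<Longrightarrow> Dom V (f i) = X"
    "\<And>i. i < n \<Longrightarrow> Cod V (f i) = A"
  shows "ntuple V X A n f \<in> Ar V" "Dom V (ntuple V X A n f) = X" "Cod V (ntuple V X A n f) = npow V A n"
    "i < n \<Longrightarrow> nproj V A n i \<cdot> ntuple V X A n f = f i"
    "i < n \<Longrightarrow> e \<in> Ar V \<Longrightarrow> Cod V e = X \<Longrightarrow> nproj V A n i \<cdot> ntuple V X A n f \<cdot> e = f i \<cdot> e"
proof -
  have *: "ntuple V X A n f \<in> hom V X (npow V A n)" "i < n \<Longrightarrow> nproj V A n i \<cdot> ntuple V X A n f = f i"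
    for i using ntuple_props[of A X n f] assms by auto
  then show "ntuple V X A n f \<in> Ar V" "Dom V (ntuple V X A n f) = X"
    "Cod V (ntuple V X A n f) = npow V A n" by auto
  show "i < n \<Longrightarrow> nproj V A n i \<cdot> ntuple V X A n f = f i" by fact
  show "nproj V A n i \<cdot> ntuple V X A n f \<cdot> e = f i \<cdot> e" if "i < n" "e \<in> Ar V" "Cod V e = X"
    using comp_assoc'[of e "ntuple V X A n f" "nproj V A n i"] * that assms by simp
qed

lemma npow_ext:
  assumes "h \<in> hom V X (npow V A n)" "k \<in> hom V X (npow V A n)" "A \<in> Ob V"
    "\<And>i. i < n \<Longrightarrow> nproj V A n i \<cdot> h = nproj V A n i \<cdot> k"
  shows "h = k"
proof -
  have "X \<in> Ob V" using assms(1) by auto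
  then have "\<exists>!h. h \<in> hom V X (npow V A n) \<and> (\<forall>i<n. nproj V A n i \<cdot> h = nproj V A n i \<cdot> k)"
    using npow_ex1[of A X n "\<lambda>i. nproj V A n i \<cdot> k"] assms by simp
  then show ?thesis using assms by blast
qed

lemma curry_eq_iff:
  assumes "f \<in> hom V (Prod V W A) B" "g \<in> hom V (Prod V W A) B" "W \<in> Ob V" "A \<in> Ob V" "l \<in> hom V Y W"
  shows "curry V W A f \<cdot> l = curry V W A g \<cdot> l \<longleftrightarrow>
    (\<forall>Z. \<forall>e \<in> hom V Z Y. \<forall>x \<in> hom V Z A. f \<cdot> \<langle>l \<cdot> e, x\<rangle> = g \<cdot> \<langle>l \<cdot> e, x\<rangle>)"
proof -
  have B: "B \<in> Ob V" using assms(1) by auto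
  have beta: "Ev V A B \<cdot> \<langle>(curry V W A k \<cdot> l) \<cdot> e, x\<rangle> = k \<cdot> \<langle>l \<cdot> e, x\<rangle>"
    if "k \<in> hom V (Prod V W A) B" "e \<in> hom V Z Y" "x \<in> hom V Z A" for k Z e x
    using that assms(3-5) by simp
  show ?thesis
  proof
    assume "curry V W A f \<cdot> l = curry V W A g \<cdot> l"
    then show "\<forall>Z. \<forall>e \<in> hom V Z Y. \<forall>x \<in> hom V Z A. f \<cdot> \<langle>l \<cdot> e, x\<rangle> = g \<cdot> \<langle>l \<cdot> e, x\<rangle>"
      using beta[OF assms(1)] beta[OF assms(2)] by metis
  next
    assume r: "\<forall>Z. \<forall>e \<in> hom V Z Y. \<forall>x \<in> hom V Z A. f \<cdot> \<langle>l \<cdot> e, x\<rangle> = g \<cdot> \<langle>l \<cdot> e, x\<rangle>"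
    show "curry V W A f \<cdot> l = curry V W A g \<cdot> l"
    proof (rule exp_ext[where X = Y and A = A and B = B])
      show "Ev V A B \<cdot> \<langle>(curry V W A f \<cdot> l) \<cdot> e, x\<rangle> = Ev V A B \<cdot> \<langle>(curry V W A g \<cdot> l) \<cdot> e, x\<rangle>"
        if "e \<in> hom V Z Y" "x \<in> hom V Z A" for Z e x
        using beta[OF assms(1) that] beta[OF assms(2) that] r that by metis
    qed (use assms B in auto)
  qed
qed

lemma elements_of_prod:
  assumes "A \<in> Ob V" "B \<in> Ob V"
  shows "(\<forall>x \<in> hom V Z (Prod V A B). Q x) \<longleftrightarrow> (\<forall>a \<in> hom V Z A. \<forall>b \<in> hom V Z B. Q \<langle>a, b\<rangle>)"
proof
  assume *: "\<forall>a \<in> hom V Z A. \<forall>b \<in> hom V Z B. Q \<langle>a, b\<rangle>"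
  show "\<forall>x \<in> hom V Z (Prod V A B). Q x"
  proof
    fix x assume x: "x \<in> hom V Z (Prod V A B)"
    have "x = \<langle>Fst V A B \<cdot> x, Snd V A B \<cdot> x\<rangle>"
      by (rule pair_ext[where X = Z and A = A and B = B]) (use x assms in auto)
    moreover have "Fst V A B \<cdot> x \<in> hom V Z A" "Snd V A B \<cdot> x \<in> hom V Z B" using x assms by auto
    ultimately show "Q x" using * by metis
  qed
qed auto

text \<open>
  Equalizers are taken one pair after the other: the next pair is restricted along the equalizer
  of the previous ones.
\<close>

lemma joint_equalizer_exists:
  assumes eq: "has_equalizers V" and "finite Q" and A: "A \<in> Ob V"
    and "\<And>f g. (f, g) \<in> Q \<Longrightarrow> \<exists>B. f \<in> hom V A B \<and> g \<in> hom V A B"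
  shows "\<exists>L j. is_joint_equalizer V A Q L j"
  using assms(2,4)
proof (induction Q)
  case empty
  have "is_joint_equalizer V A {} A (Ide V A)"
    unfolding is_joint_equalizer_def
  proof (intro conjI allI ballI impI)
    fix Y h assume "h \<in> hom V Y A"
    then show "\<exists>!k. k \<in> hom V Y A \<and> Ide V A \<cdot> k = h"
      by (intro ex1I[of _ h]) (auto simp: ide_left)
  qed (use A in auto)
  then show ?case by blast
next
  case (insert p Q)
  obtain f g where p: "p = (f, g)" by (cases p)
  obtain L j where L: "is_joint_equalizer V A Q L j" using insert by blast
  then have j: "j \<in> hom V L A" by (simp add: is_joint_equalizer_def)
  obtain B where f: "f \<in> hom V A B" and g: "g \<in> hom V A B" using insert.prems p by blast
  then have fj: "f \<cdot> j \<in> hom V L B" "g \<cdot> j \<in> hom V L B" using j by simp_all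
  then obtain N i where N: "is_joint_equalizer V L {(f \<cdot> j, g \<cdot> j)} N i"
    using eq unfolding has_equalizers_def by blast
  then have i: "i \<in> hom V N L" and fg: "(f \<cdot> j) \<cdot> i = (g \<cdot> j) \<cdot> i"
    by (simp_all add: is_joint_equalizer_def del: comp_assoc')
  have assoc: "(u \<cdot> j) \<cdot> k = u \<cdot> j \<cdot> k" if "u \<in> hom V A B'" "k \<in> hom V Y L" for u B' k Y
    using that j by simp
  have "is_joint_equalizer V A (insert p Q) N (j \<cdot> i)"
    unfolding is_joint_equalizer_def
  proof (intro conjI allI ballI impI)
    show "j \<cdot> i \<in> hom V N A" using i j by simp
    show "case q of (u, v) \<Rightarrow> u \<cdot> j \<cdot> i = v \<cdot> j \<cdot> i" if q: "q \<in> insert p Q" for q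
    proof -
      obtain u v where uv: "q = (u, v)" by (cases q)
      then obtain B' where B': "u \<in> hom V A B'" "v \<in> hom V A B'" using insert.prems q by blast
      have "(u \<cdot> j) \<cdot> i = (v \<cdot> j) \<cdot> i"
        using q uv p fg L unfolding is_joint_equalizer_def by (auto simp del: comp_assoc')
      then show ?thesis using assoc[OF B'(1) i] assoc[OF B'(2) i] uv by simp
    qed
    fix Y h assume h: "h \<in> hom V Y A" and eq: "\<forall>(u, v) \<in> insert p Q. u \<cdot> h = v \<cdot> h"
    from eq have "\<forall>(u, v) \<in> Q. u \<cdot> h = v \<cdot> h" by blast
    with L h have "\<exists>!k. k \<in> hom V Y L \<and> j \<cdot> k = h" unfolding is_joint_equalizer_def by blast
    then obtain k where k: "k \<in> hom V Y L" "j \<cdot> k = h"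
      and k_uniq: "\<And>k'. k' \<in> hom V Y L \<Longrightarrow> j \<cdot> k' = h \<Longrightarrow> k' = k" by blast
    have "f \<cdot> h = g \<cdot> h" using eq p by simp
    then have "(f \<cdot> j) \<cdot> k = (g \<cdot> j) \<cdot> k" using assoc[OF f k(1)] assoc[OF g k(1)] k(2) by simp
    then have "\<exists>!m. m \<in> hom V Y N \<and> i \<cdot> m = k"
      using N k(1) unfolding is_joint_equalizer_def by blast
    then obtain m where m: "m \<in> hom V Y N" "i \<cdot> m = k"
      and m_uniq: "\<And>m'. m' \<in> hom V Y N \<Longrightarrow> i \<cdot> m' = k \<Longrightarrow> m' = m" by blast
    have ji: "(j \<cdot> i) \<cdot> m' = j \<cdot> i \<cdot> m'" if "m' \<in> hom V Y N" for m' using that i j by simp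
    show "\<exists>!m. m \<in> hom V Y N \<and> (j \<cdot> i) \<cdot> m = h"
    proof (rule ex1I[of _ m])
      show "m \<in> hom V Y N \<and> (j \<cdot> i) \<cdot> m = h" using m ji k(2) by (simp del: mem_hom comp_assoc')
      fix m' assume m': "m' \<in> hom V Y N \<and> (j \<cdot> i) \<cdot> m' = h"
      then have "i \<cdot> m' = k" by (intro k_uniq) (use i ji in \<open>auto simp del: comp_assoc'\<close>)
      with m' show "m' = m" using m_uniq by blast
    qed
  qed
  then show ?case by blast
qed

lemma name_inj:
  assumes "f \<in> hom V A B" "g \<in> hom V A B" "name V f = name V g"
  shows "f = g"
proof -
  have A: "A \<in> Ob V" using assms(1) by auto
  have "Ev V A B \<cdot> \<langle>name V f \<cdot> bang V A, Ide V A\<rangle> = Ev V A B \<cdot> \<langle>name V g \<cdot> bang V A, Ide V A\<rangle>"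
    using assms(3) by simp
  then show ?thesis using assms(1,2) A by simp
qed

lemma name_surj:
  assumes "A \<in> Ob V" "B \<in> Ob V" "h \<in> hom V (Tml V) (Exp V A B)"
  shows "\<exists>f \<in> hom V A B. name V f = h"
proof
  let ?f = "Ev V A B \<cdot> \<langle>h \<cdot> bang V A, Ide V A\<rangle>"
  show f: "?f \<in> hom V A B" using assms by simp
  show "name V ?f = h"
  proof (rule exp_ext[where X = "Tml V" and A = A and B = B])
    fix Y e x assume e: "e \<in> hom V Y (Tml V)" and x: "x \<in> hom V Y A"
    have "e = bang V Y" using into_tml[of e] e by simp
    then show "Ev V A B \<cdot> \<langle>name V ?f \<cdot> e, x\<rangle> = Ev V A B \<cdot> \<langle>h \<cdot> e, x\<rangle>"
      using e x assms hom_Ob[OF e] by simp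
  qed (use f assms in auto)
qed


section \<open>Natural families in terms of elements\<close>

lemma selfv_simps [simp]: "VOb (selfv V) = Ob V" "VHom (selfv V) = Exp V"
  "VId (selfv V) A = name V (Ide V A)"
  unfolding selfv_def by auto

lemma vc_selfv_simps [simp]:
  assumes "A \<in> Ob V" "B \<in> Ob V" "C \<in> Ob V"
    "f \<in> Ar V" "Cod V f = Exp V A B" "g \<in> Ar V" "Cod V g = Exp V B C" "Dom V g = Dom V f"
  shows "vc V (selfv V) A B C g f \<in> Ar V" "Dom V (vc V (selfv V) A B C g f) = Dom V f"
    "Cod V (vc V (selfv V) A B C g f) = Exp V A C"
    "x \<in> Ar V \<Longrightarrow> Cod V x = A \<Longrightarrow> Dom V x = Dom V f \<Longrightarrow>
      Ev V A C \<cdot> \<langle>vc V (selfv V) A B C g f, x\<rangle> = Ev V B C \<cdot> \<langle>g, Ev V A B \<cdot> \<langle>f, x\<rangle>\<rangle>"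
    "e \<in> Ar V \<Longrightarrow> Cod V e = Dom V f \<Longrightarrow>
      vc V (selfv V) A B C g f \<cdot> e = vc V (selfv V) A B C (g \<cdot> e) (f \<cdot> e)"
  using assms by (auto simp: vc_def selfv_def Let_def)

end

text \<open>
  The data of an algebra over \<open>T\<close> without its laws. Natural families and their ends make sense
  at this level, and powers and cotensors of such data are again such data.
\<close>

definition prealgebra :: "('o, 'a) ccc \<Rightarrow> ('o, 'a) thy \<Rightarrow> ('o, 'a) alg \<Rightarrow> bool" where
  "prealgebra V T A \<longleftrightarrow> (\<forall>n m. VHom T n m \<in> Ob V) \<and> (\<forall>n. FOb A n \<in> Ob V) \<and>
    (\<forall>n m. FHom A n m \<in> hom V (VHom T n m) (Exp V (FOb A n) (FOb A m)))"

context cartesian_closed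
begin

lemma prealgebra_simps:
  assumes "prealgebra V T A"
  shows "VHom T n m \<in> Ob V" "FOb A n \<in> Ob V" "FHom A n m \<in> Ar V" "Dom V (FHom A n m) = VHom T n m"
    "Cod V (FHom A n m) = Exp V (FOb A n) (FOb A m)"
  using assms by (auto simp: prealgebra_def)

text \<open>
  An element of an internal hom is determined by its values, so naturality of a family becomes the
  usual naturality square for its values at generalized elements.
\<close>

lemma natural_family_iff:
  assumes A: "prealgebra V T A" and B: "prealgebra V T B"
  shows "is_natural_family V T A B X l \<longleftrightarrow>
    (\<forall>n. l n \<in> hom V X (Exp V (FOb A n) (FOb B n))) \<and>
    (\<forall>n m Y. \<forall>e \<in> hom V Y X. \<forall>t \<in> hom V Y (VHom T n m). \<forall>x \<in> hom V Y (FOb A n).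
      Ev V (FOb B n) (FOb B m) \<cdot> \<langle>FHom B n m \<cdot> t, Ev V (FOb A n) (FOb B n) \<cdot> \<langle>l n \<cdot> e, x\<rangle>\<rangle> =
      Ev V (FOb A m) (FOb B m) \<cdot> \<langle>l m \<cdot> e, Ev V (FOb A n) (FOb A m) \<cdot> \<langle>FHom A n m \<cdot> t, x\<rangle>\<rangle>)"
    (is "?L \<longleftrightarrow> ?T \<and> ?R")
proof (cases ?T)
  case True
  note [simp] = prealgebra_simps[OF A] prealgebra_simps(2-)[OF B]
  have l [simp]: "l n \<in> Ar V" "Dom V (l n) = X" "Cod V (l n) = Exp V (FOb A n) (FOb B n)" for n
    using True by auto
  show ?thesis
  proof
    assume L: ?L
    show "?T \<and> ?R"
    proof (intro conjI True allI ballI)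
      fix n m Y e t x
      assume *: "e \<in> hom V Y X" "t \<in> hom V Y (VHom T n m)" "x \<in> hom V Y (FOb A n)"
      then have Y: "Y \<in> Ob V" by auto
      have "vc V (selfv V) (FOb A n) (FOb B n) (FOb B m) (FHom B n m \<cdot> t) (l n \<cdot> e) =
        vc V (selfv V) (FOb A n) (FOb A m) (FOb B m) (l m \<cdot> e) (FHom A n m \<cdot> t)" (is "?l = ?r")
        using L *(1,2) unfolding is_natural_family_def by blast
      then have "Ev V (FOb A n) (FOb B m) \<cdot> \<langle>?l, x\<rangle> = Ev V (FOb A n) (FOb B m) \<cdot> \<langle>?r, x\<rangle>"
        by (rule arg_cong)
      then show "Ev V (FOb B n) (FOb B m) \<cdot> \<langle>FHom B n m \<cdot> t, Ev V (FOb A n) (FOb B n) \<cdot> \<langle>l n \<cdot> e, x\<rangle>\<rangle> =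
        Ev V (FOb A m) (FOb B m) \<cdot> \<langle>l m \<cdot> e, Ev V (FOb A n) (FOb A m) \<cdot> \<langle>FHom A n m \<cdot> t, x\<rangle>\<rangle>"
        using * Y by simp
    qed
  next
    assume R: "?T \<and> ?R"
    show ?L
      unfolding is_natural_family_def
    proof (intro conjI True allI ballI)
      fix n m Y e t
      assume *: "e \<in> hom V Y X" "t \<in> hom V Y (VHom T n m)"
      show "vc V (selfv V) (FOb A n) (FOb B n) (FOb B m) (FHom B n m \<cdot> t) (l n \<cdot> e) =
        vc V (selfv V) (FOb A n) (FOb A m) (FOb B m) (l m \<cdot> e) (FHom A n m \<cdot> t)"
      proof (rule exp_ext[where X = Y and A = "FOb A n" and B = "FOb B m"])
        fix Z d x assume d: "d \<in> hom V Z Y" "x \<in> hom V Z (FOb A n)"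
        have "e \<cdot> d \<in> hom V Z X" "t \<cdot> d \<in> hom V Z (VHom T n m)" using d * by auto
        with R d show "Ev V (FOb A n) (FOb B m) \<cdot>
            \<langle>vc V (selfv V) (FOb A n) (FOb B n) (FOb B m) (FHom B n m \<cdot> t) (l n \<cdot> e) \<cdot> d, x\<rangle> =
          Ev V (FOb A n) (FOb B m) \<cdot>
            \<langle>vc V (selfv V) (FOb A n) (FOb A m) (FOb B m) (l m \<cdot> e) (FHom A n m \<cdot> t) \<cdot> d, x\<rangle>"
          using * by simp
      qed (use * in auto)
    qed
  qed
qed (auto simp: is_natural_family_def simp del: mem_hom)

lemma natural_family_in_hom:
  "is_natural_family V T A B X l \<Longrightarrow> l n \<in> hom V X (Exp V (FOb A n) (FOb B n))"
  by (simp add: is_natural_family_def)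

lemma natural_familyD:
  assumes "is_natural_family V T A B X l" "prealgebra V T A" "prealgebra V T B"
    "e \<in> hom V Y X" "t \<in> hom V Y (VHom T n m)" "x \<in> hom V Y (FOb A n)"
  shows "Ev V (FOb A m) (FOb B m) \<cdot> \<langle>l m \<cdot> e, Ev V (FOb A n) (FOb A m) \<cdot> \<langle>FHom A n m \<cdot> t, x\<rangle>\<rangle> =
    Ev V (FOb B n) (FOb B m) \<cdot> \<langle>FHom B n m \<cdot> t, Ev V (FOb A n) (FOb B n) \<cdot> \<langle>l n \<cdot> e, x\<rangle>\<rangle>"
  using assms(1) natural_family_iff[OF assms(2,3), of X l] assms(4-) by auto

lemma natural_familyI:
  assumes "prealgebra V T A" "prealgebra V T B" "\<And>n. l n \<in> hom V X (Exp V (FOb A n) (FOb B n))"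
    "\<And>n m Y e t x. Y \<in> Ob V \<Longrightarrow> e \<in> hom V Y X \<Longrightarrow> t \<in> hom V Y (VHom T n m) \<Longrightarrow> x \<in> hom V Y (FOb A n) \<Longrightarrow>
      Ev V (FOb B n) (FOb B m) \<cdot> \<langle>FHom B n m \<cdot> t, Ev V (FOb A n) (FOb B n) \<cdot> \<langle>l n \<cdot> e, x\<rangle>\<rangle> =
      Ev V (FOb A m) (FOb B m) \<cdot> \<langle>l m \<cdot> e, Ev V (FOb A n) (FOb A m) \<cdot> \<langle>FHom A n m \<cdot> t, x\<rangle>\<rangle>"
  shows "is_natural_family V T A B X l"
  unfolding natural_family_iff[OF assms(1,2)]
  using assms(3) by (intro conjI allI ballI assms(4)) (auto dest: hom_Ob)

lemma natural_family_restrict: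
  assumes "is_natural_family V T A B X l" "prealgebra V T A" "prealgebra V T B" "e \<in> hom V Y X"
  shows "is_natural_family V T A B Y (\<lambda>n. l n \<cdot> e)"
proof (rule natural_familyI[OF assms(2,3)])
  note [simp] = prealgebra_simps[OF assms(2)] prealgebra_simps(2-)[OF assms(3)]
  note l = natural_family_in_hom[OF assms(1)]
  show "l n \<cdot> e \<in> hom V Y (Exp V (FOb A n) (FOb B n))" for n using l[of n] assms(4) by simp
  fix n m Z d t x
  assume *: "d \<in> hom V Z Y" "t \<in> hom V Z (VHom T n m)" "x \<in> hom V Z (FOb A n)"
  show "Ev V (FOb B n) (FOb B m) \<cdot> \<langle>FHom B n m \<cdot> t, Ev V (FOb A n) (FOb B n) \<cdot> \<langle>(l n \<cdot> e) \<cdot> d, x\<rangle>\<rangle> =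
      Ev V (FOb A m) (FOb B m) \<cdot> \<langle>(l m \<cdot> e) \<cdot> d, Ev V (FOb A n) (FOb A m) \<cdot> \<langle>FHom A n m \<cdot> t, x\<rangle>\<rangle>"
    using natural_familyD[OF assms(1-3) _ *(2,3), of "e \<cdot> d"] l[of n] l[of m] * assms(4) by simp
qed

lemma natural_family_comp:
  assumes "is_natural_family V T A B X f" "is_natural_family V T B C X g"
    and ABC: "prealgebra V T A" "prealgebra V T B" "prealgebra V T C"
  shows "is_natural_family V T A C X (\<lambda>n. vc V (selfv V) (FOb A n) (FOb B n) (FOb C n) (g n) (f n))"
proof (rule natural_familyI)
  note [simp] = ABC[THEN prealgebra_simps(2)] ABC[THEN prealgebra_simps(3)]
    ABC[THEN prealgebra_simps(4)] ABC[THEN prealgebra_simps(5)]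
  note f = natural_family_in_hom[OF assms(1)]
  note g = natural_family_in_hom[OF assms(2)]
  have [simp]: "f n \<in> Ar V" "Dom V (f n) = X" "Cod V (f n) = Exp V (FOb A n) (FOb B n)"
    "g n \<in> Ar V" "Dom V (g n) = X" "Cod V (g n) = Exp V (FOb B n) (FOb C n)" for n
    using f g by auto
  show "vc V (selfv V) (FOb A n) (FOb B n) (FOb C n) (g n) (f n) \<in> hom V X (Exp V (FOb A n) (FOb C n))" for n
    by simp
  fix n m Y e t x
  assume *: "e \<in> hom V Y X" "t \<in> hom V Y (VHom T n m)" "x \<in> hom V Y (FOb A n)"
  have "Ev V (FOb A n) (FOb B n) \<cdot> \<langle>f n \<cdot> e, x\<rangle> \<in> hom V Y (FOb B n)" using * by simp
  from natural_familyD[OF assms(1,3,4) *] natural_familyD[OF assms(2,4,5) *(1,2) this] *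
  show "Ev V (FOb C n) (FOb C m) \<cdot> \<langle>FHom C n m \<cdot> t, Ev V (FOb A n) (FOb C n) \<cdot>
          \<langle>vc V (selfv V) (FOb A n) (FOb B n) (FOb C n) (g n) (f n) \<cdot> e, x\<rangle>\<rangle> =
    Ev V (FOb A m) (FOb C m) \<cdot> \<langle>vc V (selfv V) (FOb A m) (FOb B m) (FOb C m) (g m) (f m) \<cdot> e,
      Ev V (FOb A n) (FOb A m) \<cdot> \<langle>FHom A n m \<cdot> t, x\<rangle>\<rangle>"
    by simp
qed (use ABC in simp_all)

lemma natural_family_id:
  assumes "prealgebra V T A"
  shows "is_natural_family V T A A (Tml V) (\<lambda>n. name V (Ide V (FOb A n)))"
  by (rule natural_familyI) (use assms prealgebra_simps[OF assms] in auto)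

text \<open>
  As \<open>alg_obj\<close> is defined by choice, exhibiting any end suffices for the chosen one to have the
  universal property.
\<close>

lemma alg_obj_props:
  assumes "is_alg_obj V T A B p"
  shows "is_alg_obj V T A B (alg_obj V T A B, alg_pr V T A B)"
  unfolding alg_obj_def alg_pr_def using someI[of "is_alg_obj V T A B", OF assms] by simp

lemma is_alg_obj_ext:
  assumes E: "is_alg_obj V T A B (E, l)" and "prealgebra V T A" "prealgebra V T B"
    "h \<in> hom V X E" "k \<in> hom V X E" "\<And>n. l n \<cdot> h = l n \<cdot> k"
  shows "h = k"
proof -
  have "is_natural_family V T A B X (\<lambda>n. l n \<cdot> k)"
    using E assms(2,3,5) by - (rule natural_family_restrict[where X = E], auto simp: is_alg_obj_def)
  moreover have "X \<in> Ob V" using assms(4) by auto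
  ultimately have "\<exists>!h. h \<in> hom V X E \<and> (\<forall>n. l n \<cdot> h = l n \<cdot> k)"
    using E unfolding is_alg_obj_def by blast
  then show ?thesis using assms(4-6) by blast
qed

lemma alg_in_props:
  assumes "is_alg_obj V T A B p" "is_natural_family V T A B X k" "X \<in> Ob V"
  shows "alg_in V T A B X k \<in> hom V X (alg_obj V T A B) \<and>
    (\<forall>n. alg_pr V T A B n \<cdot> alg_in V T A B X k = k n)"
  unfolding alg_in_def
  by (rule theI') (use alg_obj_props[OF assms(1)] assms(2,3) in \<open>simp add: is_alg_obj_def del: mem_hom\<close>)

lemma is_alg_obj_unique:
  assumes E: "is_alg_obj V T A B (E, l)" and F: "is_alg_obj V T A B (F, j)"
    and A: "prealgebra V T A" and B: "prealgebra V T B"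
  shows "\<exists>\<phi>. is_iso V E F \<phi> \<and> (\<forall>n. j n \<cdot> \<phi> = l n)"
proof -
  have Ob: "E \<in> Ob V" "F \<in> Ob V" and l: "is_natural_family V T A B E l"
    and j: "is_natural_family V T A B F j"
    using E F by (auto simp: is_alg_obj_def)
  obtain \<phi> where \<phi>: "\<phi> \<in> hom V E F" "\<And>n. j n \<cdot> \<phi> = l n"
    using F l Ob unfolding is_alg_obj_def by blast
  obtain \<psi> where \<psi>: "\<psi> \<in> hom V F E" "\<And>n. l n \<cdot> \<psi> = j n"
    using E j Ob unfolding is_alg_obj_def by blast
  note lj = natural_family_in_hom[OF l] natural_family_in_hom[OF j]
  have *: "l n \<cdot> \<psi> \<cdot> \<phi> = l n" "j n \<cdot> \<phi> \<cdot> \<psi> = j n" for n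
    using comp_assoc'[of \<phi> \<psi> "l n"] comp_assoc'[of \<psi> \<phi> "j n"] \<phi> \<psi> lj[of n] by auto
  have "\<psi> \<cdot> \<phi> = Ide V E" by (rule is_alg_obj_ext[OF E A B, of _ E]) (use \<phi> \<psi> lj * Ob in auto)
  moreover have "\<phi> \<cdot> \<psi> = Ide V F" by (rule is_alg_obj_ext[OF F A B, of _ F]) (use \<phi> \<psi> lj * Ob in auto)
  ultimately show ?thesis using \<phi> \<psi> unfolding is_iso_def by blast
qed

lemma power_alg_FOb [simp]: "FOb (power_alg V T A n) k = npow V (FOb A k) n"
  by (simp add: power_alg_def)

lemma cotensor_alg_FOb [simp]: "FOb (cotensor_alg V T X A) k = Exp V X (FOb A k)"
  by (simp add: cotensor_alg_def)

lemma prealgebra_power [simp]: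
  assumes "prealgebra V T A"
  shows "prealgebra V T (power_alg V T A n)"
  unfolding prealgebra_def using prealgebra_simps[OF assms] by (simp add: power_alg_def Let_def)

lemma power_alg_app:
  assumes "prealgebra V T A" "t \<in> Ar V" "Cod V t = VHom T k l"
    "x \<in> Ar V" "Cod V x = npow V (FOb A k) n" "Dom V x = Dom V t" "i < n"
  shows "nproj V (FOb A l) n i \<cdot> Ev V (npow V (FOb A k) n) (npow V (FOb A l) n) \<cdot>
      \<langle>FHom (power_alg V T A n) k l \<cdot> t, x\<rangle> =
    Ev V (FOb A k) (FOb A l) \<cdot> \<langle>FHom A k l \<cdot> t, nproj V (FOb A k) n i \<cdot> x\<rangle>"
  using assms(2-) prealgebra_simps[OF assms(1)] by (simp add: power_alg_def Let_def)

lemma prealgebra_cotensor: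
  assumes "prealgebra V T A" "X \<in> Ob V"
  shows "prealgebra V T (cotensor_alg V T X A)"
  unfolding prealgebra_def
  using prealgebra_simps[OF assms(1)] assms(2) by (simp add: cotensor_alg_def Let_def)

lemma cotensor_alg_app:
  assumes "prealgebra V T A" "X \<in> Ob V" "t \<in> Ar V" "Cod V t = VHom T k l"
    "g \<in> Ar V" "Cod V g = Exp V X (FOb A k)" "Dom V g = Dom V t"
    "x \<in> Ar V" "Cod V x = X" "Dom V x = Dom V t"
  shows "Ev V X (FOb A l) \<cdot> \<langle>Ev V (Exp V X (FOb A k)) (Exp V X (FOb A l)) \<cdot>
      \<langle>FHom (cotensor_alg V T X A) k l \<cdot> t, g\<rangle>, x\<rangle> =
    Ev V (FOb A k) (FOb A l) \<cdot> \<langle>FHom A k l \<cdot> t, Ev V X (FOb A k) \<cdot> \<langle>g, x\<rangle>\<rangle>"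
proof -
  note [simp] = prealgebra_simps[OF assms(1)] assms(2)
  let ?H = "VHom T k l" and ?Q = "Exp V X (FOb A k)"
  let ?P = "Prod V ?H ?Q"
  let ?f = "Ev V (FOb A k) (FOb A l) \<cdot>
          \<langle>FHom A k l \<cdot> Fst V ?H ?Q \<cdot> Fst V ?P X,
           Ev V X (FOb A k) \<cdot> \<langle>Snd V ?H ?Q \<cdot> Fst V ?P X, Snd V ?P X\<rangle>\<rangle>"
  have "Ev V (Exp V X (FOb A k)) (Exp V X (FOb A l)) \<cdot>
      \<langle>FHom (cotensor_alg V T X A) k l \<cdot> t, g\<rangle> = curry V ?P X ?f \<cdot> \<langle>t, g\<rangle>"
    using assms(2-) by (simp add: cotensor_alg_def Let_def)
  then show ?thesis using assms(3-) by simp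
qed


section \<open>Finite sums in a commutative rig\<close>

lemma cmonoid_simps:
  assumes "is_cmonoid V M"
  shows "Car M \<in> Ob V" "Add M \<in> Ar V" "Dom V (Add M) = Prod V (Car M) (Car M)"
    "Cod V (Add M) = Car M" "Zero M \<in> Ar V" "Dom V (Zero M) = Tml V" "Cod V (Zero M) = Car M"
  using assms by (auto simp: is_cmonoid_def Let_def)

lemma vsum_simps [simp]:
  assumes M: "is_cmonoid V M" and X: "X \<in> Ob V"
    and f: "\<And>i. i < n \<Longrightarrow> f i \<in> Ar V" "\<And>i. i < n \<Longrightarrow> Dom V (f i) = X" "\<And>i. i < n \<Longrightarrow> Cod V (f i) = Car M"
  shows "vsum V M X f n \<in> Ar V" "Dom V (vsum V M X f n) = X" "Cod V (vsum V M X f n) = Car M"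
    "e \<in> Ar V \<Longrightarrow> Cod V e = X \<Longrightarrow> vsum V M X f n \<cdot> e = vsum V M (Dom V e) (\<lambda>i. f i \<cdot> e) n"
proof -
  note [simp] = cmonoid_simps[OF M]
  have *: "vsum V M X f k \<in> Ar V \<and> Dom V (vsum V M X f k) = X \<and> Cod V (vsum V M X f k) = Car M"
    if "k \<le> n" for k using that f X by (induction k) simp_all
  then show "vsum V M X f n \<in> Ar V" "Dom V (vsum V M X f n) = X" "Cod V (vsum V M X f n) = Car M"
    by auto
  assume e: "e \<in> Ar V" "Cod V e = X"
  have "vsum V M X f k \<cdot> e = vsum V M (Dom V e) (\<lambda>i. f i \<cdot> e) k" if "k \<le> n" for k
    using that
  proof (induction k)
    case (Suc k)
    then show ?case using *[of k] f[of k] e X by simp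
  qed (use e X in simp)
  then show "vsum V M X f n \<cdot> e = vsum V M (Dom V e) (\<lambda>i. f i \<cdot> e) n" by simp
qed

lemma vsum_cong:
  "X = Y \<Longrightarrow> n = m \<Longrightarrow> (\<And>i. i < m \<Longrightarrow> f i = g i) \<Longrightarrow> vsum V M X f n = vsum V M Y g m"
proof -
  have "(\<And>i. i < m \<Longrightarrow> f i = g i) \<Longrightarrow> vsum V M Y f m = vsum V M Y g m"
    by (induction m) auto
  then show "X = Y \<Longrightarrow> n = m \<Longrightarrow> (\<And>i. i < m \<Longrightarrow> f i = g i) \<Longrightarrow>
    vsum V M X f n = vsum V M Y g m" by simp
qed

end

locale comm_rig = cartesian_closed V for V :: "('o, 'a) ccc" (structure) +
  fixes R :: "('o, 'a) rig"
  assumes comm_rig: "is_comm_rig V R"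
begin

abbreviation "K \<equiv> Car R"
abbreviation "S \<equiv> rig_module R"
abbreviation add (infixl "\<oplus>" 65) where "x \<oplus> y \<equiv> Add R \<cdot> \<langle>x, y\<rangle>"
abbreviation mul (infixl "\<otimes>" 70) where "x \<otimes> y \<equiv> Mul R \<cdot> \<langle>x, y\<rangle>"
abbreviation "zero X \<equiv> Zero R \<cdot> bang V X"
abbreviation "one X \<equiv> One R \<cdot> bang V X"
abbreviation "vsum_rig \<equiv> vsum V S"

lemma is_rig: "is_rig V R" and is_cmonoid_rig: "is_cmonoid V R"
  using comm_rig by (auto simp: is_comm_rig_def is_rig_def Let_def)

lemma rig_simps [simp]:
  "K \<in> Ob V" "Add R \<in> Ar V" "Dom V (Add R) = Prod V K K" "Cod V (Add R) = K"
  "Zero R \<in> Ar V" "Dom V (Zero R) = Tml V" "Cod V (Zero R) = K"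
  "Mul R \<in> Ar V" "Dom V (Mul R) = Prod V K K" "Cod V (Mul R) = K"
  "One R \<in> Ar V" "Dom V (One R) = Tml V" "Cod V (One R) = K"
  using is_rig cmonoid_simps[OF is_cmonoid_rig] by (auto simp: is_rig_def Let_def)

lemma rig_module_simps [simp]: "Car S = K" "Add S = Add R" "Zero S = Zero R" "Act S = Mul R"
  by (simp_all add: rig_module_def)

lemma is_cmonoid_rig_module [simp]: "is_cmonoid V S"
  using is_cmonoid_rig unfolding is_cmonoid_def rig_module_simps .

lemma
  assumes "x \<in> hom V X K" "y \<in> hom V X K" "z \<in> hom V X K"
  shows add_assoc: "(x \<oplus> y) \<oplus> z = x \<oplus> (y \<oplus> z)"
    and mul_assoc: "(x \<otimes> y) \<otimes> z = x \<otimes> (y \<otimes> z)"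
    and add_mul: "(x \<oplus> y) \<otimes> z = (x \<otimes> z) \<oplus> (y \<otimes> z)"
    and mul_add: "x \<otimes> (y \<oplus> z) = (x \<otimes> y) \<oplus> (x \<otimes> z)"
proof -
  have "X \<in> Ob V" using assms by auto
  with assms show "(x \<oplus> y) \<oplus> z = x \<oplus> (y \<oplus> z)" "(x \<otimes> y) \<otimes> z = x \<otimes> (y \<otimes> z)"
    "(x \<oplus> y) \<otimes> z = (x \<otimes> z) \<oplus> (y \<otimes> z)" "x \<otimes> (y \<oplus> z) = (x \<otimes> y) \<oplus> (x \<otimes> z)"
    using is_rig unfolding is_rig_def is_cmonoid_def Let_def by blast+
qed

lemma
  assumes "x \<in> hom V X K" "y \<in> hom V X K"
  shows add_commute: "x \<oplus> y = y \<oplus> x" and mul_commute: "x \<otimes> y = y \<otimes> x"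
proof -
  have "X \<in> Ob V" using assms by auto
  with assms show "x \<oplus> y = y \<oplus> x" "x \<otimes> y = y \<otimes> x"
    using comm_rig unfolding is_comm_rig_def is_rig_def is_cmonoid_def Let_def by blast+
qed

lemma
  assumes "x \<in> Ar V" "Cod V x = K" "Dom V x = X"
  shows zero_add [simp]: "zero X \<oplus> x = x" and one_mul [simp]: "one X \<otimes> x = x"
    and mul_one [simp]: "x \<otimes> one X = x" and zero_mul [simp]: "zero X \<otimes> x = zero X"
    and mul_zero [simp]: "x \<otimes> zero X = zero X"
proof -
  have "X \<in> Ob V" "x \<in> hom V X K" using assms by auto
  then show "zero X \<oplus> x = x" "one X \<otimes> x = x" "x \<otimes> one X = x" "zero X \<otimes> x = zero X" "x \<otimes> zero X = zero X"
    using is_rig unfolding is_rig_def is_cmonoid_def Let_def by blast+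
qed

lemma add_zero [simp]:
  assumes "x \<in> Ar V" "Cod V x = K" "Dom V x = X"
  shows "x \<oplus> zero X = x"
proof -
  have "x \<oplus> zero X = zero X \<oplus> x" by (rule add_commute[of _ X]) (use assms in auto)
  then show ?thesis using assms by simp
qed

lemma add_swap:
  assumes "x \<in> hom V X K" "y \<in> hom V X K" "z \<in> hom V X K" "w \<in> hom V X K"
  shows "(x \<oplus> y) \<oplus> (z \<oplus> w) = (x \<oplus> z) \<oplus> (y \<oplus> w)"
proof -
  have "(x \<oplus> y) \<oplus> (z \<oplus> w) = x \<oplus> ((y \<oplus> z) \<oplus> w)"
    using add_assoc[of x X y "z \<oplus> w"] add_assoc[of y X z w] assms by simp
  also have "\<dots> = (x \<oplus> z) \<oplus> (y \<oplus> w)"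
    using add_assoc[of x X z "y \<oplus> w"] add_assoc[of z X y w] add_commute[of y X z] assms by simp
  finally show ?thesis .
qed

lemma vsum_zero: "X \<in> Ob V \<Longrightarrow> vsum_rig X (\<lambda>i. zero X) n = zero X"
  by (induction n) auto

lemma vsum_add:
  assumes "X \<in> Ob V" "\<And>i. i < n \<Longrightarrow> f i \<in> hom V X K" "\<And>i. i < n \<Longrightarrow> g i \<in> hom V X K"
  shows "vsum_rig X (\<lambda>i. f i \<oplus> g i) n = vsum_rig X f n \<oplus> vsum_rig X g n"
  using assms(2,3)
proof (induction n)
  case (Suc n)
  then show ?case using assms(1) by (simp add: add_swap[of _ X])
qed (use assms(1) in simp)

lemma mul_vsum:
  assumes "a \<in> hom V X K" "\<And>i. i < n \<Longrightarrow> f i \<in> hom V X K"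
  shows "a \<otimes> vsum_rig X f n = vsum_rig X (\<lambda>i. a \<otimes> f i) n"
proof -
  have X: "X \<in> Ob V" using assms(1) by auto
  from assms(2) show ?thesis
  proof (induction n)
    case (Suc n)
    then show ?case using X assms(1) mul_add[of a X "vsum_rig X f n" "f n"] by simp
  qed (use X assms(1) in simp)
qed

lemma vsum_swap:
  assumes "X \<in> Ob V" "\<And>i j. i < n \<Longrightarrow> j < m \<Longrightarrow> f i j \<in> hom V X K"
  shows "vsum_rig X (\<lambda>i. vsum_rig X (f i) m) n = vsum_rig X (\<lambda>j. vsum_rig X (\<lambda>i. f i j) n) m"
  using assms(2)
proof (induction n)
  case (Suc n)
  then show ?case using assms(1) by (simp add: vsum_add)
qed (use assms(1) in \<open>simp add: vsum_zero\<close>)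

lemma vsum_delta:
  assumes "X \<in> Ob V" "i < n" "\<And>i. i < n \<Longrightarrow> f i \<in> hom V X K"
  shows "vsum_rig X (\<lambda>j. (if i = j then one X else zero X) \<otimes> f j) n = f i"
proof -
  have "vsum_rig X (\<lambda>j. (if i = j then one X else zero X) \<otimes> f j) n = (if i < n then f i else zero X)"
    using assms(3)
  proof (induction n)
    case (Suc n)
    then show ?case using assms(1) by (cases i n rule: linorder_cases) auto
  qed (use assms(1) in simp)
  then show ?thesis using assms(2) by simp
qed


section \<open>Linear maps between powers of the rig are matrices\<close>

abbreviation "T \<equiv> Mat V R"
abbreviation "A \<equiv> module_alg V R S"
abbreviation "P \<equiv> power_alg V T A"

lemma matrix_obj_in_Ob [simp]: "matrix_obj V R m n \<in> Ob V"
  by (simp add: matrix_obj_def)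

lemma entry_simps [simp]:
  assumes "i < m" "j < n"
  shows "entry V R m n i j \<in> Ar V" "Dom V (entry V R m n i j) = matrix_obj V R m n"
    "Cod V (entry V R m n i j) = K"
  using assms by (auto simp: entry_def matrix_obj_def)

lemma matrix_simps [simp]:
  assumes "X \<in> Ob V" "\<And>i j. i < m \<Longrightarrow> j < n \<Longrightarrow> f i j \<in> Ar V"
    "\<And>i j. i < m \<Longrightarrow> j < n \<Longrightarrow> Dom V (f i j) = X" "\<And>i j. i < m \<Longrightarrow> j < n \<Longrightarrow> Cod V (f i j) = K"
  shows "matrix V R X m n f \<in> Ar V" "Dom V (matrix V R X m n f) = X"
    "Cod V (matrix V R X m n f) = matrix_obj V R m n"
    "i < m \<Longrightarrow> j < n \<Longrightarrow> entry V R m n i j \<cdot> matrix V R X m n f = f i j"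
  using assms by (auto simp: matrix_def entry_def matrix_obj_def)

lemma npow2_ext:
  assumes "h \<in> hom V Y (npow V (npow V K k) m)" "h' \<in> hom V Y (npow V (npow V K k) m)"
    "\<And>i p. i < m \<Longrightarrow> p < k \<Longrightarrow>
      nproj V K k p \<cdot> nproj V (npow V K k) m i \<cdot> h = nproj V K k p \<cdot> nproj V (npow V K k) m i \<cdot> h'"
  shows "h = h'"
  by (rule npow_ext[OF assms(1,2)], simp, rule npow_ext[of _ Y K k]) (use assms in auto)

lemma Mat_VHom [simp]: "VHom T n m = matrix_obj V R m n"
  by (simp add: Mat_def)

lemma module_alg_FOb [simp]: "FOb A n = npow V K n"
  by (simp add: module_alg_def)

lemma prealgebra_module_alg [simp]: "prealgebra V T A"
  unfolding prealgebra_def by (simp add: module_alg_def Let_def)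

lemma module_alg_app:
  assumes "t \<in> hom V Y (matrix_obj V R m n)" "x \<in> hom V Y (npow V K n)" "i < m"
  shows "nproj V K m i \<cdot> Ev V (npow V K n) (npow V K m) \<cdot> \<langle>FHom A n m \<cdot> t, x\<rangle> =
    vsum_rig Y (\<lambda>j. (entry V R m n i j \<cdot> t) \<otimes> (nproj V K n j \<cdot> x)) n"
  using assms by (simp add: module_alg_def Let_def cong: vsum_cong)

lemma power_app:
  assumes "t \<in> hom V Y (matrix_obj V R q k)" "x \<in> hom V Y (npow V (npow V K k) n)" "i < n" "r < q"
  shows "nproj V K q r \<cdot> nproj V (npow V K q) n i \<cdot>
      Ev V (npow V (npow V K k) n) (npow V (npow V K q) n) \<cdot> \<langle>FHom (P n) k q \<cdot> t, x\<rangle> =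
    vsum_rig Y (\<lambda>p. (entry V R q k r p \<cdot> t) \<otimes> (nproj V K k p \<cdot> nproj V (npow V K k) n i \<cdot> x)) k"
  using power_alg_app[of T A t k q x n i] module_alg_app[of t Y q k "nproj V (npow V K k) n i \<cdot> x" r] assms
  by simp

lemma power_simps [simp]:
  "FHom (P n) k q \<in> Ar V" "Dom V (FHom (P n) k q) = matrix_obj V R q k"
  "Cod V (FHom (P n) k q) = Exp V (npow V (npow V K k) n) (npow V (npow V K q) n)"
  using prealgebra_simps[OF prealgebra_power[OF prealgebra_module_alg, of n]] by auto

definition is_mat :: "'o \<Rightarrow> nat \<Rightarrow> nat \<Rightarrow> (nat \<Rightarrow> nat \<Rightarrow> 'a) \<Rightarrow> bool" where
  "is_mat X m n a \<longleftrightarrow> X \<in> Ob V \<and> (\<forall>i<m. \<forall>j<n. a i j \<in> hom V X K)"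

text \<open>
  The component at \<open>k\<close> of the family given by the \<open>m \<times> n\<close> matrix \<open>a\<close>: an element of \<open>(R\<^sup>k)\<^sup>n\<close>
  is an \<open>n \<times> k\<close> matrix \<open>x\<close>, and it is sent to the product \<open>a x\<close>.
\<close>

definition matrix_action :: "'o \<Rightarrow> nat \<Rightarrow> nat \<Rightarrow> (nat \<Rightarrow> nat \<Rightarrow> 'a) \<Rightarrow> nat \<Rightarrow> 'a" where
  "matrix_action X m n a k = (let Q = npow V (npow V K k) n; P = Prod V X Q in
    curry V X Q (ntuple V P (npow V K k) m (\<lambda>i. ntuple V P K k (\<lambda>p. vsum_rig P
      (\<lambda>j. (a i j \<cdot> Fst V X Q) \<otimes> (nproj V K k p \<cdot> nproj V (npow V K k) n j \<cdot> Snd V X Q)) n))))"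

lemma matrix_action_simps:
  assumes "is_mat X m n a"
  shows "matrix_action X m n a k \<in> Ar V" "Dom V (matrix_action X m n a k) = X"
    "Cod V (matrix_action X m n a k) = Exp V (npow V (npow V K k) n) (npow V (npow V K k) m)"
  using assms unfolding is_mat_def by (simp_all add: matrix_action_def Let_def)

lemma matrix_action_app:
  assumes "is_mat X m n a" "e \<in> hom V Y X" "x \<in> hom V Y (npow V (npow V K k) n)" "i < m" "p < k"
  shows "nproj V K k p \<cdot> nproj V (npow V K k) m i \<cdot>
      Ev V (npow V (npow V K k) n) (npow V (npow V K k) m) \<cdot> \<langle>matrix_action X m n a k \<cdot> e, x\<rangle> =
    vsum_rig Y (\<lambda>j. (a i j \<cdot> e) \<otimes> (nproj V K k p \<cdot> nproj V (npow V K k) n j \<cdot> x)) n"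
  using assms unfolding is_mat_def by (simp add: matrix_action_def Let_def cong: vsum_cong)

text \<open>
  A \<open>q \<times> k\<close> matrix \<open>t\<close> acts on each of the \<open>n\<close> rows of \<open>x\<close>. In coordinates, naturality is
  \<open>(\<Sum>p. t r p (\<Sum>j. a i j x j p)) = (\<Sum>j. a i j (\<Sum>p. t r p x j p))\<close>, which holds because
  multiplication is commutative.
\<close>

lemma matrix_action_natural:
  assumes a: "is_mat X m n a"
  shows "is_natural_family V T (P n) (P m) X (matrix_action X m n a)"
proof (rule natural_familyI)
  note [simp] = matrix_action_simps[OF a]
  show "matrix_action X m n a k \<in> hom V X (Exp V (FOb (P n) k) (FOb (P m) k))" for k by simp
  fix k q Y e t x
  assume Y: "Y \<in> Ob V" and e: "e \<in> hom V Y X" and t: "t \<in> hom V Y (VHom T k q)"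
    and x: "x \<in> hom V Y (FOb (P n) k)"
  let ?ax = "Ev V (npow V (npow V K k) n) (npow V (npow V K k) m) \<cdot> \<langle>matrix_action X m n a k \<cdot> e, x\<rangle>"
  let ?tx = "Ev V (npow V (npow V K k) n) (npow V (npow V K q) n) \<cdot> \<langle>FHom (P n) k q \<cdot> t, x\<rangle>"
  have "Ev V (npow V (npow V K k) m) (npow V (npow V K q) m) \<cdot> \<langle>FHom (P m) k q \<cdot> t, ?ax\<rangle> =
    Ev V (npow V (npow V K q) n) (npow V (npow V K q) m) \<cdot> \<langle>matrix_action X m n a q \<cdot> e, ?tx\<rangle>"
  proof (rule npow2_ext[where Y = Y])
    fix i r assume i: "i < m" and r: "r < q"
    let ?a = "\<lambda>j. a i j \<cdot> e" and ?t = "\<lambda>p. entry V R q k r p \<cdot> t"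
      and ?x = "\<lambda>j p. nproj V K k p \<cdot> nproj V (npow V K k) n j \<cdot> x"
    have [simp]: "?a j \<in> Ar V" "Dom V (?a j) = Y" "Cod V (?a j) = K" if "j < n" for j
      using a e i that by (auto simp: is_mat_def)
    have [simp]: "?t p \<in> Ar V" "Dom V (?t p) = Y" "Cod V (?t p) = K" if "p < k" for p
      using t r that by auto
    have [simp]: "?x j p \<in> Ar V" "Dom V (?x j p) = Y" "Cod V (?x j p) = K" if "j < n" "p < k" for j p
      using x that by auto
    have 1: "?t p \<otimes> (?a j \<otimes> ?x j p) = ?a j \<otimes> (?t p \<otimes> ?x j p)" if "j < n" "p < k" for j p
      using that mul_assoc[of "?t p" Y "?a j" "?x j p"] mul_assoc[of "?a j" Y "?t p" "?x j p"]
        mul_commute[of "?t p" Y "?a j"] by simp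
    have "nproj V K q r \<cdot> nproj V (npow V K q) m i \<cdot>
        Ev V (npow V (npow V K k) m) (npow V (npow V K q) m) \<cdot> \<langle>FHom (P m) k q \<cdot> t, ?ax\<rangle> =
      vsum_rig Y (\<lambda>p. ?t p \<otimes> (nproj V K k p \<cdot> nproj V (npow V K k) m i \<cdot> ?ax)) k"
      by (rule power_app) (use e t x i r in auto)
    also have "\<dots> = vsum_rig Y (\<lambda>p. ?t p \<otimes> vsum_rig Y (\<lambda>j. ?a j \<otimes> ?x j p) n) k"
      using matrix_action_app[OF a e, of x k i] x i by (intro vsum_cong) auto
    also have "\<dots> = vsum_rig Y (\<lambda>p. vsum_rig Y (\<lambda>j. ?t p \<otimes> (?a j \<otimes> ?x j p)) n) k"
      by (intro vsum_cong refl mul_vsum) auto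
    also have "\<dots> = vsum_rig Y (\<lambda>j. vsum_rig Y (\<lambda>p. ?t p \<otimes> (?a j \<otimes> ?x j p)) k) n"
      by (rule vsum_swap[OF Y]) auto
    also have "\<dots> = vsum_rig Y (\<lambda>j. vsum_rig Y (\<lambda>p. ?a j \<otimes> (?t p \<otimes> ?x j p)) k) n"
      by (intro vsum_cong refl 1)
    also have "\<dots> = vsum_rig Y (\<lambda>j. ?a j \<otimes> vsum_rig Y (\<lambda>p. ?t p \<otimes> ?x j p) k) n"
      by (intro vsum_cong refl mul_vsum[symmetric]) auto
    also have "\<dots> = vsum_rig Y (\<lambda>j. ?a j \<otimes> (nproj V K q r \<cdot> nproj V (npow V K q) n j \<cdot> ?tx)) n"
      using power_app[of t Y q k x n _ r] t x r by (intro vsum_cong) auto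
    also have "\<dots> = nproj V K q r \<cdot> nproj V (npow V K q) m i \<cdot>
        Ev V (npow V (npow V K q) n) (npow V (npow V K q) m) \<cdot> \<langle>matrix_action X m n a q \<cdot> e, ?tx\<rangle>"
      by (rule matrix_action_app[OF a e, symmetric]) (use t x i r in auto)
    finally show "nproj V K q r \<cdot> nproj V (npow V K q) m i \<cdot>
        Ev V (npow V (npow V K k) m) (npow V (npow V K q) m) \<cdot> \<langle>FHom (P m) k q \<cdot> t, ?ax\<rangle> =
      nproj V K q r \<cdot> nproj V (npow V K q) m i \<cdot>
        Ev V (npow V (npow V K q) n) (npow V (npow V K q) m) \<cdot> \<langle>matrix_action X m n a q \<cdot> e, ?tx\<rangle>" .
  qed (use e t x in auto)
  then show "Ev V (FOb (P m) k) (FOb (P m) q) \<cdot> \<langle>FHom (P m) k q \<cdot> t,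
      Ev V (FOb (P n) k) (FOb (P m) k) \<cdot> \<langle>matrix_action X m n a k \<cdot> e, x\<rangle>\<rangle> =
    Ev V (FOb (P n) q) (FOb (P m) q) \<cdot> \<langle>matrix_action X m n a q \<cdot> e,
      Ev V (FOb (P n) k) (FOb (P n) q) \<cdot> \<langle>FHom (P n) k q \<cdot> t, x\<rangle>\<rangle>"
    by simp
qed simp_all

text \<open>The \<open>j\<close>-th standard basis vector of \<open>R\<^sup>n\<close>; it is the zero vector if \<open>j \<ge> n\<close>.\<close>

definition unitvec :: "'o \<Rightarrow> nat \<Rightarrow> nat \<Rightarrow> 'a" where
  "unitvec X n j = ntuple V X K n (\<lambda>p. if j = p then one X else zero X)"

lemma unitvec_simps [simp]:
  assumes "X \<in> Ob V"
  shows "unitvec X n j \<in> Ar V" "Dom V (unitvec X n j) = X" "Cod V (unitvec X n j) = npow V K n"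
    "p < n \<Longrightarrow> nproj V K n p \<cdot> unitvec X n j = (if j = p then one X else zero X)"
  using assms by (auto simp: unitvec_def)

lemma unitvec_comp:
  assumes "e \<in> hom V Y X"
  shows "unitvec X n j \<cdot> e = unitvec Y n j"
proof (rule npow_ext[where X = Y and A = K and n = n])
  have XY: "X \<in> Ob V" "Y \<in> Ob V" using assms by auto
  show "unitvec X n j \<cdot> e \<in> hom V Y (npow V K n)" "unitvec Y n j \<in> hom V Y (npow V K n)"
    using XY assms by auto
  show "nproj V K n i \<cdot> unitvec X n j \<cdot> e = nproj V K n i \<cdot> unitvec Y n j" if "i < n" for i
    using XY assms that by (simp add: unitvec_def)
qed simp

lemma vsum_delta':
  assumes "X \<in> Ob V" "i < n" "\<And>i. i < n \<Longrightarrow> f i \<in> hom V X K"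
  shows "vsum_rig X (\<lambda>j. f j \<otimes> (if i = j then one X else zero X)) n = f i"
proof -
  have "vsum_rig X (\<lambda>j. f j \<otimes> (if i = j then one X else zero X)) n =
    vsum_rig X (\<lambda>j. (if i = j then one X else zero X) \<otimes> f j) n"
    by (intro vsum_cong refl mul_commute[of _ X]) (use assms in auto)
  then show ?thesis using vsum_delta[OF assms] by simp
qed

text \<open>
  This is naturality at the \<open>p\<close>-th unit row \<open>k \<rightarrow> 1\<close> of the theory of matrices, which acts by
  selecting the \<open>p\<close>-th coordinate. So a natural family is determined by its component at \<open>1\<close>.
\<close>

lemma natural_family_component:
  assumes l: "is_natural_family V T (P n) (P m) X l"
    and e: "e \<in> hom V Y X" and x: "x \<in> hom V Y (npow V (npow V K k) n)" and i: "i < m" and p: "p < k"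
  shows "nproj V K k p \<cdot> nproj V (npow V K k) m i \<cdot>
      Ev V (npow V (npow V K k) n) (npow V (npow V K k) m) \<cdot> \<langle>l k \<cdot> e, x\<rangle> =
    nproj V K m i \<cdot> Ev V (npow V K n) (npow V K m) \<cdot>
      \<langle>l 1 \<cdot> e, ntuple V Y K n (\<lambda>j. nproj V K k p \<cdot> nproj V (npow V K k) n j \<cdot> x)\<rangle>"
proof -
  have Y: "Y \<in> Ob V" using e by auto
  have lk: "l k \<in> hom V X (Exp V (npow V (npow V K k) n) (npow V (npow V K k) m))"
    using natural_family_in_hom[OF l, of k] by simp
  define t where "t = matrix V R Y 1 k (\<lambda>_ q. if p = q then one Y else zero Y)"
  have t: "t \<in> hom V Y (matrix_obj V R 1 k)" using Y by (simp add: t_def)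
  have tpq: "entry V R 1 k 0 q \<cdot> t = (if p = q then one Y else zero Y)" if "q < k" for q
    using Y that by (simp add: t_def)
  let ?lx = "Ev V (npow V (npow V K k) n) (npow V (npow V K k) m) \<cdot> \<langle>l k \<cdot> e, x\<rangle>"
  let ?tx = "Ev V (npow V (npow V K k) n) (npow V K n) \<cdot> \<langle>FHom (P n) k 1 \<cdot> t, x\<rangle>"
  have lx: "?lx \<in> hom V Y (npow V (npow V K k) m)" using lk e x by simp
  have act: "nproj V K n j \<cdot> Ev V (npow V (npow V K k) n) (npow V K n) \<cdot> \<langle>FHom (P n) k 1 \<cdot> t, z\<rangle> =
      nproj V K k p \<cdot> nproj V (npow V K k) n j \<cdot> z"
    if z: "z \<in> hom V Y (npow V (npow V K k) n)" and j: "j < n" for n j z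
  proof -
    have "nproj V K n j \<cdot> Ev V (npow V (npow V K k) n) (npow V K n) \<cdot> \<langle>FHom (P n) k 1 \<cdot> t, z\<rangle> =
      vsum_rig Y (\<lambda>q. (entry V R 1 k 0 q \<cdot> t) \<otimes> (nproj V K k q \<cdot> nproj V (npow V K k) n j \<cdot> z)) k"
      using power_app[OF t z j, of 0] j z t by simp
    also have "\<dots> = vsum_rig Y (\<lambda>q. (if p = q then one Y else zero Y) \<otimes>
        (nproj V K k q \<cdot> nproj V (npow V K k) n j \<cdot> z)) k"
      by (intro vsum_cong refl) (simp only: tpq)
    also have "\<dots> = nproj V K k p \<cdot> nproj V (npow V K k) n j \<cdot> z"
      by (rule vsum_delta[OF Y p]) (use z j in auto)
    finally show ?thesis .
  qed
  have "?tx = ntuple V Y K n (\<lambda>j. nproj V K k p \<cdot> nproj V (npow V K k) n j \<cdot> x)"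
  proof (rule npow_ext[where X = Y and A = K and n = n])
    show "nproj V K n j \<cdot> ?tx =
        nproj V K n j \<cdot> ntuple V Y K n (\<lambda>j. nproj V K k p \<cdot> nproj V (npow V K k) n j \<cdot> x)"
      if "j < n" for j using act[OF x that] that x p Y by simp
  qed (use t x Y p in auto)
  moreover have "Ev V (npow V K n) (npow V K m) \<cdot> \<langle>l 1 \<cdot> e, ?tx\<rangle> =
      Ev V (npow V (npow V K k) m) (npow V K m) \<cdot> \<langle>FHom (P m) k 1 \<cdot> t, ?lx\<rangle>"
    using natural_familyD[OF l _ _ e, of t k 1 x] t x by simp
  ultimately show ?thesis using act[OF lx i] by simp
qed

text \<open>
  A vector \<open>y\<close> is also a row \<open>n \<rightarrow> 1\<close> of the theory. As such it sends the tuple of all unit vectors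
  to \<open>y\<close>, so naturality at this row makes the component at \<open>1\<close> linear.
\<close>

lemma natural_family_linear:
  assumes l: "is_natural_family V T (P n) (P m) X l"
    and e: "e \<in> hom V Y X" and y: "y \<in> hom V Y (npow V K n)" and i: "i < m"
  shows "nproj V K m i \<cdot> Ev V (npow V K n) (npow V K m) \<cdot> \<langle>l 1 \<cdot> e, y\<rangle> =
    vsum_rig Y (\<lambda>j. (nproj V K m i \<cdot> Ev V (npow V K n) (npow V K m) \<cdot> \<langle>l 1 \<cdot> e, unitvec Y n j\<rangle>) \<otimes>
      (nproj V K n j \<cdot> y)) n"
proof -
  have Y: "Y \<in> Ob V" using e by auto
  have l1: "l 1 \<in> hom V X (Exp V (npow V K n) (npow V K m))"
    and ln: "l n \<in> hom V X (Exp V (npow V (npow V K n) n) (npow V (npow V K n) m))"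
    using natural_family_in_hom[OF l, of 1] natural_family_in_hom[OF l, of n] by auto
  \<comment> \<open>The identity matrix, as an element of \<open>(R\<^sup>n)\<^sup>n\<close>; its columns are again the unit vectors.\<close>
  define u where "u = ntuple V Y (npow V K n) n (unitvec Y n)"
  have u: "u \<in> hom V Y (npow V (npow V K n) n)" using Y by (simp add: u_def)
  have uq: "ntuple V Y K n (\<lambda>j. nproj V K n q \<cdot> nproj V (npow V K n) n j \<cdot> u) = unitvec Y n q"
    if "q < n" for q
    by (rule npow_ext[where X = Y and A = K and n = n]) (use Y that in \<open>auto simp: u_def\<close>)
  define t where "t = matrix V R Y 1 n (\<lambda>_ j. nproj V K n j \<cdot> y)"
  have t: "t \<in> hom V Y (matrix_obj V R 1 n)" using Y y by (simp add: t_def)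
  have tq: "entry V R 1 n 0 q \<cdot> t = nproj V K n q \<cdot> y" if "q < n" for q
    using Y y that by (simp add: t_def)
  let ?lu = "Ev V (npow V (npow V K n) n) (npow V (npow V K n) m) \<cdot> \<langle>l n \<cdot> e, u\<rangle>"
  let ?tu = "Ev V (npow V (npow V K n) n) (npow V K n) \<cdot> \<langle>FHom (P n) n 1 \<cdot> t, u\<rangle>"
  have lu: "?lu \<in> hom V Y (npow V (npow V K n) m)" using ln e u by simp
  have act: "nproj V K m j \<cdot> Ev V (npow V (npow V K n) m) (npow V K m) \<cdot> \<langle>FHom (P m) n 1 \<cdot> t, z\<rangle> =
      vsum_rig Y (\<lambda>q. (nproj V K n q \<cdot> y) \<otimes> (nproj V K n q \<cdot> nproj V (npow V K n) m j \<cdot> z)) n"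
    if z: "z \<in> hom V Y (npow V (npow V K n) m)" and j: "j < m" for m j z
  proof -
    have "nproj V K m j \<cdot> Ev V (npow V (npow V K n) m) (npow V K m) \<cdot> \<langle>FHom (P m) n 1 \<cdot> t, z\<rangle> =
      vsum_rig Y (\<lambda>q. (entry V R 1 n 0 q \<cdot> t) \<otimes> (nproj V K n q \<cdot> nproj V (npow V K n) m j \<cdot> z)) n"
      using power_app[OF t z j, of 0] j z t by simp
    then show ?thesis by (simp add: tq cong: vsum_cong del: One_nat_def)
  qed
  have "?tu = y"
  proof (rule npow_ext[where X = Y and A = K and n = n])
    fix j assume j: "j < n"
    have "nproj V K n j \<cdot> ?tu =
      vsum_rig Y (\<lambda>q. (nproj V K n q \<cdot> y) \<otimes> (if j = q then one Y else zero Y)) n"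
      unfolding act[OF u j] by (intro vsum_cong refl) (use Y j in \<open>simp add: u_def\<close>)
    also have "\<dots> = nproj V K n j \<cdot> y" by (rule vsum_delta'[OF Y j]) (use y in auto)
    finally show "nproj V K n j \<cdot> ?tu = nproj V K n j \<cdot> y" .
  qed (use t u y in auto)
  moreover have "Ev V (npow V K n) (npow V K m) \<cdot> \<langle>l 1 \<cdot> e, ?tu\<rangle> =
      Ev V (npow V (npow V K n) m) (npow V K m) \<cdot> \<langle>FHom (P m) n 1 \<cdot> t, ?lu\<rangle>"
    using natural_familyD[OF l _ _ e, of t n 1 u] t u by simp
  ultimately have "nproj V K m i \<cdot> Ev V (npow V K n) (npow V K m) \<cdot> \<langle>l 1 \<cdot> e, y\<rangle> =
      vsum_rig Y (\<lambda>q. (nproj V K n q \<cdot> y) \<otimes> (nproj V K n q \<cdot> nproj V (npow V K n) m i \<cdot> ?lu)) n"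
    using act[OF lu i] by simp
  also have "\<dots> = vsum_rig Y (\<lambda>q. (nproj V K n q \<cdot> y) \<otimes>
      (nproj V K m i \<cdot> Ev V (npow V K n) (npow V K m) \<cdot> \<langle>l 1 \<cdot> e, unitvec Y n q\<rangle>)) n"
    by (intro vsum_cong refl) (simp only: natural_family_component[OF l e u i] uq)
  also have "\<dots> = vsum_rig Y (\<lambda>q. (nproj V K m i \<cdot> Ev V (npow V K n) (npow V K m) \<cdot>
      \<langle>l 1 \<cdot> e, unitvec Y n q\<rangle>) \<otimes> (nproj V K n q \<cdot> y)) n"
    by (intro vsum_cong refl mul_commute[of _ Y]) (use l1 e y i Y in auto)
  finally show ?thesis .
qed

text \<open>The columns of the matrix are the values at the unit vectors.\<close>

definition family_matrix :: "'o \<Rightarrow> nat \<Rightarrow> nat \<Rightarrow> 'a \<Rightarrow> nat \<Rightarrow> nat \<Rightarrow> 'a" where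
  "family_matrix X m n g i j =
    nproj V K m i \<cdot> Ev V (npow V K n) (npow V K m) \<cdot> \<langle>g, unitvec X n j\<rangle>"

lemma family_matrix_is_mat:
  assumes "g \<in> hom V X (Exp V (npow V K n) (npow V K m))"
  shows "is_mat X m n (family_matrix X m n g)"
proof -
  have "X \<in> Ob V" using assms by auto
  then show ?thesis using assms by (simp add: is_mat_def family_matrix_def)
qed

lemma natural_family_eq_matrix_action:
  assumes l: "is_natural_family V T (P n) (P m) X l"
  shows "l k = matrix_action X m n (family_matrix X m n (l 1)) k"
proof -
  have l1: "l 1 \<in> hom V X (Exp V (npow V K n) (npow V K m))"
    and lk: "l k \<in> hom V X (Exp V (npow V (npow V K k) n) (npow V (npow V K k) m))"
    using natural_family_in_hom[OF l, of 1] natural_family_in_hom[OF l, of k] by auto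
  note mat = family_matrix_is_mat[OF l1]
  show ?thesis
  proof (rule exp_ext[OF lk])
    fix Y e x assume Y: "Y \<in> Ob V" and e: "e \<in> hom V Y X" and x: "x \<in> hom V Y (npow V (npow V K k) n)"
    show "Ev V (npow V (npow V K k) n) (npow V (npow V K k) m) \<cdot> \<langle>l k \<cdot> e, x\<rangle> =
      Ev V (npow V (npow V K k) n) (npow V (npow V K k) m) \<cdot>
        \<langle>matrix_action X m n (family_matrix X m n (l 1)) k \<cdot> e, x\<rangle>"
    proof (rule npow2_ext[where Y = Y])
      fix i p assume i: "i < m" and p: "p < k"
      let ?xp = "ntuple V Y K n (\<lambda>j. nproj V K k p \<cdot> nproj V (npow V K k) n j \<cdot> x)"
      have xp: "?xp \<in> hom V Y (npow V K n)" using x Y p by simp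
      have fm: "family_matrix X m n (l 1) i j \<cdot> e =
          nproj V K m i \<cdot> Ev V (npow V K n) (npow V K m) \<cdot> \<langle>l 1 \<cdot> e, unitvec Y n j\<rangle>" for j
        using l1 e i Y hom_Ob[OF e] by (simp add: family_matrix_def unitvec_comp[of e Y X])
      have "nproj V K k p \<cdot> nproj V (npow V K k) m i \<cdot>
          Ev V (npow V (npow V K k) n) (npow V (npow V K k) m) \<cdot> \<langle>l k \<cdot> e, x\<rangle> =
        vsum_rig Y (\<lambda>j. (nproj V K m i \<cdot> Ev V (npow V K n) (npow V K m) \<cdot> \<langle>l 1 \<cdot> e, unitvec Y n j\<rangle>) \<otimes>
          (nproj V K n j \<cdot> ?xp)) n"
        unfolding natural_family_component[OF l e x i p] by (rule natural_family_linear[OF l e xp i])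
      also have "\<dots> = vsum_rig Y (\<lambda>j. (family_matrix X m n (l 1) i j \<cdot> e) \<otimes>
          (nproj V K k p \<cdot> nproj V (npow V K k) n j \<cdot> x)) n"
        unfolding fm by (intro vsum_cong refl) (use x Y p in simp)
      finally show "nproj V K k p \<cdot> nproj V (npow V K k) m i \<cdot>
          Ev V (npow V (npow V K k) n) (npow V (npow V K k) m) \<cdot> \<langle>l k \<cdot> e, x\<rangle> =
        nproj V K k p \<cdot> nproj V (npow V K k) m i \<cdot>
          Ev V (npow V (npow V K k) n) (npow V (npow V K k) m) \<cdot>
            \<langle>matrix_action X m n (family_matrix X m n (l 1)) k \<cdot> e, x\<rangle>"
        unfolding matrix_action_app[OF mat e x i p] .
    qed (use lk e x matrix_action_simps[OF mat] in auto)
  qed (use matrix_action_simps[OF mat] in auto)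
qed

lemma family_matrix_matrix_action:
  assumes a: "is_mat X m n a" and i: "i < m" and j: "j < n"
  shows "family_matrix X m n (matrix_action X m n a 1) i j = a i j"
proof -
  have X: "X \<in> Ob V" using a by (simp add: is_mat_def)
  have "family_matrix X m n (matrix_action X m n a 1) i j =
    vsum_rig X (\<lambda>q. (a i q \<cdot> Ide V X) \<otimes> (nproj V K n q \<cdot> unitvec X n j)) n"
    using matrix_action_app[OF a, of "Ide V X" X "unitvec X n j" 1 i 0] X i matrix_action_simps[OF a]
    by (simp add: family_matrix_def cong: vsum_cong)
  also have "\<dots> = vsum_rig X (\<lambda>q. a i q \<otimes> (if j = q then one X else zero X)) n"
    using X a i by (intro vsum_cong refl) (simp add: is_mat_def)
  also have "\<dots> = a i j" by (rule vsum_delta'[OF X j]) (use a i in \<open>simp add: is_mat_def\<close>)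
  finally show ?thesis .
qed

lemma matrix_action_cong:
  assumes "\<And>i j. i < m \<Longrightarrow> j < n \<Longrightarrow> a i j = b i j" "is_mat X m n a" "is_mat X m n b"
  shows "matrix_action X m n a k = matrix_action X m n b k"
proof (rule exp_ext[where X = X])
  fix Y e x
  assume *: "e \<in> hom V Y X" "x \<in> hom V Y (npow V (npow V K k) n)"
  show "Ev V (npow V (npow V K k) n) (npow V (npow V K k) m) \<cdot> \<langle>matrix_action X m n a k \<cdot> e, x\<rangle> =
    Ev V (npow V (npow V K k) n) (npow V (npow V K k) m) \<cdot> \<langle>matrix_action X m n b k \<cdot> e, x\<rangle>"
  proof (rule npow2_ext[where Y = Y])
    show "nproj V K k p \<cdot> nproj V (npow V K k) m i \<cdot>
        Ev V (npow V (npow V K k) n) (npow V (npow V K k) m) \<cdot> \<langle>matrix_action X m n a k \<cdot> e, x\<rangle> =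
      nproj V K k p \<cdot> nproj V (npow V K k) m i \<cdot>
        Ev V (npow V (npow V K k) n) (npow V (npow V K k) m) \<cdot> \<langle>matrix_action X m n b k \<cdot> e, x\<rangle>"
      if "i < m" "p < k" for i p
      unfolding matrix_action_app[OF assms(2) * that] matrix_action_app[OF assms(3) * that]
      by (intro vsum_cong refl) (simp add: assms(1) that)
  qed (use * matrix_action_simps[OF assms(2)] matrix_action_simps[OF assms(3)] in simp_all)
qed (use matrix_action_simps[OF assms(2)] matrix_action_simps[OF assms(3)] in simp_all)

lemma matrix_action_comp:
  assumes a: "is_mat X m n a" and h: "h \<in> hom V Z X"
  shows "matrix_action X m n a k \<cdot> h = matrix_action Z m n (\<lambda>i j. a i j \<cdot> h) k"
proof (rule exp_ext[where X = Z])
  have b: "is_mat Z m n (\<lambda>i j. a i j \<cdot> h)" using a h by (auto simp: is_mat_def)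
  note [simp] = matrix_action_simps[OF a] matrix_action_simps[OF b]
  show "matrix_action X m n a k \<cdot> h \<in> hom V Z (Exp V (npow V (npow V K k) n) (npow V (npow V K k) m))"
    "matrix_action Z m n (\<lambda>i j. a i j \<cdot> h) k \<in> hom V Z (Exp V (npow V (npow V K k) n) (npow V (npow V K k) m))"
    using h by auto
  fix Y e x
  assume e: "e \<in> hom V Y Z" and x: "x \<in> hom V Y (npow V (npow V K k) n)"
  have he: "h \<cdot> e \<in> hom V Y X" using h e by simp
  have aij: "a i j \<in> hom V X K" if "i < m" "j < n" for i j using a that by (simp add: is_mat_def)
  show "Ev V (npow V (npow V K k) n) (npow V (npow V K k) m) \<cdot> \<langle>(matrix_action X m n a k \<cdot> h) \<cdot> e, x\<rangle> =
    Ev V (npow V (npow V K k) n) (npow V (npow V K k) m) \<cdot> \<langle>matrix_action Z m n (\<lambda>i j. a i j \<cdot> h) k \<cdot> e, x\<rangle>"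
  proof (rule npow2_ext[where Y = Y])
    have [simp]: "(matrix_action X m n a k \<cdot> h) \<cdot> e = matrix_action X m n a k \<cdot> h \<cdot> e" using h e by simp
    show "nproj V K k p \<cdot> nproj V (npow V K k) m i \<cdot>
        Ev V (npow V (npow V K k) n) (npow V (npow V K k) m) \<cdot> \<langle>(matrix_action X m n a k \<cdot> h) \<cdot> e, x\<rangle> =
      nproj V K k p \<cdot> nproj V (npow V K k) m i \<cdot>
        Ev V (npow V (npow V K k) n) (npow V (npow V K k) m) \<cdot>
          \<langle>matrix_action Z m n (\<lambda>i j. a i j \<cdot> h) k \<cdot> e, x\<rangle>"
      if "i < m" "p < k" for i p
      unfolding matrix_action_app[OF b e x that] \<open>(matrix_action X m n a k \<cdot> h) \<cdot> e = _\<close> matrix_action_app[OF a he x that]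
      by (intro vsum_cong refl) (use aij h e that in simp)
  qed (use h e x in simp_all)
qed simp_all

text \<open>
  By the preceding lemmas, \<open>family_matrix\<close> and \<open>matrix_action\<close> are mutually inverse and compatible
  with change of stage. So the end defining the hom-objects of the commutant exists, and it is the
  object of matrices.
\<close>

lemma matrix_obj_is_alg_obj:
  "is_alg_obj V T (P n) (P m) (matrix_obj V R m n, matrix_action (matrix_obj V R m n) m n (entry V R m n))"
proof -
  let ?M = "matrix_obj V R m n" and ?e = "entry V R m n"
  have mat: "is_mat ?M m n ?e" by (simp add: is_mat_def)
  have mat_h: "is_mat X m n (\<lambda>i j. ?e i j \<cdot> h)" if "h \<in> hom V X ?M" for h X
    using that by (auto simp: is_mat_def)
  have "\<exists>!h. h \<in> hom V X ?M \<and> (\<forall>k. matrix_action ?M m n ?e k \<cdot> h = l k)"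
    if X: "X \<in> Ob V" and l: "is_natural_family V T (P n) (P m) X l" for X l
  proof -
    let ?a = "family_matrix X m n (l 1)"
    let ?h = "matrix V R X m n ?a"
    have a: "is_mat X m n ?a"
      using natural_family_in_hom[OF l, of 1] by (intro family_matrix_is_mat) simp
    have h: "?h \<in> hom V X ?M" using a by (simp add: is_mat_def)
    have eh: "?e i j \<cdot> ?h = ?a i j" if "i < m" "j < n" for i j
      using a that by (simp add: is_mat_def)
    have 1: "matrix_action ?M m n ?e k \<cdot> ?h = l k" for k
      unfolding natural_family_eq_matrix_action[OF l, of k] matrix_action_comp[OF mat h]
      by (rule matrix_action_cong[OF _ mat_h[OF h] a]) (rule eh)
    show ?thesis
    proof (rule ex1I[of _ ?h])
      fix g assume g: "g \<in> hom V X ?M \<and> (\<forall>k. matrix_action ?M m n ?e k \<cdot> g = l k)"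
      have "matrix_action X m n (\<lambda>i j. ?e i j \<cdot> g) 1 = l 1"
        using g matrix_action_comp[OF mat, of g X 1] by simp
      with family_matrix_matrix_action[OF mat_h[of g X]] g
      have ge: "?e i j \<cdot> g = ?e i j \<cdot> ?h" if "i < m" "j < n" for i j
        using that eh[OF that] by metis
      have g1: "g \<in> hom V X (npow V (npow V K n) m)" "?h \<in> hom V X (npow V (npow V K n) m)"
        using g h by (simp_all add: matrix_obj_def)
      show "g = ?h"
        by (rule npow2_ext[OF g1]) (use ge g1 in \<open>simp add: entry_def\<close>)
    qed (use h 1 in simp)
  qed
  then show ?thesis unfolding is_alg_obj_def using matrix_action_natural[OF mat] by simp
qed


section \<open>The commutant of the theory of matrices\<close>

abbreviation "T' \<equiv> commutant V T A"
abbreviation "S' \<equiv> commutant_alg V T A"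
abbreviation "H n m \<equiv> alg_obj V T (P n) (P m)"
abbreviation "pr n m \<equiv> alg_pr V T (P n) (P m)"

lemma H_is_alg_obj: "is_alg_obj V T (P n) (P m) (H n m, pr n m)"
  by (rule alg_obj_props[OF matrix_obj_is_alg_obj])

lemma pr_natural: "is_natural_family V T (P n) (P m) (H n m) (pr n m)"
  using H_is_alg_obj[of n m] by (simp add: is_alg_obj_def)

lemma H_simps [simp]: "H n m \<in> Ob V" "pr n m k \<in> Ar V" "Dom V (pr n m k) = H n m"
  "Cod V (pr n m k) = Exp V (npow V (npow V K k) n) (npow V (npow V K k) m)"
  using H_is_alg_obj[of n m] natural_family_in_hom[OF pr_natural, of n m k]
  by (auto simp: is_alg_obj_def)

lemma pr_restrict:
  "u \<in> hom V X (H n m) \<Longrightarrow> is_natural_family V T (P n) (P m) X (\<lambda>k. pr n m k \<cdot> u)"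
  by (rule natural_family_restrict[OF pr_natural]) auto

lemma H_ext:
  assumes "u \<in> hom V X (H n m)" "v \<in> hom V X (H n m)"
    "\<And>k Y e x. Y \<in> Ob V \<Longrightarrow> e \<in> hom V Y X \<Longrightarrow> x \<in> hom V Y (npow V (npow V K k) n) \<Longrightarrow>
      Ev V (npow V (npow V K k) n) (npow V (npow V K k) m) \<cdot> \<langle>(pr n m k \<cdot> u) \<cdot> e, x\<rangle> =
      Ev V (npow V (npow V K k) n) (npow V (npow V K k) m) \<cdot> \<langle>(pr n m k \<cdot> v) \<cdot> e, x\<rangle>"
  shows "u = v"
proof (rule is_alg_obj_ext[OF H_is_alg_obj _ _ assms(1,2)])
  fix k
  show "pr n m k \<cdot> u = pr n m k \<cdot> v"
    by (rule exp_ext[where X = X and A = "npow V (npow V K k) n" and B = "npow V (npow V K k) m"])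
      (use assms(1,2) in simp, use assms(1,2) in simp, simp, simp, rule assms(3))
qed auto

lemma commutant_simps [simp]: "VOb T' = UNIV" "VHom T' n m = H n m"
  by (simp_all add: commutant_def)

lemma commutant_comp_simps:
  "VComp T' n m k \<in> hom V (Prod V (H m k) (H n m)) (H n k)"
  "pr n k j \<cdot> VComp T' n m k = vc V (selfv V) (npow V (npow V K j) n) (npow V (npow V K j) m)
    (npow V (npow V K j) k) (pr m k j \<cdot> Fst V (H m k) (H n m)) (pr n m j \<cdot> Snd V (H m k) (H n m))"
proof -
  let ?l = "\<lambda>j. vc V (selfv V) (npow V (npow V K j) n) (npow V (npow V K j) m)
    (npow V (npow V K j) k) (pr m k j \<cdot> Fst V (H m k) (H n m)) (pr n m j \<cdot> Snd V (H m k) (H n m))"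
  have "is_natural_family V T (P n) (P k) (Prod V (H m k) (H n m)) ?l"
    using natural_family_comp[OF pr_restrict[of "Snd V (H m k) (H n m)" _ n m]
        pr_restrict[of "Fst V (H m k) (H n m)" _ m k]] by simp
  from alg_in_props[OF H_is_alg_obj this]
  show "VComp T' n m k \<in> hom V (Prod V (H m k) (H n m)) (H n k)" "pr n k j \<cdot> VComp T' n m k = ?l j"
    by (simp_all add: commutant_def Let_def)
qed

lemma commutant_vc [simp]:
  assumes "g \<in> Ar V" "Cod V g = H m k" "f \<in> Ar V" "Cod V f = H n m" "Dom V g = Dom V f"
  shows "vc V T' n m k g f \<in> Ar V" "Dom V (vc V T' n m k g f) = Dom V f"
    "Cod V (vc V T' n m k g f) = H n k"
    "pr n k j \<cdot> vc V T' n m k g f = vc V (selfv V) (npow V (npow V K j) n) (npow V (npow V K j) m)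
      (npow V (npow V K j) k) (pr m k j \<cdot> g) (pr n m j \<cdot> f)"
proof -
  note [simp] = commutant_comp_simps(1)[of n m k, simplified]
  show "vc V T' n m k g f \<in> Ar V" "Dom V (vc V T' n m k g f) = Dom V f"
    "Cod V (vc V T' n m k g f) = H n k"
    using assms by (simp_all add: vc_def)
  have "pr n k j \<cdot> vc V T' n m k g f = (pr n k j \<cdot> VComp T' n m k) \<cdot> \<langle>g, f\<rangle>"
    using assms by (simp add: vc_def)
  then show "pr n k j \<cdot> vc V T' n m k g f = vc V (selfv V) (npow V (npow V K j) n)
      (npow V (npow V K j) m) (npow V (npow V K j) k) (pr m k j \<cdot> g) (pr n m j \<cdot> f)"
    unfolding commutant_comp_simps(2) using assms by simp
qed

lemma commutant_id [simp]:
  "VId T' n \<in> Ar V" "Dom V (VId T' n) = Tml V" "Cod V (VId T' n) = H n n"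
  "pr n n k \<cdot> VId T' n = name V (Ide V (npow V (npow V K k) n))"
  "e \<in> Ar V \<Longrightarrow> Cod V e = Tml V \<Longrightarrow>
    pr n n k \<cdot> VId T' n \<cdot> e = name V (Ide V (npow V (npow V K k) n)) \<cdot> e"
proof -
  have "is_natural_family V T (P n) (P n) (Tml V) (\<lambda>k. name V (Ide V (npow V (npow V K k) n)))"
    using natural_family_id[of T "P n"] by simp
  from alg_in_props[OF H_is_alg_obj this]
  show *: "VId T' n \<in> Ar V" "Dom V (VId T' n) = Tml V" "Cod V (VId T' n) = H n n"
    "pr n n k \<cdot> VId T' n = name V (Ide V (npow V (npow V K k) n))" for k
    by (simp_all add: commutant_def Let_def)
  assume "e \<in> Ar V" "Cod V e = Tml V"
  then show "pr n n k \<cdot> VId T' n \<cdot> e = name V (Ide V (npow V (npow V K k) n)) \<cdot> e"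
    using *(4)[of k] comp_assoc'[of e "VId T' n" "pr n n k"] *(1-3) by simp
qed

lemma commutant_vcategory: "is_vcategory V T'"
  unfolding is_vcategory_def
proof (intro conjI ballI)
  fix n m X f assume X: "X \<in> Ob V" and "f \<in> hom V X (VHom T' n m)"
  then have f: "f \<in> Ar V" "Dom V f = X" "Cod V f = H n m" by auto
  show "vc V T' n n m f (vid V T' X n) = f"
    by (rule H_ext[where X = X]) (use f X in \<open>auto simp: vid_def\<close>)
  show "vc V T' n m m (vid V T' X m) f = f"
    by (rule H_ext[where X = X]) (use f X in \<open>auto simp: vid_def\<close>)
next
  fix a b c d X f g h
  assume "X \<in> Ob V" "f \<in> hom V X (VHom T' a b)" "g \<in> hom V X (VHom T' b c)" "h \<in> hom V X (VHom T' c d)"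
  then have *: "f \<in> Ar V" "Dom V f = X" "Cod V f = H a b" "g \<in> Ar V" "Dom V g = X" "Cod V g = H b c"
    "h \<in> Ar V" "Dom V h = X" "Cod V h = H c d" by auto
  show "vc V T' a b d (vc V T' b c d h g) f = vc V T' a c d h (vc V T' a b c g f)"
    by (rule H_ext[where X = X]) (use * in auto)
qed (use commutant_comp_simps(1) in auto)

lemma commutant_Pr [simp]:
  assumes "i < n"
  shows "Pr T' n i \<in> Ar V" "Dom V (Pr T' n i) = Tml V" "Cod V (Pr T' n i) = H n (Suc 0)"
    "pr n (Suc 0) k \<cdot> Pr T' n i = name V (nproj V (npow V K k) n i)"
    "e \<in> Ar V \<Longrightarrow> Cod V e = Tml V \<Longrightarrow>
      pr n (Suc 0) k \<cdot> Pr T' n i \<cdot> e = name V (nproj V (npow V K k) n i) \<cdot> e"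
proof -
  have "is_natural_family V T (P n) (P 1) (Tml V) (\<lambda>k. name V (nproj V (npow V K k) n i))"
  proof (rule natural_familyI)
    fix k q Y e t x
    assume *: "e \<in> hom V Y (Tml V)" "t \<in> hom V Y (VHom T k q)" "x \<in> hom V Y (FOb (P n) k)"
    then show "Ev V (FOb (P 1) k) (FOb (P 1) q) \<cdot> \<langle>FHom (P 1) k q \<cdot> t,
        Ev V (FOb (P n) k) (FOb (P 1) k) \<cdot> \<langle>name V (nproj V (npow V K k) n i) \<cdot> e, x\<rangle>\<rangle> =
      Ev V (FOb (P n) q) (FOb (P 1) q) \<cdot> \<langle>name V (nproj V (npow V K q) n i) \<cdot> e,
        Ev V (FOb (P n) k) (FOb (P n) q) \<cdot> \<langle>FHom (P n) k q \<cdot> t, x\<rangle>\<rangle>"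
      using power_alg_app[of T A t k q x n i] assms
        power_alg_app[of T A t k q "nproj V (npow V K k) n i \<cdot> x" 1 0] by simp
  qed (use assms in simp_all)
  from alg_in_props[OF H_is_alg_obj this]
  show *: "Pr T' n i \<in> Ar V" "Dom V (Pr T' n i) = Tml V" "Cod V (Pr T' n i) = H n (Suc 0)"
    "pr n (Suc 0) k \<cdot> Pr T' n i = name V (nproj V (npow V K k) n i)" for k
    by (simp_all add: commutant_def Let_def)
  assume "e \<in> Ar V" "Cod V e = Tml V"
  then show "pr n (Suc 0) k \<cdot> Pr T' n i \<cdot> e = name V (nproj V (npow V K k) n i) \<cdot> e"
    using *(4)[of k] comp_assoc'[of e "Pr T' n i" "pr n (Suc 0) k"] *(1-3) by simp
qed

text \<open>
  The chosen end \<open>H n m\<close> is the object of matrices only up to isomorphism. The entries of its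
  generalized elements are therefore read off through the projection \<open>pr n m 1\<close>.
\<close>

definition mat_of :: "'o \<Rightarrow> nat \<Rightarrow> nat \<Rightarrow> 'a \<Rightarrow> nat \<Rightarrow> nat \<Rightarrow> 'a" where
  "mat_of X n m u = family_matrix X m n (pr n m 1 \<cdot> u)"

lemma mat_of_is_mat: "u \<in> hom V X (H n m) \<Longrightarrow> is_mat X m n (mat_of X n m u)"
  unfolding mat_of_def by (rule family_matrix_is_mat) simp

lemma mat_of_ext:
  assumes u: "u \<in> hom V X (H n m)" and v: "v \<in> hom V X (H n m)"
    and eq: "\<And>i j. i < m \<Longrightarrow> j < n \<Longrightarrow> mat_of X n m u i j = mat_of X n m v i j"
  shows "u = v"
proof (rule is_alg_obj_ext[OF H_is_alg_obj _ _ u v])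
  show "pr n m k \<cdot> u = pr n m k \<cdot> v" for k
    using natural_family_eq_matrix_action[OF pr_restrict[OF u], of k]
      natural_family_eq_matrix_action[OF pr_restrict[OF v], of k]
      matrix_action_cong[OF eq mat_of_is_mat[OF u] mat_of_is_mat[OF v], of k]
    by (simp add: mat_of_def)
qed simp_all

lemma mat_of_surj:
  assumes a: "is_mat X m n a"
  shows "\<exists>u \<in> hom V X (H n m). \<forall>i<m. \<forall>j<n. mat_of X n m u i j = a i j"
proof -
  have X: "X \<in> Ob V" using a by (simp add: is_mat_def)
  from alg_in_props[OF H_is_alg_obj matrix_action_natural[OF a] X] obtain u
    where "u \<in> hom V X (H n m)" "\<And>k. pr n m k \<cdot> u = matrix_action X m n a k" by blast
  with family_matrix_matrix_action[OF a] show ?thesis unfolding mat_of_def by metis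
qed

lemma commutant_app:
  assumes u: "u \<in> hom V Y (H n m)" and x: "x \<in> hom V Y (npow V K n)" and i: "i < m"
  shows "nproj V K m i \<cdot> Ev V (npow V K n) (npow V K m) \<cdot> \<langle>pr n m 1 \<cdot> u, x\<rangle> =
    vsum_rig Y (\<lambda>j. mat_of Y n m u i j \<otimes> (nproj V K n j \<cdot> x)) n"
proof -
  have "Y \<in> Ob V" using u by auto
  then show ?thesis
    using natural_family_linear[OF pr_restrict[OF u] _ x i, of "Ide V Y"] u
    by (simp add: mat_of_def family_matrix_def)
qed

text \<open>
  Composing with the \<open>i\<close>-th projection extracts the \<open>i\<close>-th row of a matrix, and a matrix with \<open>n\<close> rows
  is the list of its rows.
\<close>

lemma commutant_theory: "is_theory V T'"
  unfolding is_theory_def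
proof (intro conjI allI commutant_vcategory)
  fix n
  show "is_conical_power V T' n n 1 (Pr T' n)"
    unfolding is_conical_power_def
  proof (intro conjI ballI allI impI)
    fix a X f assume X: "X \<in> Ob V" and f: "\<forall>i<n. f i \<in> hom V X (VHom T' a 1)"
    have mat_pr: "mat_of X a 1 (vc V T' a n 1 (Pr T' n i \<cdot> bang V X) h) 0 j = mat_of X a n h i j"
      if "h \<in> hom V X (H a n)" "i < n" "j < a" for h i j
      using that X by (simp add: mat_of_def family_matrix_def)
    have iff: "vc V T' a n 1 (Pr T' n i \<cdot> bang V X) h = f i \<longleftrightarrow>
        (\<forall>j<a. mat_of X a n h i j = mat_of X a 1 (f i) 0 j)" (is "?l = f i \<longleftrightarrow> ?r")
      if h: "h \<in> hom V X (H a n)" and i: "i < n" for h i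
    proof
      have l: "?l \<in> hom V X (H a 1)" "f i \<in> hom V X (H a 1)" using h i f X by auto
      show "?l = f i" if ?r
        by (rule mat_of_ext[OF l]) (use mat_pr[OF h i] that in simp)
    qed (use mat_pr[OF h i] in auto)
    have "is_mat X n a (\<lambda>i. mat_of X a 1 (f i) 0)"
      unfolding is_mat_def
    proof (intro conjI allI impI X)
      fix i j assume "i < n" "j < a"
      then have "is_mat X 1 a (mat_of X a 1 (f i))" using f by (intro mat_of_is_mat) auto
      with \<open>j < a\<close> show "mat_of X a 1 (f i) 0 j \<in> hom V X K" unfolding is_mat_def by blast
    qed
    from mat_of_surj[OF this] obtain h where h: "h \<in> hom V X (H a n)"
      "\<forall>i<n. \<forall>j<a. mat_of X a n h i j = mat_of X a 1 (f i) 0 j" by blast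
    show "\<exists>!h. h \<in> hom V X (VHom T' a n) \<and> (\<forall>i<n. vc V T' a n 1 (Pr T' n i \<cdot> bang V X) h = f i)"
    proof (rule ex1I[of _ h])
      show "h \<in> hom V X (VHom T' a n) \<and> (\<forall>i<n. vc V T' a n 1 (Pr T' n i \<cdot> bang V X) h = f i)"
        using h iff by (simp del: mem_hom)
      fix g assume g: "g \<in> hom V X (VHom T' a n) \<and> (\<forall>i<n. vc V T' a n 1 (Pr T' n i \<cdot> bang V X) g = f i)"
      then have gH: "g \<in> hom V X (H a n)" by simp
      then have "\<forall>i<n. \<forall>j<a. mat_of X a n g i j = mat_of X a 1 (f i) 0 j" using g iff by blast
      then show "g = h" using h by (intro mat_of_ext[OF gH h(1)]) simp
    qed
  qed auto
next
  show "Pr T' 1 0 = VId T' 1"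
    by (rule H_ext[where X = "Tml V"]) auto
qed simp

section \<open>Algebras over the commutant\<close>

text \<open>
  The condition for conical powers in \<open>V\<close> in the case of the terminal test object, for which the
  internal hom into \<open>B\<close> is \<open>B\<close> itself.
\<close>

definition is_element_power :: "nat \<Rightarrow> 'o \<Rightarrow> 'o \<Rightarrow> (nat \<Rightarrow> 'a) \<Rightarrow> bool" where
  "is_element_power n B C q \<longleftrightarrow> (\<forall>Z \<in> Ob V. \<forall>f. (\<forall>i<n. f i \<in> hom V Z C) \<longrightarrow>
    (\<exists>!h. h \<in> hom V Z B \<and> (\<forall>i<n. Ev V B C \<cdot> \<langle>q i \<cdot> bang V Z, h\<rangle> = f i)))"

text \<open>
  Elements of \<open>Exp V a B\<close> at stage \<open>X\<close> are elements of \<open>B\<close> at stage \<open>Prod V X a\<close>. This one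
  computation shows that the powers defined above are conical powers in \<open>V\<close>, and that they are
  preserved by cotensors.
\<close>

lemma element_power_exp:
  assumes pow: "is_element_power n B C q" and B: "B \<in> Ob V" and C: "C \<in> Ob V" and a: "a \<in> Ob V"
    and X: "X \<in> Ob V" and q: "\<And>i. i < n \<Longrightarrow> q i \<in> hom V (Tml V) (Exp V B C)"
    and f: "\<And>i. i < n \<Longrightarrow> f i \<in> hom V X (Exp V a C)"
  shows "\<exists>!h. h \<in> hom V X (Exp V a B) \<and> (\<forall>i<n. \<forall>Y e x. e \<in> hom V Y X \<longrightarrow> x \<in> hom V Y a \<longrightarrow>
    Ev V B C \<cdot> \<langle>q i \<cdot> bang V Y, Ev V a B \<cdot> \<langle>h \<cdot> e, x\<rangle>\<rangle> = Ev V a C \<cdot> \<langle>f i \<cdot> e, x\<rangle>)"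
proof -
  let ?Z = "Prod V X a"
  let ?f = "\<lambda>i. Ev V a C \<cdot> \<langle>f i \<cdot> Fst V X a, Snd V X a\<rangle>"
  have Z: "?Z \<in> Ob V" using X a by simp
  have ex: "\<exists>!h. h \<in> hom V ?Z B \<and> (\<forall>i<n. Ev V B C \<cdot> \<langle>q i \<cdot> bang V ?Z, h\<rangle> = ?f i)"
    by (rule pow[unfolded is_element_power_def, rule_format, OF Z]) (use f X a C in simp)
  then obtain h where h: "h \<in> hom V ?Z B" "\<And>i. i < n \<Longrightarrow> Ev V B C \<cdot> \<langle>q i \<cdot> bang V ?Z, h\<rangle> = ?f i"
    by blast
  show ?thesis
  proof (rule ex1I[of _ "curry V X a h"])
    show "curry V X a h \<in> hom V X (Exp V a B) \<and> (\<forall>i<n. \<forall>Y e x. e \<in> hom V Y X \<longrightarrow> x \<in> hom V Y a \<longrightarrow>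
      Ev V B C \<cdot> \<langle>q i \<cdot> bang V Y, Ev V a B \<cdot> \<langle>curry V X a h \<cdot> e, x\<rangle>\<rangle> = Ev V a C \<cdot> \<langle>f i \<cdot> e, x\<rangle>)"
    proof (intro conjI allI impI)
      show "curry V X a h \<in> hom V X (Exp V a B)" using h(1) X a by simp
      fix i Y e x assume i: "i < n" and e: "e \<in> hom V Y X" and x: "x \<in> hom V Y a"
      then have Y: "Y \<in> Ob V" by auto
      have "Ev V B C \<cdot> \<langle>q i \<cdot> bang V Y, Ev V a B \<cdot> \<langle>curry V X a h \<cdot> e, x\<rangle>\<rangle> =
          (Ev V B C \<cdot> \<langle>q i \<cdot> bang V ?Z, h\<rangle>) \<cdot> \<langle>e, x\<rangle>"
        using h(1) q[OF i] e x X a B C Y by simp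
      also have "\<dots> = Ev V a C \<cdot> \<langle>f i \<cdot> e, x\<rangle>"
        unfolding h(2)[OF i] using f[OF i] e x X a C Y by simp
      finally show "Ev V B C \<cdot> \<langle>q i \<cdot> bang V Y, Ev V a B \<cdot> \<langle>curry V X a h \<cdot> e, x\<rangle>\<rangle> =
        Ev V a C \<cdot> \<langle>f i \<cdot> e, x\<rangle>" .
    qed
  next
    fix g assume g: "g \<in> hom V X (Exp V a B) \<and> (\<forall>i<n. \<forall>Y e x. e \<in> hom V Y X \<longrightarrow> x \<in> hom V Y a \<longrightarrow>
      Ev V B C \<cdot> \<langle>q i \<cdot> bang V Y, Ev V a B \<cdot> \<langle>g \<cdot> e, x\<rangle>\<rangle> = Ev V a C \<cdot> \<langle>f i \<cdot> e, x\<rangle>)"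
    let ?g = "Ev V a B \<cdot> \<langle>g \<cdot> Fst V X a, Snd V X a\<rangle>"
    have gB: "?g \<in> hom V ?Z B" using g[THEN conjunct1] X a B by simp
    have FS: "Fst V X a \<in> hom V ?Z X" "Snd V X a \<in> hom V ?Z a" using X a by auto
    have "\<forall>i<n. Ev V B C \<cdot> \<langle>q i \<cdot> bang V ?Z, ?g\<rangle> = ?f i" using g FS by blast
    with gB ex h have "?g = h" by blast
    then show "g = curry V X a h"
      by (intro curry_eqI[OF _ h(1) X a]) (use g in auto)
  qed
qed

lemma element_power_imp_conical:
  assumes pow: "is_element_power n B C q" and B: "B \<in> Ob V" and C: "C \<in> Ob V"
    and q: "\<And>i. i < n \<Longrightarrow> q i \<in> hom V (Tml V) (Exp V B C)"
  shows "is_conical_power V (selfv V) n B C q"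
  unfolding is_conical_power_def
proof (intro conjI ballI allI impI)
  fix a X f assume a: "a \<in> VOb (selfv V)" and X: "X \<in> Ob V"
    and f: "\<forall>i<n. f i \<in> hom V X (VHom (selfv V) a C)"
  have a: "a \<in> Ob V" using a by simp
  have f: "f i \<in> hom V X (Exp V a C)" if "i < n" for i using f that by simp
  have iff: "vc V (selfv V) a B C (q i \<cdot> bang V X) h = f i \<longleftrightarrow>
      (\<forall>Y e x. e \<in> hom V Y X \<longrightarrow> x \<in> hom V Y a \<longrightarrow>
        Ev V B C \<cdot> \<langle>q i \<cdot> bang V Y, Ev V a B \<cdot> \<langle>h \<cdot> e, x\<rangle>\<rangle> = Ev V a C \<cdot> \<langle>f i \<cdot> e, x\<rangle>)" (is "?l = f i \<longleftrightarrow> ?r")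
    if h: "h \<in> hom V X (Exp V a B)" and i: "i < n" for h i
  proof -
    have beta: "Ev V a C \<cdot> \<langle>?l \<cdot> e, x\<rangle> = Ev V B C \<cdot> \<langle>q i \<cdot> bang V Y, Ev V a B \<cdot> \<langle>h \<cdot> e, x\<rangle>\<rangle>"
      if "e \<in> hom V Y X" "x \<in> hom V Y a" for Y e x
      using that h q[OF i] a B C X hom_Ob[OF that(1)] by simp
    show ?thesis
    proof
      assume r: ?r
      show "?l = f i"
      proof (rule exp_ext[where X = X])
        show "Ev V a C \<cdot> \<langle>?l \<cdot> e, x\<rangle> = Ev V a C \<cdot> \<langle>f i \<cdot> e, x\<rangle>" if "e \<in> hom V Y X" "x \<in> hom V Y a" for Y e x
          using beta[OF that] r that by metis
      qed (use h q[OF i] f[OF i] a B C X in auto)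
    qed (use beta in metis)
  qed
  show "\<exists>!h. h \<in> hom V X (VHom (selfv V) a B) \<and>
      (\<forall>i<n. vc V (selfv V) a B C (q i \<cdot> bang V X) h = f i)"
  proof -
    have "h \<in> hom V X (VHom (selfv V) a B) \<and> (\<forall>i<n. vc V (selfv V) a B C (q i \<cdot> bang V X) h = f i) \<longleftrightarrow>
      h \<in> hom V X (Exp V a B) \<and> (\<forall>i<n. \<forall>Y e x. e \<in> hom V Y X \<longrightarrow> x \<in> hom V Y a \<longrightarrow>
        Ev V B C \<cdot> \<langle>q i \<cdot> bang V Y, Ev V a B \<cdot> \<langle>h \<cdot> e, x\<rangle>\<rangle> = Ev V a C \<cdot> \<langle>f i \<cdot> e, x\<rangle>)" for h
      unfolding selfv_simps using iff by blast
    then show ?thesis using element_power_exp[OF pow B C a X q f] by presburger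
  qed
qed (use B C q in auto)

lemma commutant_alg_FOb [simp]: "FOb S' n = npow V K n"
  by (simp add: commutant_alg_def)

lemma commutant_alg_FHom: "FHom S' n m = pr n m 1"
  by (simp add: commutant_alg_def)

lemma prealgebra_commutant_alg [simp]: "prealgebra V T' S'"
  unfolding prealgebra_def by (simp add: commutant_alg_FHom)

text \<open>
  The algebra \<open>S'\<close> is represented by the object \<open>1\<close>, with universal element the unit of \<open>R\<close>:
  evaluation at the unit identifies matrices with one column and tuples of elements of \<open>R\<close>.
\<close>

definition column :: "'o \<Rightarrow> nat \<Rightarrow> 'a \<Rightarrow> 'a" where
  "column Z n u = Ev V K (npow V K n) \<cdot> \<langle>pr 1 n 1 \<cdot> u, one Z\<rangle>"

lemma column_in_hom: "u \<in> hom V Z (H 1 n) \<Longrightarrow> column Z n u \<in> hom V Z (npow V K n)"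
  unfolding column_def using hom_Ob[of u Z "H 1 n"] by simp

lemma nproj_column:
  assumes u: "u \<in> hom V Z (H 1 n)" and i: "i < n"
  shows "nproj V K n i \<cdot> column Z n u = mat_of Z 1 n u i 0"
proof -
  have Z: "Z \<in> Ob V" using u by auto
  have "unitvec Z 1 0 = one Z"
    using unitvec_simps(4)[OF Z, where n = 1 and j = 0 and p = 0] unitvec_simps(1-3)[OF Z, of 1 0] by simp
  then show ?thesis by (simp add: column_def mat_of_def family_matrix_def)
qed

lemma column_ext:
  assumes "u \<in> hom V Z (H 1 n)" "v \<in> hom V Z (H 1 n)" "column Z n u = column Z n v"
  shows "u = v"
  by (rule mat_of_ext[OF assms(1,2)]) (use nproj_column assms in \<open>metis less_one\<close>)

lemma column_surj:
  assumes f: "f \<in> hom V Z (npow V K n)"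
  shows "\<exists>u \<in> hom V Z (H 1 n). column Z n u = f"
proof -
  have Z: "Z \<in> Ob V" using f by auto
  have "is_mat Z n 1 (\<lambda>i j. nproj V K n i \<cdot> f)" using f Z by (simp add: is_mat_def)
  from mat_of_surj[OF this] obtain u where u: "u \<in> hom V Z (H 1 n)"
    "\<forall>i<n. mat_of Z 1 n u i 0 = nproj V K n i \<cdot> f" by auto
  have "column Z n u = f"
    by (rule npow_ext[OF column_in_hom[OF u(1)] f]) (use nproj_column[OF u(1)] u(2) in auto)
  with u show ?thesis by blast
qed

lemma column_comp:
  assumes "q \<in> hom V (Tml V) (H p c)" "u \<in> hom V Z (H 1 p)"
  shows "column Z c (vc V T' 1 p c (q \<cdot> bang V Z) u) =
    Ev V (npow V K p) (npow V K c) \<cdot> \<langle>(pr p c 1 \<cdot> q) \<cdot> bang V Z, column Z p u\<rangle>"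
  using assms hom_Ob[of u Z "H 1 p"] by (simp add: column_def)

text \<open>
  The universal property of a conical power is a statement about maps out of an arbitrary object, here
  out of \<open>1\<close>; it is carried over to \<open>S'\<close> along \<open>column\<close>.
\<close>

lemma commutant_alg_element_power:
  assumes "is_conical_power V T' n p c q"
  shows "is_element_power n (FOb S' p) (FOb S' c) (\<lambda>i. FHom S' p c \<cdot> q i)"
  unfolding is_element_power_def commutant_alg_FOb commutant_alg_FHom
proof (intro ballI allI impI)
  fix Z f assume Z: "Z \<in> Ob V" and f: "\<forall>i<n. f i \<in> hom V Z (npow V K c)"
  have q: "q i \<in> hom V (Tml V) (H p c)" if "i < n" for i
    using assms that unfolding is_conical_power_def by simp
  from f column_surj have "\<forall>i<n. \<exists>u. u \<in> hom V Z (H 1 c) \<and> column Z c u = f i" by metis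
  then obtain u where u: "\<And>i. i < n \<Longrightarrow> u i \<in> hom V Z (H 1 c)" "\<And>i. i < n \<Longrightarrow> column Z c (u i) = f i"
    by metis
  then have "\<exists>!w. w \<in> hom V Z (H 1 p) \<and> (\<forall>i<n. vc V T' 1 p c (q i \<cdot> bang V Z) w = u i)"
    using assms Z unfolding is_conical_power_def by (simp del: mem_hom)
  then obtain w where w: "w \<in> hom V Z (H 1 p)" "\<And>i. i < n \<Longrightarrow> vc V T' 1 p c (q i \<cdot> bang V Z) w = u i"
    and uniq: "\<And>w'. w' \<in> hom V Z (H 1 p) \<Longrightarrow> (\<And>i. i < n \<Longrightarrow> vc V T' 1 p c (q i \<cdot> bang V Z) w' = u i) \<Longrightarrow> w' = w"
    by metis
  show "\<exists>!h. h \<in> hom V Z (npow V K p) \<and>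
    (\<forall>i<n. Ev V (npow V K p) (npow V K c) \<cdot> \<langle>(pr p c 1 \<cdot> q i) \<cdot> bang V Z, h\<rangle> = f i)"
  proof (rule ex1I[of _ "column Z p w"])
    show "column Z p w \<in> hom V Z (npow V K p) \<and>
      (\<forall>i<n. Ev V (npow V K p) (npow V K c) \<cdot> \<langle>(pr p c 1 \<cdot> q i) \<cdot> bang V Z, column Z p w\<rangle> = f i)"
      using column_in_hom[OF w(1)] column_comp[OF q w(1)] w(2) u(2) by (simp del: mem_hom comp_assoc')
    fix h assume h: "h \<in> hom V Z (npow V K p) \<and>
      (\<forall>i<n. Ev V (npow V K p) (npow V K c) \<cdot> \<langle>(pr p c 1 \<cdot> q i) \<cdot> bang V Z, h\<rangle> = f i)"
    then obtain w' where w': "w' \<in> hom V Z (H 1 p)" "column Z p w' = h" using column_surj by blast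
    have "w' = w"
    proof (rule uniq[OF w'(1)])
      fix i assume i: "i < n"
      show "vc V T' 1 p c (q i \<cdot> bang V Z) w' = u i"
      proof (rule column_ext[OF _ u(1)[OF i]])
        show "vc V T' 1 p c (q i \<cdot> bang V Z) w' \<in> hom V Z (H 1 c)" using q[OF i] w'(1) Z by simp
        show "column Z c (vc V T' 1 p c (q i \<cdot> bang V Z) w') = column Z c (u i)"
          using column_comp[OF q[OF i] w'(1)] w'(2) h i u(2)[OF i] by metis
      qed
    qed
    with w' show "h = column Z p w" by simp
  qed
qed

lemma commutant_alg_is_algebra: "is_algebra V T' S'"
  unfolding is_algebra_def
proof (intro conjI allI impI commutant_theory)
  show "is_vfunctor V T' (selfv V) S'"
    unfolding is_vfunctor_def by (simp add: commutant_alg_FHom)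
  fix n p c q assume *: "is_conical_power V T' n p c q"
  then have "q i \<in> hom V (Tml V) (H p c)" if "i < n" for i
    using that unfolding is_conical_power_def by simp
  then show "is_conical_power V (selfv V) n (FOb S' p) (FOb S' c) (\<lambda>i. FHom S' p c \<cdot> q i)"
    by (intro element_power_imp_conical commutant_alg_element_power[OF *])
      (auto simp: commutant_alg_FHom)
qed

lemma vfunctor_cotensor:
  assumes F: "is_vfunctor V T' (selfv V) B" and B: "prealgebra V T' B" and X: "X \<in> Ob V"
  shows "is_vfunctor V T' (selfv V) (cotensor_alg V T' X B)"
proof -
  let ?C = "cotensor_alg V T' X B"
  note [simp] = prealgebra_simps(2-)[OF B] X
  have C [simp]: "FHom ?C k l \<in> Ar V" "Dom V (FHom ?C k l) = H k l"
    "Cod V (FHom ?C k l) = Exp V (Exp V X (FOb B k)) (Exp V X (FOb B l))" for k l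
    using prealgebra_simps[OF prealgebra_cotensor[OF B X]] by auto
  show ?thesis
    unfolding is_vfunctor_def
  proof (intro conjI ballI)
    fix n
    have id: "FHom B n n \<cdot> VId T' n \<cdot> e = name V (Ide V (FOb B n)) \<cdot> e" if "e \<in> Ar V" "Cod V e = Tml V" for e
      using F that comp_assoc'[of e "VId T' n" "FHom B n n"] by (simp add: is_vfunctor_def)
    show "FHom ?C n n \<cdot> VId T' n = VId (selfv V) (FOb ?C n)"
    proof (rule exp_ext[where X = "Tml V" and A = "Exp V X (FOb B n)" and B = "Exp V X (FOb B n)"])
      fix Y e g assume e: "e \<in> hom V Y (Tml V)" and g: "g \<in> hom V Y (Exp V X (FOb B n))"
      show "Ev V (Exp V X (FOb B n)) (Exp V X (FOb B n)) \<cdot> \<langle>(FHom ?C n n \<cdot> VId T' n) \<cdot> e, g\<rangle> =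
        Ev V (Exp V X (FOb B n)) (Exp V X (FOb B n)) \<cdot> \<langle>VId (selfv V) (FOb ?C n) \<cdot> e, g\<rangle>"
      proof (rule exp_ext[where X = Y and A = X and B = "FOb B n"])
        fix Z d x assume "d \<in> hom V Z Y" "x \<in> hom V Z X"
        then show "Ev V X (FOb B n) \<cdot> \<langle>(Ev V (Exp V X (FOb B n)) (Exp V X (FOb B n)) \<cdot>
            \<langle>(FHom ?C n n \<cdot> VId T' n) \<cdot> e, g\<rangle>) \<cdot> d, x\<rangle> =
          Ev V X (FOb B n) \<cdot> \<langle>(Ev V (Exp V X (FOb B n)) (Exp V X (FOb B n)) \<cdot>
            \<langle>VId (selfv V) (FOb ?C n) \<cdot> e, g\<rangle>) \<cdot> d, x\<rangle>"
          using e g cotensor_alg_app[OF B X, of "VId T' n \<cdot> e \<cdot> d" n n "g \<cdot> d" x] by (simp add: id)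
      qed (use e g in auto)
    qed auto
  next
    fix a b c Y f g assume "f \<in> hom V Y (VHom T' a b)" "g \<in> hom V Y (VHom T' b c)"
    then have f: "f \<in> hom V Y (H a b)" and g: "g \<in> hom V Y (H b c)" by simp_all
    show "FHom ?C a c \<cdot> vc V T' a b c g f =
      vc V (selfv V) (FOb ?C a) (FOb ?C b) (FOb ?C c) (FHom ?C b c \<cdot> g) (FHom ?C a b \<cdot> f)"
    proof (rule exp_ext[where X = Y and A = "Exp V X (FOb B a)" and B = "Exp V X (FOb B c)"])
      fix Z e y assume e: "e \<in> hom V Z Y" and y: "y \<in> hom V Z (Exp V X (FOb B a))"
      show "Ev V (Exp V X (FOb B a)) (Exp V X (FOb B c)) \<cdot> \<langle>(FHom ?C a c \<cdot> vc V T' a b c g f) \<cdot> e, y\<rangle> =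
        Ev V (Exp V X (FOb B a)) (Exp V X (FOb B c)) \<cdot> \<langle>vc V (selfv V) (FOb ?C a) (FOb ?C b) (FOb ?C c)
          (FHom ?C b c \<cdot> g) (FHom ?C a b \<cdot> f) \<cdot> e, y\<rangle>"
      proof (rule exp_ext[where X = Z and A = X and B = "FOb B c"])
        fix W d x assume d: "d \<in> hom V W Z" and x: "x \<in> hom V W X"
        have "FHom B a c \<cdot> vc V T' a b c g f =
            vc V (selfv V) (FOb B a) (FOb B b) (FOb B c) (FHom B b c \<cdot> g) (FHom B a b \<cdot> f)"
          using F f g hom_Ob[OF f] unfolding is_vfunctor_def commutant_simps by blast
        then have "(FHom B a c \<cdot> vc V T' a b c g f) \<cdot> e \<cdot> d =
            vc V (selfv V) (FOb B a) (FOb B b) (FOb B c) (FHom B b c \<cdot> g) (FHom B a b \<cdot> f) \<cdot> e \<cdot> d"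
          by simp
        then have *: "FHom B a c \<cdot> vc V T' a b c g f \<cdot> e \<cdot> d = vc V (selfv V) (FOb B a) (FOb B b) (FOb B c)
            (FHom B b c \<cdot> g \<cdot> e \<cdot> d) (FHom B a b \<cdot> f \<cdot> e \<cdot> d)"
          using f g d e by simp
        show "Ev V X (FOb B c) \<cdot> \<langle>(Ev V (Exp V X (FOb B a)) (Exp V X (FOb B c)) \<cdot>
              \<langle>(FHom ?C a c \<cdot> vc V T' a b c g f) \<cdot> e, y\<rangle>) \<cdot> d, x\<rangle> =
          Ev V X (FOb B c) \<cdot> \<langle>(Ev V (Exp V X (FOb B a)) (Exp V X (FOb B c)) \<cdot>
              \<langle>vc V (selfv V) (FOb ?C a) (FOb ?C b) (FOb ?C c) (FHom ?C b c \<cdot> g) (FHom ?C a b \<cdot> f) \<cdot> e, y\<rangle>) \<cdot> d, x\<rangle>"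
          using f g e d x y *
            cotensor_alg_app[OF B X, of "vc V T' a b c g f \<cdot> e \<cdot> d" a c "y \<cdot> d" x]
            cotensor_alg_app[OF B X, of "f \<cdot> e \<cdot> d" a b "y \<cdot> d" x]
            cotensor_alg_app[OF B X, of "g \<cdot> e \<cdot> d" b c
              "Ev V (Exp V X (FOb B a)) (Exp V X (FOb B b)) \<cdot> \<langle>FHom ?C a b \<cdot> f \<cdot> e \<cdot> d, y \<cdot> d\<rangle>" x]
          by simp
      qed (use f g e y in auto)
    qed (use f g in auto)
  qed auto
qed

lemma cotensor_element_power:
  assumes B: "prealgebra V T' B" and X: "X \<in> Ob V" and q: "\<And>i. i < n \<Longrightarrow> q i \<in> hom V (Tml V) (H p c)"
    and pow: "is_element_power n (FOb B p) (FOb B c) (\<lambda>i. FHom B p c \<cdot> q i)"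
  shows "is_element_power n (FOb (cotensor_alg V T' X B) p) (FOb (cotensor_alg V T' X B) c)
    (\<lambda>i. FHom (cotensor_alg V T' X B) p c \<cdot> q i)"
  unfolding is_element_power_def
proof (intro ballI allI impI)
  let ?C = "cotensor_alg V T' X B"
  note [simp] = prealgebra_simps(2-)[OF B] X
  have C [simp]: "FHom ?C k l \<in> Ar V" "Dom V (FHom ?C k l) = H k l"
    "Cod V (FHom ?C k l) = Exp V (Exp V X (FOb B k)) (Exp V X (FOb B l))" for k l
    using prealgebra_simps[OF prealgebra_cotensor[OF B X]] by auto
  fix Z f assume Z: "Z \<in> Ob V" and f: "\<forall>i<n. f i \<in> hom V Z (FOb ?C c)"
  have f: "f i \<in> hom V Z (Exp V X (FOb B c))" if "i < n" for i using f that by simp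
  have iff: "Ev V (FOb ?C p) (FOb ?C c) \<cdot> \<langle>(FHom ?C p c \<cdot> q i) \<cdot> bang V Z, h\<rangle> = f i \<longleftrightarrow>
      (\<forall>Y e x. e \<in> hom V Y Z \<longrightarrow> x \<in> hom V Y X \<longrightarrow>
        Ev V (FOb B p) (FOb B c) \<cdot> \<langle>(FHom B p c \<cdot> q i) \<cdot> bang V Y, Ev V X (FOb B p) \<cdot> \<langle>h \<cdot> e, x\<rangle>\<rangle> =
        Ev V X (FOb B c) \<cdot> \<langle>f i \<cdot> e, x\<rangle>)" (is "?l = f i \<longleftrightarrow> ?r")
    if h: "h \<in> hom V Z (Exp V X (FOb B p))" and i: "i < n" for h i
  proof -
    have beta: "Ev V X (FOb B c) \<cdot> \<langle>?l \<cdot> e, x\<rangle> =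
        Ev V (FOb B p) (FOb B c) \<cdot> \<langle>(FHom B p c \<cdot> q i) \<cdot> bang V Y, Ev V X (FOb B p) \<cdot> \<langle>h \<cdot> e, x\<rangle>\<rangle>"
      if "e \<in> hom V Y Z" "x \<in> hom V Y X" for Y e x
      using that h q[OF i] Z hom_Ob[OF that(1)]
        cotensor_alg_app[OF B X, of "q i \<cdot> bang V Y" p c "h \<cdot> e" x] by simp
    show ?thesis
    proof
      assume r: ?r
      show "?l = f i"
      proof (rule exp_ext[where X = Z and A = X and B = "FOb B c"])
        show "Ev V X (FOb B c) \<cdot> \<langle>?l \<cdot> e, x\<rangle> = Ev V X (FOb B c) \<cdot> \<langle>f i \<cdot> e, x\<rangle>"
          if "e \<in> hom V Y Z" "x \<in> hom V Y X" for Y e x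
          using beta[OF that] r that by metis
      qed (use h q[OF i] f[OF i] Z in auto)
    qed (use beta in metis)
  qed
  have q': "FHom B p c \<cdot> q i \<in> hom V (Tml V) (Exp V (FOb B p) (FOb B c))" if "i < n" for i
    using q[OF that] by simp
  show "\<exists>!h. h \<in> hom V Z (FOb ?C p) \<and>
      (\<forall>i<n. Ev V (FOb ?C p) (FOb ?C c) \<cdot> \<langle>(FHom ?C p c \<cdot> q i) \<cdot> bang V Z, h\<rangle> = f i)"
  proof -
    have "h \<in> hom V Z (FOb ?C p) \<and>
        (\<forall>i<n. Ev V (FOb ?C p) (FOb ?C c) \<cdot> \<langle>(FHom ?C p c \<cdot> q i) \<cdot> bang V Z, h\<rangle> = f i) \<longleftrightarrow>
      h \<in> hom V Z (Exp V X (FOb B p)) \<and> (\<forall>i<n. \<forall>Y e x. e \<in> hom V Y Z \<longrightarrow> x \<in> hom V Y X \<longrightarrow>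
        Ev V (FOb B p) (FOb B c) \<cdot> \<langle>(FHom B p c \<cdot> q i) \<cdot> bang V Y, Ev V X (FOb B p) \<cdot> \<langle>h \<cdot> e, x\<rangle>\<rangle> =
        Ev V X (FOb B c) \<cdot> \<langle>f i \<cdot> e, x\<rangle>)" for h
      using iff[of h] unfolding cotensor_alg_FOb by blast
    moreover have "FOb B p \<in> Ob V" "FOb B c \<in> Ob V" by simp_all
    ultimately show ?thesis using element_power_exp[OF pow _ _ X Z q' f] by presburger
  qed
qed

lemma cotensor_is_algebra:
  assumes X: "X \<in> Ob V"
  shows "is_algebra V T' (cotensor_alg V T' X S')"
  unfolding is_algebra_def
proof (intro conjI allI impI commutant_theory)
  let ?C = "cotensor_alg V T' X S'"
  show "is_vfunctor V T' (selfv V) ?C"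
    using commutant_alg_is_algebra by (intro vfunctor_cotensor X) (auto simp: is_algebra_def)
  fix n p c q assume *: "is_conical_power V T' n p c q"
  then have q: "q i \<in> hom V (Tml V) (H p c)" if "i < n" for i
    using that unfolding is_conical_power_def by simp
  have "FHom ?C p c \<in> hom V (H p c) (Exp V (FOb ?C p) (FOb ?C c))"
    using prealgebra_simps[OF prealgebra_cotensor[OF prealgebra_commutant_alg X]] by simp
  then show "is_conical_power V (selfv V) n (FOb ?C p) (FOb ?C c) (\<lambda>i. FHom ?C p c \<cdot> q i)"
    by (intro element_power_imp_conical cotensor_element_power[OF _ X q]
          commutant_alg_element_power[OF *]) (use q X in auto)
qed

end


section \<open>Linear functionals and natural families\<close>

locale comm_rig_cotensor = comm_rig V R for V :: "('o, 'a) ccc" (structure) and R :: "('o, 'a) rig" +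
  fixes X :: 'o
  assumes X [simp]: "X \<in> Ob V"
begin

abbreviation "M \<equiv> cotensor_module V R X S"
abbreviation "E \<equiv> Exp V X K"
abbreviation "XS \<equiv> cotensor_alg V T' X S'"

lemma M_simps [simp]:
  "Car M = E" "Add M \<in> Ar V" "Dom V (Add M) = Prod V E E" "Cod V (Add M) = E"
  "Zero M \<in> Ar V" "Dom V (Zero M) = Tml V" "Cod V (Zero M) = E"
  "Act M \<in> Ar V" "Dom V (Act M) = Prod V K E" "Cod V (Act M) = E"
  by (simp_all add: cotensor_module_def Let_def)

lemma M_Add_app [simp]:
  assumes "g \<in> Ar V" "Cod V g = E" "h \<in> Ar V" "Cod V h = E" "Dom V h = Dom V g"
    "x \<in> Ar V" "Cod V x = X" "Dom V x = Dom V g"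
  shows "Ev V X K \<cdot> \<langle>Add M \<cdot> \<langle>g, h\<rangle>, x\<rangle> = (Ev V X K \<cdot> \<langle>g, x\<rangle>) \<oplus> (Ev V X K \<cdot> \<langle>h, x\<rangle>)"
  using assms by (simp add: cotensor_module_def Let_def)

lemma M_Zero_app [simp]:
  assumes "e \<in> Ar V" "Cod V e = Tml V" "x \<in> Ar V" "Cod V x = X" "Dom V x = Dom V e"
  shows "Ev V X K \<cdot> \<langle>Zero M \<cdot> e, x\<rangle> = Zero R \<cdot> e"
  using assms by (simp add: cotensor_module_def Let_def)

lemma M_Act_app [simp]:
  assumes "r \<in> Ar V" "Cod V r = K" "h \<in> Ar V" "Cod V h = E" "Dom V h = Dom V r"
    "x \<in> Ar V" "Cod V x = X" "Dom V x = Dom V r"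
  shows "Ev V X K \<cdot> \<langle>Act M \<cdot> \<langle>r, h\<rangle>, x\<rangle> = r \<otimes> (Ev V X K \<cdot> \<langle>h, x\<rangle>)"
  using assms by (simp add: cotensor_module_def Let_def)

lemma E_ext:
  assumes "g \<in> hom V Y E" "h \<in> hom V Y E"
    "\<And>Z e x. Z \<in> Ob V \<Longrightarrow> e \<in> hom V Z Y \<Longrightarrow> x \<in> hom V Z X \<Longrightarrow>
      Ev V X K \<cdot> \<langle>g \<cdot> e, x\<rangle> = Ev V X K \<cdot> \<langle>h \<cdot> e, x\<rangle>"
  shows "g = h"
  by (rule exp_ext[OF assms(1,2) X _ assms(3)]) auto

lemma is_cmonoid_M [simp]: "is_cmonoid V M"
  unfolding is_cmonoid_def Let_def
proof (intro conjI ballI)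
  fix Y x y z assume "Y \<in> Ob V" "x \<in> hom V Y (Car M)" "y \<in> hom V Y (Car M)" "z \<in> hom V Y (Car M)"
  then have *: "x \<in> Ar V" "Dom V x = Y" "Cod V x = E" "y \<in> Ar V" "Dom V y = Y" "Cod V y = E"
    "z \<in> Ar V" "Dom V z = Y" "Cod V z = E" "Y \<in> Ob V" by auto
  show "Add M \<cdot> \<langle>Add M \<cdot> \<langle>x, y\<rangle>, z\<rangle> = Add M \<cdot> \<langle>x, Add M \<cdot> \<langle>y, z\<rangle>\<rangle>"
    by (rule E_ext[where Y = Y]) (use * in \<open>auto simp: add_assoc\<close>)
  show "Add M \<cdot> \<langle>x, y\<rangle> = Add M \<cdot> \<langle>y, x\<rangle>"
  proof (rule E_ext[where Y = Y])
    fix Z e u assume "e \<in> hom V Z Y" "u \<in> hom V Z X"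
    then show "Ev V X K \<cdot> \<langle>(Add M \<cdot> \<langle>x, y\<rangle>) \<cdot> e, u\<rangle> = Ev V X K \<cdot> \<langle>(Add M \<cdot> \<langle>y, x\<rangle>) \<cdot> e, u\<rangle>"
      using * add_commute[of "Ev V X K \<cdot> \<langle>x \<cdot> e, u\<rangle>" Z "Ev V X K \<cdot> \<langle>y \<cdot> e, u\<rangle>"] by simp
  qed (use * in auto)
  show "Add M \<cdot> \<langle>Zero M \<cdot> bang V Y, x\<rangle> = x"
    by (rule E_ext[where Y = Y]) (use * in auto)
qed auto

lemma is_rmodule_M: "is_rmodule V R M"
  unfolding is_rmodule_def Let_def
proof (intro conjI ballI is_rig is_cmonoid_M)
  fix Y r s x y assume "Y \<in> Ob V" "r \<in> hom V Y K" "s \<in> hom V Y K" "x \<in> hom V Y (Car M)" "y \<in> hom V Y (Car M)"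
  then have *: "x \<in> Ar V" "Dom V x = Y" "Cod V x = E" "y \<in> Ar V" "Dom V y = Y" "Cod V y = E"
    "r \<in> Ar V" "Dom V r = Y" "Cod V r = K" "s \<in> Ar V" "Dom V s = Y" "Cod V s = K" "Y \<in> Ob V" by auto
  show "Act M \<cdot> \<langle>r \<otimes> s, x\<rangle> = Act M \<cdot> \<langle>r, Act M \<cdot> \<langle>s, x\<rangle>\<rangle>"
    by (rule E_ext[where Y = Y]) (use * in \<open>auto simp: mul_assoc\<close>)
  show "Act M \<cdot> \<langle>one Y, x\<rangle> = x"
    by (rule E_ext[where Y = Y]) (use * in auto)
  show "Act M \<cdot> \<langle>r \<oplus> s, x\<rangle> = Add M \<cdot> \<langle>Act M \<cdot> \<langle>r, x\<rangle>, Act M \<cdot> \<langle>s, x\<rangle>\<rangle>"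
    by (rule E_ext[where Y = Y]) (use * in \<open>auto simp: add_mul\<close>)
  show "Act M \<cdot> \<langle>r, Add M \<cdot> \<langle>x, y\<rangle>\<rangle> = Add M \<cdot> \<langle>Act M \<cdot> \<langle>r, x\<rangle>, Act M \<cdot> \<langle>r, y\<rangle>\<rangle>"
    by (rule E_ext[where Y = Y]) (use * in \<open>auto simp: mul_add\<close>)
  show "Act M \<cdot> \<langle>zero Y, x\<rangle> = Zero M \<cdot> bang V Y"
    by (rule E_ext[where Y = Y]) (use * in auto)
  show "Act M \<cdot> \<langle>r, Zero M \<cdot> bang V Y\<rangle> = Zero M \<cdot> bang V Y"
    by (rule E_ext[where Y = Y]) (use * in auto)
qed auto

lemma is_rmodule_S: "is_rmodule V R S"
  unfolding is_rmodule_def Let_def rig_module_simps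
proof (intro conjI ballI is_rig is_cmonoid_rig_module)
  fix Y r s x y assume *: "Y \<in> Ob V" "r \<in> hom V Y K" "s \<in> hom V Y K" "x \<in> hom V Y K" "y \<in> hom V Y K"
  show "(r \<otimes> s) \<otimes> x = r \<otimes> (s \<otimes> x)" "(r \<oplus> s) \<otimes> x = (r \<otimes> x) \<oplus> (s \<otimes> x)"
    "r \<otimes> (x \<oplus> y) = (r \<otimes> x) \<oplus> (r \<otimes> y)"
    by (rule mul_assoc add_mul mul_add; fact)+
qed auto

text \<open>
  Since \<open>l\<close> is only defined at stage \<open>Y\<close>, its linearity has to be tested on the arguments at all
  later stages \<open>e : Z \<rightarrow> Y\<close>.
\<close>

definition is_linear_element :: "'o \<Rightarrow> 'a \<Rightarrow> bool" where
  "is_linear_element Y l \<longleftrightarrow> l \<in> hom V Y (Exp V E K) \<and> (\<forall>Z. \<forall>e \<in> hom V Z Y.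
    (\<forall>g \<in> hom V Z E. \<forall>h \<in> hom V Z E. Ev V E K \<cdot> \<langle>l \<cdot> e, Add M \<cdot> \<langle>g, h\<rangle>\<rangle> =
      (Ev V E K \<cdot> \<langle>l \<cdot> e, g\<rangle>) \<oplus> (Ev V E K \<cdot> \<langle>l \<cdot> e, h\<rangle>)) \<and>
    Ev V E K \<cdot> \<langle>l \<cdot> e, Zero M \<cdot> bang V Z\<rangle> = zero Z \<and>
    (\<forall>r \<in> hom V Z K. \<forall>g \<in> hom V Z E. Ev V E K \<cdot> \<langle>l \<cdot> e, Act M \<cdot> \<langle>r, g\<rangle>\<rangle> =
      r \<otimes> (Ev V E K \<cdot> \<langle>l \<cdot> e, g\<rangle>)))"

text \<open>
  The equations for addition and for the action are between curried morphisms. Evaluated at a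
  generalized element of the product, i.e. at a pair, they become the conditions for elements.
\<close>

lemma linearity_pairs_iff:
  assumes l: "l \<in> hom V Y (Exp V E K)"
  shows "(\<forall>(f, g) \<in> linearity_pairs V R M S. f \<cdot> l = g \<cdot> l) \<longleftrightarrow> is_linear_element Y l"
proof -
  let ?W = "Exp V E K"
  have W: "?W \<in> Ob V" by simp
  have Y: "Y \<in> Ob V" using l by auto
  let ?a = "Ev V E K \<cdot> \<langle>Fst V ?W (Prod V E E), Add M \<cdot> Snd V ?W (Prod V E E)\<rangle>"
  let ?b = "(Ev V E K \<cdot> \<langle>Fst V ?W (Prod V E E), Fst V E E \<cdot> Snd V ?W (Prod V E E)\<rangle>) \<oplus>
    (Ev V E K \<cdot> \<langle>Fst V ?W (Prod V E E), Snd V E E \<cdot> Snd V ?W (Prod V E E)\<rangle>)"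
  let ?c = "Ev V E K \<cdot> \<langle>Fst V ?W (Prod V K E), Act M \<cdot> Snd V ?W (Prod V K E)\<rangle>"
  let ?d = "(Fst V K E \<cdot> Snd V ?W (Prod V K E)) \<otimes>
    (Ev V E K \<cdot> \<langle>Fst V ?W (Prod V K E), Snd V K E \<cdot> Snd V ?W (Prod V K E)\<rangle>)"
  have add: "curry V ?W (Prod V E E) ?a \<cdot> l = curry V ?W (Prod V E E) ?b \<cdot> l \<longleftrightarrow>
    (\<forall>Z. \<forall>e \<in> hom V Z Y. \<forall>g \<in> hom V Z E. \<forall>h \<in> hom V Z E. Ev V E K \<cdot> \<langle>l \<cdot> e, Add M \<cdot> \<langle>g, h\<rangle>\<rangle> =
      (Ev V E K \<cdot> \<langle>l \<cdot> e, g\<rangle>) \<oplus> (Ev V E K \<cdot> \<langle>l \<cdot> e, h\<rangle>))"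
  proof -
    have "curry V ?W (Prod V E E) ?a \<cdot> l = curry V ?W (Prod V E E) ?b \<cdot> l \<longleftrightarrow>
      (\<forall>Z. \<forall>e \<in> hom V Z Y. \<forall>g \<in> hom V Z E. \<forall>h \<in> hom V Z E.
        ?a \<cdot> \<langle>l \<cdot> e, \<langle>g, h\<rangle>\<rangle> = ?b \<cdot> \<langle>l \<cdot> e, \<langle>g, h\<rangle>\<rangle>)"
      by (subst curry_eq_iff[where Y = Y and B = K]) (use l in \<open>simp_all add: elements_of_prod del: mem_hom\<close>, simp_all)
    also have "\<dots> \<longleftrightarrow> (\<forall>Z. \<forall>e \<in> hom V Z Y. \<forall>g \<in> hom V Z E. \<forall>h \<in> hom V Z E.
      Ev V E K \<cdot> \<langle>l \<cdot> e, Add M \<cdot> \<langle>g, h\<rangle>\<rangle> = (Ev V E K \<cdot> \<langle>l \<cdot> e, g\<rangle>) \<oplus> (Ev V E K \<cdot> \<langle>l \<cdot> e, h\<rangle>))"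
      by (intro all_cong1 ball_cong refl) (use l in simp)
    finally show ?thesis .
  qed
  have act: "curry V ?W (Prod V K E) ?c \<cdot> l = curry V ?W (Prod V K E) ?d \<cdot> l \<longleftrightarrow>
    (\<forall>Z. \<forall>e \<in> hom V Z Y. \<forall>r \<in> hom V Z K. \<forall>g \<in> hom V Z E. Ev V E K \<cdot> \<langle>l \<cdot> e, Act M \<cdot> \<langle>r, g\<rangle>\<rangle> =
      r \<otimes> (Ev V E K \<cdot> \<langle>l \<cdot> e, g\<rangle>))"
  proof -
    have "curry V ?W (Prod V K E) ?c \<cdot> l = curry V ?W (Prod V K E) ?d \<cdot> l \<longleftrightarrow>
      (\<forall>Z. \<forall>e \<in> hom V Z Y. \<forall>r \<in> hom V Z K. \<forall>g \<in> hom V Z E.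
        ?c \<cdot> \<langle>l \<cdot> e, \<langle>r, g\<rangle>\<rangle> = ?d \<cdot> \<langle>l \<cdot> e, \<langle>r, g\<rangle>\<rangle>)"
      by (subst curry_eq_iff[where Y = Y and B = K]) (use l in \<open>simp_all add: elements_of_prod del: mem_hom\<close>, simp_all)
    also have "\<dots> \<longleftrightarrow> (\<forall>Z. \<forall>e \<in> hom V Z Y. \<forall>r \<in> hom V Z K. \<forall>g \<in> hom V Z E.
      Ev V E K \<cdot> \<langle>l \<cdot> e, Act M \<cdot> \<langle>r, g\<rangle>\<rangle> = r \<otimes> (Ev V E K \<cdot> \<langle>l \<cdot> e, g\<rangle>))"
      by (intro all_cong1 ball_cong refl) (use l in simp)
    finally show ?thesis .
  qed
  have zero: "(Ev V E K \<cdot> \<langle>Ide V ?W, Zero M \<cdot> bang V ?W\<rangle>) \<cdot> l = (Zero R \<cdot> bang V ?W) \<cdot> l \<longleftrightarrow>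
    (\<forall>Z. \<forall>e \<in> hom V Z Y. Ev V E K \<cdot> \<langle>l \<cdot> e, Zero M \<cdot> bang V Z\<rangle> = zero Z)" (is "?x = ?y \<longleftrightarrow> ?z")
  proof -
    have *: "?x \<cdot> e = Ev V E K \<cdot> \<langle>l \<cdot> e, Zero M \<cdot> bang V Z\<rangle>" "?y \<cdot> e = zero Z"
      if "e \<in> hom V Z Y" for e Z using that l by auto
    have xy: "?x \<in> hom V Y K" "?y \<in> hom V Y K" using l Y by auto
    show ?thesis
    proof
      assume ?z
      then have "?x \<cdot> Ide V Y = ?y \<cdot> Ide V Y" using *[of "Ide V Y" Y] Y by (metis ide_in_hom)
      then show "?x = ?y" using xy by simp
    qed (use * in metis)
  qed
  have "(\<forall>(f, g) \<in> linearity_pairs V R M S. f \<cdot> l = g \<cdot> l) \<longleftrightarrow>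
    curry V ?W (Prod V E E) ?a \<cdot> l = curry V ?W (Prod V E E) ?b \<cdot> l \<and>
    (Ev V E K \<cdot> \<langle>Ide V ?W, Zero M \<cdot> bang V ?W\<rangle>) \<cdot> l = (Zero R \<cdot> bang V ?W) \<cdot> l \<and>
    curry V ?W (Prod V K E) ?c \<cdot> l = curry V ?W (Prod V K E) ?d \<cdot> l"
    by (simp only: linearity_pairs_def Let_def M_simps rig_module_simps ball_simps split simp_thms)
  also have "\<dots> \<longleftrightarrow> is_linear_element Y l"
    unfolding add act zero is_linear_element_def using l by blast
  finally show ?thesis .
qed

text \<open>
  A linear morphism satisfies equations between morphisms out of products, which amount to the
  equations for elements by taking the two product projections as the generic elements.
\<close>

lemma is_linear_iff:
  "is_linear V R M S f \<longleftrightarrow> f \<in> hom V E K \<and> is_linear_element (Tml V) (name V f)"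
proof (cases "f \<in> hom V E K")
  case f: True
  have "is_linear V R M S f \<longleftrightarrow>
    f \<cdot> Add M = Add R \<cdot> \<langle>f \<cdot> Fst V E E, f \<cdot> Snd V E E\<rangle> \<and> f \<cdot> Zero M = Zero R \<and>
    f \<cdot> Act M = Mul R \<cdot> \<langle>Fst V K E, f \<cdot> Snd V K E\<rangle>"
    using f is_rmodule_M is_rmodule_S by (simp add: is_linear_def Let_def)
  moreover have "f \<cdot> Add M = Add R \<cdot> \<langle>f \<cdot> Fst V E E, f \<cdot> Snd V E E\<rangle> \<longleftrightarrow>
    (\<forall>Z. \<forall>g \<in> hom V Z E. \<forall>h \<in> hom V Z E. f \<cdot> Add M \<cdot> \<langle>g, h\<rangle> = (f \<cdot> g) \<oplus> (f \<cdot> h))" (is "?l = ?r \<longleftrightarrow> ?q")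
  proof -
    have *: "?l \<cdot> \<langle>g, h\<rangle> = f \<cdot> Add M \<cdot> \<langle>g, h\<rangle>" "?r \<cdot> \<langle>g, h\<rangle> = (f \<cdot> g) \<oplus> (f \<cdot> h)"
      if "g \<in> hom V Z E" "h \<in> hom V Z E" for g h Z using that f by auto
    have FS: "Fst V E E \<in> hom V (Prod V E E) E" "Snd V E E \<in> hom V (Prod V E E) E" by auto
    have lr: "?l \<in> hom V (Prod V E E) K" "?r \<in> hom V (Prod V E E) K" using f by auto
    show ?thesis
    proof
      assume ?q
      then have "?l \<cdot> \<langle>Fst V E E, Snd V E E\<rangle> = ?r \<cdot> \<langle>Fst V E E, Snd V E E\<rangle>" using *[OF FS] FS by metis
      then show "?l = ?r" using lr by (simp add: pair_eta del: pair_comp comp_assoc')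
    qed (use * in metis)
  qed
  moreover have "f \<cdot> Act M = Mul R \<cdot> \<langle>Fst V K E, f \<cdot> Snd V K E\<rangle> \<longleftrightarrow>
    (\<forall>Z. \<forall>r \<in> hom V Z K. \<forall>g \<in> hom V Z E. f \<cdot> Act M \<cdot> \<langle>r, g\<rangle> = r \<otimes> (f \<cdot> g))" (is "?l = ?r \<longleftrightarrow> ?q")
  proof -
    have *: "?l \<cdot> \<langle>g, h\<rangle> = f \<cdot> Act M \<cdot> \<langle>g, h\<rangle>" "?r \<cdot> \<langle>g, h\<rangle> = g \<otimes> (f \<cdot> h)"
      if "g \<in> hom V Z K" "h \<in> hom V Z E" for g h Z using that f by auto
    have FS: "Fst V K E \<in> hom V (Prod V K E) K" "Snd V K E \<in> hom V (Prod V K E) E" by auto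
    have lr: "?l \<in> hom V (Prod V K E) K" "?r \<in> hom V (Prod V K E) K" using f by auto
    show ?thesis
    proof
      assume ?q
      then have "?l \<cdot> \<langle>Fst V K E, Snd V K E\<rangle> = ?r \<cdot> \<langle>Fst V K E, Snd V K E\<rangle>" using *[OF FS] FS by metis
      then show "?l = ?r" using lr by (simp add: pair_eta del: pair_comp comp_assoc')
    qed (use * in metis)
  qed
  moreover have "f \<cdot> Zero M = Zero R \<longleftrightarrow> (\<forall>Z \<in> Ob V. f \<cdot> Zero M \<cdot> bang V Z = zero Z)" (is "?l = ?r \<longleftrightarrow> ?q")
  proof
    assume lr: "?l = ?r"
    have "f \<cdot> Zero M \<cdot> bang V Z = ?l \<cdot> bang V Z" if "Z \<in> Ob V" for Z using f that by simp
    then show ?q unfolding lr by blast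
  next
    assume ?q
    then have "f \<cdot> Zero M \<cdot> bang V (Tml V) = zero (Tml V)" using tml_in_Ob by blast
    then show "?l = ?r" using f by (simp add: bang_tml)
  qed
  moreover have "is_linear_element (Tml V) (name V f) \<longleftrightarrow>
    (\<forall>Z. \<forall>e \<in> hom V Z (Tml V).
      (\<forall>g \<in> hom V Z E. \<forall>h \<in> hom V Z E. f \<cdot> Add M \<cdot> \<langle>g, h\<rangle> = (f \<cdot> g) \<oplus> (f \<cdot> h)) \<and>
      f \<cdot> Zero M \<cdot> bang V Z = zero Z \<and>
      (\<forall>r \<in> hom V Z K. \<forall>g \<in> hom V Z E. f \<cdot> Act M \<cdot> \<langle>r, g\<rangle> = r \<otimes> (f \<cdot> g)))"
  proof -
    have nf: "name V f \<in> hom V (Tml V) (Exp V E K)" using f by simp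
    have ev: "Ev V E K \<cdot> \<langle>name V f \<cdot> e, g\<rangle> = f \<cdot> g" if "e \<in> hom V Z (Tml V)" "g \<in> hom V Z E" for e g Z
      using that f by simp
    have MZ: "Add M \<cdot> \<langle>g, h\<rangle> \<in> hom V Z E" if "g \<in> hom V Z E" "h \<in> hom V Z E" for g h Z using that by simp
    have MA: "Act M \<cdot> \<langle>g, h\<rangle> \<in> hom V Z E" if "g \<in> hom V Z K" "h \<in> hom V Z E" for g h Z using that by simp
    have M0: "Zero M \<cdot> bang V Z \<in> hom V Z E" if "e \<in> hom V Z (Tml V)" for e Z using hom_Ob[OF that] by simp
    show ?thesis
      unfolding is_linear_element_def
      by (simp add: nf ev MZ MA M0 del: mem_hom name_beta name_beta_comp cong: ball_cong)
  qed
  ultimately show ?thesis using f bang_in_hom hom_Ob by (metis (no_types, lifting))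
qed (auto simp: is_linear_def Let_def)

text \<open>
  A matrix acts on \<open>[X,R\<^sup>n] \<cong> [X,R]\<^sup>n\<close> by linear combinations, so preservation of these is the form of
  linearity that can be compared with naturality.
\<close>

abbreviation "lincomb Z t g n \<equiv> vsum V M Z (\<lambda>j. Act M \<cdot> \<langle>t j, g j\<rangle>) n"

lemma lincomb_simps:
  assumes "Z \<in> Ob V" "\<And>j. j < n \<Longrightarrow> t j \<in> hom V Z K" "\<And>j. j < n \<Longrightarrow> g j \<in> hom V Z E"
  shows "lincomb Z t g n \<in> hom V Z E"
  using assms by simp

lemma lincomb_app:
  assumes Z: "Z \<in> Ob V" and t: "\<And>j. j < n \<Longrightarrow> t j \<in> hom V Z K" and g: "\<And>j. j < n \<Longrightarrow> g j \<in> hom V Z E"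
    and e: "e \<in> hom V W Z" and x: "x \<in> hom V W X"
  shows "Ev V X K \<cdot> \<langle>lincomb Z t g n \<cdot> e, x\<rangle> =
    vsum_rig W (\<lambda>j. (t j \<cdot> e) \<otimes> (Ev V X K \<cdot> \<langle>g j \<cdot> e, x\<rangle>)) n"
  using t g
proof (induction n)
  case 0
  then show ?case using e x Z hom_Ob[OF e] by simp
next
  case (Suc n)
  then show ?case using e x Z hom_Ob[OF e] by simp
qed

lemma linear_element_lincomb:
  assumes l: "is_linear_element Y l" and e: "e \<in> hom V Z Y"
    and t: "\<And>j. j < n \<Longrightarrow> t j \<in> hom V Z K" and g: "\<And>j. j < n \<Longrightarrow> g j \<in> hom V Z E"
  shows "Ev V E K \<cdot> \<langle>l \<cdot> e, lincomb Z t g n\<rangle> = vsum_rig Z (\<lambda>j. t j \<otimes> (Ev V E K \<cdot> \<langle>l \<cdot> e, g j\<rangle>)) n"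
  using t g
proof (induction n)
  case 0
  then show ?case using l e unfolding is_linear_element_def by simp
next
  case (Suc n)
  have Z: "Z \<in> Ob V" using e by auto
  have c: "lincomb Z t g n \<in> hom V Z E" "Act M \<cdot> \<langle>t n, g n\<rangle> \<in> hom V Z E"
    using Suc Z by simp_all
  have "Ev V E K \<cdot> \<langle>l \<cdot> e, Add M \<cdot> \<langle>lincomb Z t g n, Act M \<cdot> \<langle>t n, g n\<rangle>\<rangle>\<rangle> =
      (Ev V E K \<cdot> \<langle>l \<cdot> e, lincomb Z t g n\<rangle>) \<oplus> (Ev V E K \<cdot> \<langle>l \<cdot> e, Act M \<cdot> \<langle>t n, g n\<rangle>\<rangle>)"
    using l e c unfolding is_linear_element_def by blast
  moreover have "Ev V E K \<cdot> \<langle>l \<cdot> e, Act M \<cdot> \<langle>t n, g n\<rangle>\<rangle> = t n \<otimes> (Ev V E K \<cdot> \<langle>l \<cdot> e, g n\<rangle>)"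
    using l e Suc.prems unfolding is_linear_element_def by blast
  ultimately show ?case using Suc by simp
qed

text \<open>
  Zero, the action and addition are linear combinations of length zero, one and two.
\<close>

lemma linear_elementI:
  assumes l: "l \<in> hom V Y (Exp V E K)"
    and lc: "\<And>Z e n t g. e \<in> hom V Z Y \<Longrightarrow> (\<And>j. j < n \<Longrightarrow> t j \<in> hom V Z K) \<Longrightarrow>
      (\<And>j. j < n \<Longrightarrow> g j \<in> hom V Z E) \<Longrightarrow>
      Ev V E K \<cdot> \<langle>l \<cdot> e, lincomb Z t g n\<rangle> = vsum_rig Z (\<lambda>j. t j \<otimes> (Ev V E K \<cdot> \<langle>l \<cdot> e, g j\<rangle>)) n"
  shows "is_linear_element Y l"
  unfolding is_linear_element_def
proof (intro conjI allI ballI l)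
  fix Z e assume e: "e \<in> hom V Z Y"
  then have Z: "Z \<in> Ob V" by auto
  have Mzero: "Add M \<cdot> \<langle>Zero M \<cdot> bang V Z, x\<rangle> = x" if "x \<in> hom V Z E" for x
    by (rule E_ext[where Y = Z]) (use that Z in auto)
  have Mone: "Act M \<cdot> \<langle>one Z, x\<rangle> = x" if "x \<in> hom V Z E" for x
    by (rule E_ext[where Y = Z]) (use that Z in auto)
  show "Ev V E K \<cdot> \<langle>l \<cdot> e, Zero M \<cdot> bang V Z\<rangle> = zero Z"
    using lc[OF e, of 0] by simp
  show "Ev V E K \<cdot> \<langle>l \<cdot> e, Act M \<cdot> \<langle>r, g\<rangle>\<rangle> = r \<otimes> (Ev V E K \<cdot> \<langle>l \<cdot> e, g\<rangle>)"
    if "r \<in> hom V Z K" "g \<in> hom V Z E" for r g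
    using lc[OF e, of 1 "\<lambda>_. r" "\<lambda>_. g"] that e l Mzero[of "Act M \<cdot> \<langle>r, g\<rangle>"] by simp
  fix g h assume gh: "g \<in> hom V Z E" "h \<in> hom V Z E"
  have "Ev V E K \<cdot> \<langle>l \<cdot> e, lincomb Z (\<lambda>_. one Z) (\<lambda>j. if j = 0 then g else h) 2\<rangle> =
    vsum_rig Z (\<lambda>j. one Z \<otimes> (Ev V E K \<cdot> \<langle>l \<cdot> e, if j = 0 then g else h\<rangle>)) 2"
    by (rule lc[OF e]) (use gh Z in auto)
  then show "Ev V E K \<cdot> \<langle>l \<cdot> e, Add M \<cdot> \<langle>g, h\<rangle>\<rangle> = (Ev V E K \<cdot> \<langle>l \<cdot> e, g\<rangle>) \<oplus> (Ev V E K \<cdot> \<langle>l \<cdot> e, h\<rangle>)"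
    using gh l e Mzero[of g] Mone[of g] Mone[of h] Z by (simp add: numeral_2_eq_2)
qed

text \<open>
  Composition with the \<open>i\<close>-th projection of \<open>R\<^sup>n\<close>, i.e. the \<open>i\<close>-th coordinate of
  \<open>[X,R\<^sup>n] \<cong> [X,R]\<^sup>n\<close>.
\<close>

definition post :: "nat \<Rightarrow> nat \<Rightarrow> 'a" where
  "post n i = curry V (Exp V X (npow V K n)) X (nproj V K n i \<cdot> Ev V X (npow V K n))"

lemma post_simps [simp]:
  assumes "i < n"
  shows "post n i \<in> Ar V" "Dom V (post n i) = Exp V X (npow V K n)" "Cod V (post n i) = E"
    "g \<in> Ar V \<Longrightarrow> Cod V g = Exp V X (npow V K n) \<Longrightarrow> x \<in> Ar V \<Longrightarrow> Cod V x = X \<Longrightarrow> Dom V x = Dom V g \<Longrightarrow>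
      Ev V X K \<cdot> \<langle>post n i \<cdot> g, x\<rangle> = nproj V K n i \<cdot> Ev V X (npow V K n) \<cdot> \<langle>g, x\<rangle>"
  using assms by (simp_all add: post_def)

lemma post_1 [simp]:
  assumes "g \<in> Ar V" "Cod V g = E"
  shows "post (Suc 0) 0 \<cdot> g = g"
  by (rule E_ext[where Y = "Dom V g"]) (use assms in auto)

lemma post_surj:
  assumes "Z \<in> Ob V" and g: "\<And>j. j < n \<Longrightarrow> g j \<in> hom V Z E"
  shows "\<exists>h \<in> hom V Z (Exp V X (npow V K n)). \<forall>j<n. post n j \<cdot> h = g j"
proof (intro bexI allI impI)
  let ?h = "curry V Z X (ntuple V (Prod V Z X) K n (\<lambda>j. Ev V X K \<cdot> \<langle>g j \<cdot> Fst V Z X, Snd V Z X\<rangle>))"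
  show h: "?h \<in> hom V Z (Exp V X (npow V K n))" using assms by simp
  fix j assume j: "j < n"
  show "post n j \<cdot> ?h = g j"
    by (rule E_ext[where Y = Z]) (use j g assms h in auto)
qed

lemma XS_simps [simp]:
  "FHom XS n m \<in> Ar V" "Dom V (FHom XS n m) = H n m"
  "Cod V (FHom XS n m) = Exp V (Exp V X (npow V K n)) (Exp V X (npow V K m))"
  using prealgebra_simps[OF prealgebra_cotensor[OF prealgebra_commutant_alg X]] by auto

lemma mat_of_comp:
  assumes u: "u \<in> hom V Z (H n m)" and e: "e \<in> hom V W Z" and i: "i < m"
  shows "mat_of W n m (u \<cdot> e) i j = mat_of Z n m u i j \<cdot> e"
  using assms hom_Ob[OF e] by (simp add: mat_of_def family_matrix_def unitvec_comp)

text \<open>This is \<open>commutant_app\<close>, applied pointwise on \<open>X\<close>.\<close>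

lemma post_XS:
  assumes t: "t \<in> hom V Z (H n m)" and g: "g \<in> hom V Z (Exp V X (npow V K n))" and i: "i < m"
  shows "post m i \<cdot> Ev V (Exp V X (npow V K n)) (Exp V X (npow V K m)) \<cdot> \<langle>FHom XS n m \<cdot> t, g\<rangle> =
    lincomb Z (mat_of Z n m t i) (\<lambda>j. post n j \<cdot> g) n"
proof (rule E_ext[where Y = Z])
  have Z: "Z \<in> Ob V" using t by auto
  have a: "mat_of Z n m t i j \<in> hom V Z K" if "j < n" for j
    using mat_of_is_mat[OF t] i that by (simp add: is_mat_def)
  have pg: "post n j \<cdot> g \<in> hom V Z E" if "j < n" for j using g that by simp
  let ?tg = "Ev V (Exp V X (npow V K n)) (Exp V X (npow V K m)) \<cdot> \<langle>FHom XS n m \<cdot> t, g\<rangle>"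
  have tg: "?tg \<in> hom V Z (Exp V X (npow V K m))" using t g by simp
  show "post m i \<cdot> ?tg \<in> hom V Z E" using tg i by simp
  show "lincomb Z (mat_of Z n m t i) (\<lambda>j. post n j \<cdot> g) n \<in> hom V Z E"
    by (rule lincomb_simps[OF Z a pg])
  fix W e x assume e: "e \<in> hom V W Z" and x: "x \<in> hom V W X"
  have te: "t \<cdot> e \<in> hom V W (H n m)" using t e by simp
  have gx: "Ev V X (npow V K n) \<cdot> \<langle>g \<cdot> e, x\<rangle> \<in> hom V W (npow V K n)" using g e x by simp
  have "Ev V X K \<cdot> \<langle>(post m i \<cdot> ?tg) \<cdot> e, x\<rangle> =
      nproj V K m i \<cdot> Ev V (npow V K n) (npow V K m) \<cdot> \<langle>pr n m 1 \<cdot> t \<cdot> e, Ev V X (npow V K n) \<cdot> \<langle>g \<cdot> e, x\<rangle>\<rangle>"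
    using t g e x i cotensor_alg_app[OF prealgebra_commutant_alg X, of "t \<cdot> e" n m "g \<cdot> e" x]
    by (simp add: commutant_alg_FHom)
  also have "\<dots> = vsum_rig W (\<lambda>j. mat_of W n m (t \<cdot> e) i j \<otimes>
      (nproj V K n j \<cdot> Ev V X (npow V K n) \<cdot> \<langle>g \<cdot> e, x\<rangle>)) n"
    by (rule commutant_app[OF te gx i])
  also have "\<dots> = vsum_rig W (\<lambda>j. (mat_of Z n m t i j \<cdot> e) \<otimes> (Ev V X K \<cdot> \<langle>(post n j \<cdot> g) \<cdot> e, x\<rangle>)) n"
    by (intro vsum_cong refl) (use g e x in \<open>simp add: mat_of_comp[OF t e i]\<close>)
  also have "\<dots> = Ev V X K \<cdot> \<langle>lincomb Z (mat_of Z n m t i) (\<lambda>j. post n j \<cdot> g) n \<cdot> e, x\<rangle>"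
    by (rule lincomb_app[OF Z a pg e x, symmetric])
  finally show "Ev V X K \<cdot> \<langle>(post m i \<cdot> ?tg) \<cdot> e, x\<rangle> =
    Ev V X K \<cdot> \<langle>lincomb Z (mat_of Z n m t i) (\<lambda>j. post n j \<cdot> g) n \<cdot> e, x\<rangle>" .
qed

text \<open>
  A linear functional is extended to \<open>[X,R\<^sup>n] \<cong> [X,R]\<^sup>n\<close> coordinatewise.
\<close>

definition power_family :: "'o \<Rightarrow> 'a \<Rightarrow> nat \<Rightarrow> 'a" where
  "power_family Y l n = (let Q = Exp V X (npow V K n); P = Prod V Y Q in
    curry V Y Q (ntuple V P K n (\<lambda>i. Ev V E K \<cdot> \<langle>l \<cdot> Fst V Y Q, post n i \<cdot> Snd V Y Q\<rangle>)))"

lemma power_family_in_hom: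
  assumes "l \<in> hom V Y (Exp V E K)"
  shows "power_family Y l n \<in> hom V Y (Exp V (Exp V X (npow V K n)) (npow V K n))"
proof -
  have "Y \<in> Ob V" using assms by auto
  then show ?thesis using assms by (simp add: power_family_def Let_def)
qed

lemma power_family_app:
  assumes "l \<in> hom V Y (Exp V E K)" "e \<in> hom V Z Y" "g \<in> hom V Z (Exp V X (npow V K n))" "i < n"
  shows "nproj V K n i \<cdot> Ev V (Exp V X (npow V K n)) (npow V K n) \<cdot> \<langle>power_family Y l n \<cdot> e, g\<rangle> =
    Ev V E K \<cdot> \<langle>l \<cdot> e, post n i \<cdot> g\<rangle>"
  using assms hom_Ob[OF assms(2)] by (simp add: power_family_def Let_def)

lemma power_family_eqI:
  assumes l: "l \<in> hom V Y (Exp V E K)"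
    and k: "k \<in> hom V Y (Exp V (Exp V X (npow V K n)) (npow V K n))"
    and eq: "\<And>Z e g i. e \<in> hom V Z Y \<Longrightarrow> g \<in> hom V Z (Exp V X (npow V K n)) \<Longrightarrow> i < n \<Longrightarrow>
      nproj V K n i \<cdot> Ev V (Exp V X (npow V K n)) (npow V K n) \<cdot> \<langle>k \<cdot> e, g\<rangle> =
      Ev V E K \<cdot> \<langle>l \<cdot> e, post n i \<cdot> g\<rangle>"
  shows "k = power_family Y l n"
proof (rule exp_ext[OF k power_family_in_hom[OF l]])
  fix Z e g assume e: "e \<in> hom V Z Y" and g: "g \<in> hom V Z (Exp V X (npow V K n))"
  show "Ev V (Exp V X (npow V K n)) (npow V K n) \<cdot> \<langle>k \<cdot> e, g\<rangle> =
    Ev V (Exp V X (npow V K n)) (npow V K n) \<cdot> \<langle>power_family Y l n \<cdot> e, g\<rangle>"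
  proof (rule npow_ext[where X = Z and A = K and n = n])
    show "nproj V K n i \<cdot> Ev V (Exp V X (npow V K n)) (npow V K n) \<cdot> \<langle>k \<cdot> e, g\<rangle> =
        nproj V K n i \<cdot> Ev V (Exp V X (npow V K n)) (npow V K n) \<cdot> \<langle>power_family Y l n \<cdot> e, g\<rangle>"
      if "i < n" for i
      using eq[OF e g that] power_family_app[OF l e g that] by simp
  qed (use k power_family_in_hom[OF l, of n] e g in auto)
qed auto

lemma power_family_1:
  assumes "l \<in> hom V Y (Exp V E K)"
  shows "power_family Y l 1 = l"
proof (rule power_family_eqI[symmetric, OF assms])
  show "l \<in> hom V Y (Exp V (Exp V X (npow V K 1)) (npow V K 1))" using assms by simp
  show "nproj V K 1 i \<cdot> Ev V (Exp V X (npow V K 1)) (npow V K 1) \<cdot> \<langle>l \<cdot> e, g\<rangle> =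
      Ev V E K \<cdot> \<langle>l \<cdot> e, post 1 i \<cdot> g\<rangle>"
    if "e \<in> hom V Z Y" "g \<in> hom V Z (Exp V X (npow V K 1))" "i < 1" for Z e g i
    using that assms by simp
qed

lemma power_family_comp:
  assumes l: "l \<in> hom V Y (Exp V E K)" and h: "h \<in> hom V W Y"
  shows "power_family Y l n \<cdot> h = power_family W (l \<cdot> h) n"
proof (rule power_family_eqI)
  show "l \<cdot> h \<in> hom V W (Exp V E K)" using l h by simp
  show "power_family Y l n \<cdot> h \<in> hom V W (Exp V (Exp V X (npow V K n)) (npow V K n))"
    using power_family_in_hom[OF l, of n] h by simp
  fix Z e g i assume e: "e \<in> hom V Z W" and g: "g \<in> hom V Z (Exp V X (npow V K n))" and i: "i < n"
  have he: "h \<cdot> e \<in> hom V Z Y" using h e by simp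
  show "nproj V K n i \<cdot> Ev V (Exp V X (npow V K n)) (npow V K n) \<cdot> \<langle>(power_family Y l n \<cdot> h) \<cdot> e, g\<rangle> =
    Ev V E K \<cdot> \<langle>(l \<cdot> h) \<cdot> e, post n i \<cdot> g\<rangle>"
    using power_family_app[OF l he g i] power_family_in_hom[OF l, of n] l h e by simp
qed

text \<open>
  Linearity makes the coordinatewise extension commute with all matrices.
\<close>

lemma power_family_natural:
  assumes lin: "is_linear_element Y l"
  shows "is_natural_family V T' XS S' Y (power_family Y l)"
proof (rule natural_familyI[OF prealgebra_cotensor[OF prealgebra_commutant_alg X] prealgebra_commutant_alg])
  have l: "l \<in> hom V Y (Exp V E K)" using lin by (simp add: is_linear_element_def)
  note fam = power_family_in_hom[OF l]
  show "power_family Y l n \<in> hom V Y (Exp V (FOb XS n) (FOb S' n))" for n using fam by simp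
  fix n m Z e t g
  assume Z: "Z \<in> Ob V" and e: "e \<in> hom V Z Y" and "t \<in> hom V Z (VHom T' n m)" "g \<in> hom V Z (FOb XS n)"
  then have t: "t \<in> hom V Z (H n m)" and g: "g \<in> hom V Z (Exp V X (npow V K n))" by simp_all
  let ?lg = "Ev V (Exp V X (npow V K n)) (npow V K n) \<cdot> \<langle>power_family Y l n \<cdot> e, g\<rangle>"
  let ?tg = "Ev V (Exp V X (npow V K n)) (Exp V X (npow V K m)) \<cdot> \<langle>FHom XS n m \<cdot> t, g\<rangle>"
  have lg: "?lg \<in> hom V Z (npow V K n)" using fam[of n] e g by simp
  have tg: "?tg \<in> hom V Z (Exp V X (npow V K m))" using t g by simp
  have "Ev V (npow V K n) (npow V K m) \<cdot> \<langle>pr n m 1 \<cdot> t, ?lg\<rangle> =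
    Ev V (Exp V X (npow V K m)) (npow V K m) \<cdot> \<langle>power_family Y l m \<cdot> e, ?tg\<rangle>"
  proof (rule npow_ext[where X = Z and A = K and n = m])
    fix i assume i: "i < m"
    have a: "mat_of Z n m t i j \<in> hom V Z K" if "j < n" for j
      using mat_of_is_mat[OF t] i that by (simp add: is_mat_def)
    have pg: "post n j \<cdot> g \<in> hom V Z E" if "j < n" for j using g that by simp
    have "nproj V K m i \<cdot> Ev V (npow V K n) (npow V K m) \<cdot> \<langle>pr n m 1 \<cdot> t, ?lg\<rangle> =
        vsum_rig Z (\<lambda>j. mat_of Z n m t i j \<otimes> (nproj V K n j \<cdot> ?lg)) n"
      by (rule commutant_app[OF t lg i])
    also have "\<dots> = vsum_rig Z (\<lambda>j. mat_of Z n m t i j \<otimes> (Ev V E K \<cdot> \<langle>l \<cdot> e, post n j \<cdot> g\<rangle>)) n"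
      by (intro vsum_cong refl) (simp only: power_family_app[OF l e g])
    also have "\<dots> = Ev V E K \<cdot> \<langle>l \<cdot> e, lincomb Z (mat_of Z n m t i) (\<lambda>j. post n j \<cdot> g) n\<rangle>"
      by (rule linear_element_lincomb[OF lin e a pg, symmetric])
    also have "\<dots> = nproj V K m i \<cdot> Ev V (Exp V X (npow V K m)) (npow V K m) \<cdot>
        \<langle>power_family Y l m \<cdot> e, ?tg\<rangle>"
      unfolding power_family_app[OF l e tg i] post_XS[OF t g i] ..
    finally show "nproj V K m i \<cdot> Ev V (npow V K n) (npow V K m) \<cdot> \<langle>pr n m 1 \<cdot> t, ?lg\<rangle> =
      nproj V K m i \<cdot> Ev V (Exp V X (npow V K m)) (npow V K m) \<cdot> \<langle>power_family Y l m \<cdot> e, ?tg\<rangle>" .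
  qed (use t lg tg fam[of m] e in auto)
  then show "Ev V (FOb S' n) (FOb S' m) \<cdot> \<langle>FHom S' n m \<cdot> t,
      Ev V (FOb XS n) (FOb S' n) \<cdot> \<langle>power_family Y l n \<cdot> e, g\<rangle>\<rangle> =
    Ev V (FOb XS m) (FOb S' m) \<cdot> \<langle>power_family Y l m \<cdot> e,
      Ev V (FOb XS n) (FOb XS m) \<cdot> \<langle>FHom XS n m \<cdot> t, g\<rangle>\<rangle>"
    by (simp add: commutant_alg_FHom)
qed

text \<open>
  The commutant contains every row \<open>a : n \<rightarrow> 1\<close>, and naturality at this row is a statement about
  the linear combination with coefficients \<open>a\<close>.
\<close>

lemma natural_family_row:
  assumes l: "is_natural_family V T' XS S' Y l"
    and e: "e \<in> hom V Z Y" and a: "\<And>j. j < n \<Longrightarrow> a j \<in> hom V Z K"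
    and g: "g \<in> hom V Z (Exp V X (npow V K n))"
  shows "Ev V E K \<cdot> \<langle>l 1 \<cdot> e, lincomb Z a (\<lambda>j. post n j \<cdot> g) n\<rangle> =
    vsum_rig Z (\<lambda>j. a j \<otimes> (nproj V K n j \<cdot> Ev V (Exp V X (npow V K n)) (npow V K n) \<cdot> \<langle>l n \<cdot> e, g\<rangle>)) n"
proof -
  have Z: "Z \<in> Ob V" using e by auto
  have ln: "l n \<in> hom V Y (Exp V (Exp V X (npow V K n)) (npow V K n))"
    using natural_family_in_hom[OF l, of n] by simp
  have "is_mat Z 1 n (\<lambda>_ j. a j)" using a Z by (simp add: is_mat_def)
  from mat_of_surj[OF this] obtain t where t: "t \<in> hom V Z (H n 1)"
    and ta: "\<And>j. j < n \<Longrightarrow> mat_of Z n 1 t 0 j = a j" by auto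
  let ?lg = "Ev V (Exp V X (npow V K n)) (npow V K n) \<cdot> \<langle>l n \<cdot> e, g\<rangle>"
  let ?tg = "Ev V (Exp V X (npow V K n)) E \<cdot> \<langle>FHom XS n 1 \<cdot> t, g\<rangle>"
  have lg: "?lg \<in> hom V Z (npow V K n)" using ln e g by simp
  have "?tg = lincomb Z (mat_of Z n 1 t 0) (\<lambda>j. post n j \<cdot> g) n"
    using post_XS[OF t g, of 0] t g by simp
  also have "\<dots> = lincomb Z a (\<lambda>j. post n j \<cdot> g) n"
    by (intro vsum_cong refl) (simp only: ta)
  finally have tg: "?tg = lincomb Z a (\<lambda>j. post n j \<cdot> g) n" .
  have "Ev V (npow V K n) K \<cdot> \<langle>pr n 1 1 \<cdot> t, ?lg\<rangle> =
      vsum_rig Z (\<lambda>j. mat_of Z n 1 t 0 j \<otimes> (nproj V K n j \<cdot> ?lg)) n"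
    using commutant_app[OF t lg, of 0] t lg by simp
  also have "\<dots> = vsum_rig Z (\<lambda>j. a j \<otimes> (nproj V K n j \<cdot> ?lg)) n"
    by (intro vsum_cong refl) (simp only: ta)
  finally have "Ev V (npow V K n) K \<cdot> \<langle>pr n 1 1 \<cdot> t, ?lg\<rangle> =
      vsum_rig Z (\<lambda>j. a j \<otimes> (nproj V K n j \<cdot> ?lg)) n" .
  moreover have "Ev V E K \<cdot> \<langle>l 1 \<cdot> e, ?tg\<rangle> = Ev V (npow V K n) K \<cdot> \<langle>pr n 1 1 \<cdot> t, ?lg\<rangle>"
    using natural_familyD[OF l prealgebra_cotensor[OF prealgebra_commutant_alg X]
        prealgebra_commutant_alg e, of t n 1 g] t g by (simp add: commutant_alg_FHom)
  ultimately show ?thesis unfolding tg by simp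
qed

text \<open>A unit row selects one coordinate on both sides.\<close>

lemma natural_family_coordinate:
  assumes l: "is_natural_family V T' XS S' Y l"
    and e: "e \<in> hom V Z Y" and g: "g \<in> hom V Z (Exp V X (npow V K n))" and i: "i < n"
  shows "nproj V K n i \<cdot> Ev V (Exp V X (npow V K n)) (npow V K n) \<cdot> \<langle>l n \<cdot> e, g\<rangle> =
    Ev V E K \<cdot> \<langle>l 1 \<cdot> e, post n i \<cdot> g\<rangle>"
proof -
  have Z: "Z \<in> Ob V" using e by auto
  have ln: "l n \<in> hom V Y (Exp V (Exp V X (npow V K n)) (npow V K n))"
    using natural_family_in_hom[OF l, of n] by simp
  let ?d = "\<lambda>j. if i = j then one Z else zero Z"
  have d: "?d j \<in> hom V Z K" for j using Z by simp
  have pg: "post n j \<cdot> g \<in> hom V Z E" if "j < n" for j using g that by simp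
  have "lincomb Z ?d (\<lambda>j. post n j \<cdot> g) n = post n i \<cdot> g"
  proof (rule E_ext[OF lincomb_simps[OF Z d pg] pg[OF i]])
    fix W e x assume e: "e \<in> hom V W Z" and x: "x \<in> hom V W X"
    have W: "W \<in> Ob V" using e by auto
    have "Ev V X K \<cdot> \<langle>lincomb Z ?d (\<lambda>j. post n j \<cdot> g) n \<cdot> e, x\<rangle> =
      vsum_rig W (\<lambda>j. (?d j \<cdot> e) \<otimes> (Ev V X K \<cdot> \<langle>(post n j \<cdot> g) \<cdot> e, x\<rangle>)) n"
      by (rule lincomb_app[OF Z d pg e x])
    also have "\<dots> = vsum_rig W (\<lambda>j. (if i = j then one W else zero W) \<otimes>
        (Ev V X K \<cdot> \<langle>(post n j \<cdot> g) \<cdot> e, x\<rangle>)) n"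
      by (intro vsum_cong refl) (use e Z in auto)
    also have "\<dots> = Ev V X K \<cdot> \<langle>(post n i \<cdot> g) \<cdot> e, x\<rangle>"
      by (rule vsum_delta[OF W i]) (use g e x in auto)
    finally show "Ev V X K \<cdot> \<langle>lincomb Z ?d (\<lambda>j. post n j \<cdot> g) n \<cdot> e, x\<rangle> =
      Ev V X K \<cdot> \<langle>(post n i \<cdot> g) \<cdot> e, x\<rangle>" .
  qed
  with natural_family_row[where a = ?d, OF l e d g] have "Ev V E K \<cdot> \<langle>l 1 \<cdot> e, post n i \<cdot> g\<rangle> =
      vsum_rig Z (\<lambda>j. ?d j \<otimes> (nproj V K n j \<cdot> Ev V (Exp V X (npow V K n)) (npow V K n) \<cdot> \<langle>l n \<cdot> e, g\<rangle>)) n"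
    by simp
  also have "\<dots> = nproj V K n i \<cdot> Ev V (Exp V X (npow V K n)) (npow V K n) \<cdot> \<langle>l n \<cdot> e, g\<rangle>"
    by (rule vsum_delta[OF Z i]) (use ln e g in auto)
  finally show ?thesis by simp
qed

lemma natural_family_1_in_hom:
  "is_natural_family V T' XS S' Y l \<Longrightarrow> l 1 \<in> hom V Y (Exp V E K)"
  using natural_family_in_hom[of T' XS S' Y l 1] by simp

lemma natural_family_eq_power_family:
  assumes l: "is_natural_family V T' XS S' Y l"
  shows "l n = power_family Y (l 1) n"
  by (rule power_family_eqI[OF natural_family_1_in_hom[OF l]])
    (use natural_family_in_hom[OF l, of n] natural_family_coordinate[OF l] in simp_all)

text \<open>
  Any \<open>n\<close> elements of \<open>[X,R]\<close> are the coordinates of an element of \<open>[X,R\<^sup>n]\<close>, so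
  naturality at a row yields preservation of arbitrary linear combinations.
\<close>

lemma natural_family_is_linear:
  assumes l: "is_natural_family V T' XS S' Y l"
  shows "is_linear_element Y (l 1)"
proof (rule linear_elementI[OF natural_family_1_in_hom[OF l]])
  fix Z e and n :: nat and t g :: "nat \<Rightarrow> 'a"
  assume e: "e \<in> hom V Z Y" and t: "\<And>j. j < n \<Longrightarrow> t j \<in> hom V Z K" and g: "\<And>j. j < n \<Longrightarrow> g j \<in> hom V Z E"
  have Z: "Z \<in> Ob V" using e by auto
  have "\<exists>h \<in> hom V Z (Exp V X (npow V K n)). \<forall>j<n. post n j \<cdot> h = g j"
    by (rule post_surj[OF Z g])
  then obtain h where h: "h \<in> hom V Z (Exp V X (npow V K n))"
    "\<And>j. j < n \<Longrightarrow> post n j \<cdot> h = g j" by blast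
  have "lincomb Z t g n = lincomb Z t (\<lambda>j. post n j \<cdot> h) n"
    by (intro vsum_cong refl) (simp only: h(2))
  then have "Ev V E K \<cdot> \<langle>l 1 \<cdot> e, lincomb Z t g n\<rangle> = vsum_rig Z (\<lambda>j. t j \<otimes>
      (nproj V K n j \<cdot> Ev V (Exp V X (npow V K n)) (npow V K n) \<cdot> \<langle>l n \<cdot> e, h\<rangle>)) n"
    using natural_family_row[where a = t, OF l e t h(1)] by simp
  also have "\<dots> = vsum_rig Z (\<lambda>j. t j \<otimes> (Ev V E K \<cdot> \<langle>l 1 \<cdot> e, g j\<rangle>)) n"
    by (intro vsum_cong refl) (simp only: natural_family_coordinate[OF l e h(1)] h(2))
  finally show "Ev V E K \<cdot> \<langle>l 1 \<cdot> e, lincomb Z t g n\<rangle> =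
    vsum_rig Z (\<lambda>j. t j \<otimes> (Ev V E K \<cdot> \<langle>l 1 \<cdot> e, g j\<rangle>)) n" .
qed

text \<open>
  At every stage, natural families from \<open>[X,S']\<close> to \<open>S'\<close> correspond to linear elements by taking the
  component at \<open>1\<close>, and the equalizer classifies linear elements.
\<close>

lemma joint_equalizer_is_alg_obj:
  assumes eq: "is_joint_equalizer V (Exp V E K) (linearity_pairs V R M S) L j"
  shows "is_alg_obj V T' XS S' (L, power_family L j)"
proof -
  have j: "j \<in> hom V L (Exp V E K)" and "\<forall>(f, g) \<in> linearity_pairs V R M S. f \<cdot> j = g \<cdot> j"
    using eq by (auto simp: is_joint_equalizer_def)
  then have nat: "is_natural_family V T' XS S' L (power_family L j)"
    by (intro power_family_natural) (simp add: linearity_pairs_iff del: mem_hom)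
  have L: "L \<in> Ob V" using j by auto
  have "\<exists>!h. h \<in> hom V Y L \<and> (\<forall>n. power_family L j n \<cdot> h = k n)"
    if Y: "Y \<in> Ob V" and k: "is_natural_family V T' XS S' Y k" for Y k
  proof -
    note k1 = natural_family_1_in_hom[OF k]
    have "\<forall>(f, g) \<in> linearity_pairs V R M S. f \<cdot> k 1 = g \<cdot> k 1"
      using natural_family_is_linear[OF k] linearity_pairs_iff[OF k1] by blast
    then have "\<exists>!h. h \<in> hom V Y L \<and> j \<cdot> h = k 1"
      using eq k1 unfolding is_joint_equalizer_def by blast
    moreover
    have "(\<forall>n. power_family L j n \<cdot> h = k n) \<longleftrightarrow> j \<cdot> h = k 1" if h: "h \<in> hom V Y L" for h
    proof
      assume "\<forall>n. power_family L j n \<cdot> h = k n"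
      then show "j \<cdot> h = k 1" using power_family_1[OF j] by metis
    next
      assume *: "j \<cdot> h = k 1"
      show "\<forall>n. power_family L j n \<cdot> h = k n"
        by (simp only: power_family_comp[OF j h] * natural_family_eq_power_family[OF k, symmetric] simp_thms)
    qed
    then have "h \<in> hom V Y L \<and> (\<forall>n. power_family L j n \<cdot> h = k n) \<longleftrightarrow> h \<in> hom V Y L \<and> j \<cdot> h = k 1" for h
      by blast
    ultimately show ?thesis by presburger
  qed
  then show ?thesis using L nat unfolding is_alg_obj_def by blast
qed

lemma linearity_pairs_parallel:
  assumes "(f, g) \<in> linearity_pairs V R M S"
  shows "\<exists>B. f \<in> hom V (Exp V E K) B \<and> g \<in> hom V (Exp V E K) B"
  using assms unfolding linearity_pairs_def Let_def by auto

lemma finite_linearity_pairs: "finite (linearity_pairs V R M S)"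
  by (simp add: linearity_pairs_def Let_def)

lemma is_algebra_hom_iff:
  "is_algebra_hom V T' XS S' \<alpha> \<longleftrightarrow> (\<forall>n. \<alpha> n \<in> hom V (Exp V X (npow V K n)) (npow V K n)) \<and>
    is_natural_family V T' XS S' (Tml V) (\<lambda>n. name V (\<alpha> n))"
  by (simp add: is_algebra_hom_def cotensor_is_algebra commutant_alg_is_algebra)

text \<open>
  The correspondence of natural families and linear elements at the terminal object, where elements of
  internal homs are names of morphisms.
\<close>

lemma functional_distributions_bij:
  "bij_betw (\<lambda>\<mu>. \<mu> 1) (functional_distributions V T A X) {f. is_linear V R M S f}"
  unfolding functional_distributions_def Let_def
proof (intro bij_betwI')
  fix \<mu> \<nu> assume "\<mu> \<in> {\<mu>. is_algebra_hom V T' XS S' \<mu>}" "\<nu> \<in> {\<mu>. is_algebra_hom V T' XS S' \<mu>}"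
  then have \<mu>: "\<And>n. \<mu> n \<in> hom V (Exp V X (npow V K n)) (npow V K n)"
      "is_natural_family V T' XS S' (Tml V) (\<lambda>n. name V (\<mu> n))"
    and \<nu>: "\<And>n. \<nu> n \<in> hom V (Exp V X (npow V K n)) (npow V K n)"
      "is_natural_family V T' XS S' (Tml V) (\<lambda>n. name V (\<nu> n))"
    unfolding is_algebra_hom_iff by blast+
  show "\<mu> 1 = \<nu> 1 \<longleftrightarrow> \<mu> = \<nu>"
  proof
    assume eq: "\<mu> 1 = \<nu> 1"
    show "\<mu> = \<nu>"
    proof
      fix n
      have "name V (\<mu> n) = power_family (Tml V) (name V (\<mu> 1)) n"
        by (rule natural_family_eq_power_family[OF \<mu>(2)])
      also have "\<dots> = name V (\<nu> n)"
        unfolding eq by (rule natural_family_eq_power_family[OF \<nu>(2), symmetric])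
      finally show "\<mu> n = \<nu> n" by (rule name_inj[OF \<mu>(1) \<nu>(1)])
    qed
  qed simp
next
  fix \<mu> assume "\<mu> \<in> {\<mu>. is_algebra_hom V T' XS S' \<mu>}"
  then have \<mu>: "\<mu> 1 \<in> hom V (Exp V X (npow V K 1)) (npow V K 1)"
      "is_natural_family V T' XS S' (Tml V) (\<lambda>n. name V (\<mu> n))"
    unfolding is_algebra_hom_iff by blast+
  then show "\<mu> 1 \<in> {f. is_linear V R M S f}"
    using natural_family_is_linear[OF \<mu>(2)] by (simp add: is_linear_iff)
next
  fix f assume "f \<in> {f. is_linear V R M S f}"
  then have f: "f \<in> hom V E K" and lin: "is_linear_element (Tml V) (name V f)"
    by (simp_all add: is_linear_iff)
  let ?l = "power_family (Tml V) (name V f)"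
  have nf: "name V f \<in> hom V (Tml V) (Exp V E K)" using f by simp
  have "\<exists>h \<in> hom V (Exp V X (npow V K n)) (npow V K n). name V h = ?l n" for n
    by (rule name_surj) (use power_family_in_hom[OF nf] in auto)
  then obtain \<mu> where \<mu>: "\<And>n. \<mu> n \<in> hom V (Exp V X (npow V K n)) (npow V K n)" "\<And>n. name V (\<mu> n) = ?l n"
    by metis
  have "is_algebra_hom V T' XS S' \<mu>"
    unfolding is_algebra_hom_iff \<mu>(2) using \<mu>(1) power_family_natural[OF lin] by blast
  moreover have "f = \<mu> 1"
    by (rule name_inj[OF f]) (use \<mu>(1)[of 1] \<mu>(2)[of 1] power_family_1[OF nf] in simp_all)
  ultimately show "\<exists>\<mu> \<in> {\<mu>. is_algebra_hom V T' XS S' \<mu>}. f = \<mu> 1" by blast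
qed

text \<open>
  Both objects are ends of the same data, with the inclusions as components at \<open>1\<close>.
\<close>

lemma distribution_obj_iso:
  assumes "has_equalizers V"
  shows "\<exists>\<phi>. is_iso V (distribution_obj V T A X) (linear_obj V R M S) \<phi> \<and>
    linear_incl V R M S \<cdot> \<phi> = distribution_incl V T A X"
proof -
  let ?L = "linear_obj V R M S" and ?j = "linear_incl V R M S"
  have "\<exists>L j. is_joint_equalizer V (Exp V E K) (linearity_pairs V R M S) L j"
    by (rule joint_equalizer_exists[OF assms finite_linearity_pairs _ linearity_pairs_parallel]) simp_all
  then have "\<exists>p. is_linear_obj V R M S p" by (auto simp: is_linear_obj_def)
  then have "is_linear_obj V R M S (?L, ?j)"
    unfolding linear_obj_def linear_incl_def by (simp add: someI_ex)
  then have eq: "is_joint_equalizer V (Exp V E K) (linearity_pairs V R M S) ?L ?j"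
    by (simp add: is_linear_obj_def)
  then have j: "?j \<in> hom V ?L (Exp V E K)" by (simp add: is_joint_equalizer_def)
  note F = joint_equalizer_is_alg_obj[OF eq]
  from is_alg_obj_unique[OF alg_obj_props[OF F] F prealgebra_cotensor[OF prealgebra_commutant_alg X]
      prealgebra_commutant_alg] obtain \<phi>
    where "is_iso V (alg_obj V T' XS S') ?L \<phi>" "\<And>n. power_family ?L ?j n \<cdot> \<phi> = alg_pr V T' XS S' n"
    by blast
  moreover from this(2)[of 1] have "?j \<cdot> \<phi> = alg_pr V T' XS S' 1" unfolding power_family_1[OF j] .
  ultimately show ?thesis unfolding distribution_obj_def distribution_incl_def Let_def by blast
qed

end


section \<open>Functional distributions are linear functionals\<close>

theorem corollary7p5:
  fixes V :: "('o, 'a) ccc" and R :: "('o, 'a) rig" and X :: 'o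
  assumes "enrichment_base V"
    and "is_comm_rig V R"
    and "X \<in> Ob V"
  shows "bij_betw (\<lambda>\<mu>. \<mu> 1)
      (functional_distributions V (Mat V R) (module_alg V R (rig_module R)) X)
      {f. is_linear V R (cotensor_module V R X (rig_module R)) (rig_module R) f}
    \<and> (\<exists>\<phi>. is_iso V
        (distribution_obj V (Mat V R) (module_alg V R (rig_module R)) X)
        (linear_obj V R (cotensor_module V R X (rig_module R)) (rig_module R)) \<phi>
      \<and> Comp V (linear_incl V R (cotensor_module V R X (rig_module R)) (rig_module R)) \<phi>
        = distribution_incl V (Mat V R) (module_alg V R (rig_module R)) X)"
proof -
  interpret enrichment_base V by fact
  interpret comm_rig_cotensor V R X by standard fact+
  show ?thesis
    using functional_distributions_bij distribution_obj_iso[OF equalizers] by blast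
qed

end
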